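(* Let $\Phi:\mathbb{C}_+\to\mathbb{C}_+$ be analytic. Then $C_\Phi$, $C_\Phi f=f\circ\Phi$, defines a bounded composition operator from $\mathcal{A}(\mathbb{C}_+)$ into itself if and only if $\Phi\in\mathcal{G}_{\mathcal{A}}$.
   Context: $\mathbb{N}=\{1,2,\dots\}$. For $\theta\in\mathbb{R}$, $\mathbb{C}_\theta=\{s\in\mathbb{C}:\mathrm{Re}(s)>\theta\}$ and $\mathbb{C}_+=\mathbb{C}_0$. $\mathcal{D}$ is the set of Dirichlet series $\sum_{n\ge1}a_nn^{-s}$ that converge in some half-plane $\mathbb{C}_\theta$; an analytic function on $\mathbb{C}_+$ is said to be in $\mathcal{D}$ if it coincides with such a series on some half-plane. $\mathcal{A}(\mathbb{C}_+)$ (the algebra of Dirichlet series) is the set of Dirichlet series convergent in $\mathbb{C}_+$ whose sum is a uniformly continuous function on $\mathbb{C}_+$; it is a Banach algebra with the norm $\|f\|_\infty=\sup_{s\in\mathbb{C}_+}|f(s)|$. An analytic $\Phi:\mathbb{C}_+\to\mathbb{C}_+$ is in $\mathcal{G}_\infty$ if there are $c_\Phi\in\mathbb{N}\cup\{0\}$ and $\varphi\in\mathcal{D}$ with $\Phi(s)=c_\Phi s+\varphi(s)$. It is in $\mathcal{G}_{\mathcal{A}}$ if $\Phi\in\mathcal{G}_\infty$ and, for every $M>0$, $\Phi$ is uniformly continuous on $A_M=\{s\in\mathbb{C}_+:0<\mathrm{Re}(\Phi(s))<M\}$. *)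

theory Defs
  imports "HOL-Complex_Analysis.Complex_Analysis"
begin

definition half_plane :: "real \<Rightarrow> complex set" where
  "half_plane \<theta> = {s. Re s > \<theta>}"

text \<open>The summation index starts at 1, so \<open>a 0\<close> is never used. The series is only required to
  converge, not to converge absolutely.\<close>

definition has_dirichlet_series_on ::
    "(nat \<Rightarrow> complex) \<Rightarrow> (complex \<Rightarrow> complex) \<Rightarrow> complex set \<Rightarrow> bool" where
  "has_dirichlet_series_on a f S \<longleftrightarrow>
     (\<forall>s\<in>S. (\<lambda>n. a (Suc n) * of_nat (Suc n) powr (- s)) sums f s)"

text \<open>Functions on a half-plane are represented by total functions on \<^typ>\<open>complex\<close>. In all
  definitions below, the values outside \<open>half_plane 0\<close> are irrelevant (in \<open>dirichlet_class\<close> because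
  \<open>\<theta>\<close> can always be enlarged).\<close>

definition dirichlet_class :: "(complex \<Rightarrow> complex) set" where
  "dirichlet_class =
     {\<phi>. \<phi> holomorphic_on half_plane 0 \<and>
         (\<exists>a \<theta>. has_dirichlet_series_on a \<phi> (half_plane \<theta>))}"

definition dirichlet_algebra :: "(complex \<Rightarrow> complex) set" where
  "dirichlet_algebra =
     {f. (\<exists>a. has_dirichlet_series_on a f (half_plane 0)) \<and>
         uniformly_continuous_on (half_plane 0) f}"

text \<open>Members of \<open>dirichlet_algebra\<close> are bounded on \<open>half_plane 0\<close>: a Dirichlet series is bounded on
  some half-plane of absolute convergence, and a uniformly continuous function varies by a bounded
  amount across the remaining strip of finite width. The real supremum below is therefore the
  genuine one for them.\<close>

definition sup_norm :: "(complex \<Rightarrow> complex) \<Rightarrow> real" where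
  "sup_norm f = (SUP s\<in>half_plane 0. norm (f s))"

definition bounded_operator_on_algebra ::
    "((complex \<Rightarrow> complex) \<Rightarrow> (complex \<Rightarrow> complex)) \<Rightarrow> bool" where
  "bounded_operator_on_algebra T \<longleftrightarrow>
     (\<forall>f\<in>dirichlet_algebra. T f \<in> dirichlet_algebra) \<and>
     (\<forall>f\<in>dirichlet_algebra. \<forall>g\<in>dirichlet_algebra. \<forall>\<alpha> \<beta>. \<forall>s\<in>half_plane 0.
        T (\<lambda>z. \<alpha> * f z + \<beta> * g z) s = \<alpha> * T f s + \<beta> * T g s) \<and>
     (\<exists>C. \<forall>f\<in>dirichlet_algebra. sup_norm (T f) \<le> C * sup_norm f)"

definition composition_operator ::
    "(complex \<Rightarrow> complex) \<Rightarrow> (complex \<Rightarrow> complex) \<Rightarrow> (complex \<Rightarrow> complex)" where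
  "composition_operator \<Phi> f = f \<circ> \<Phi>"

definition G_infinity :: "(complex \<Rightarrow> complex) set" where
  "G_infinity =
     {\<Phi>. \<Phi> holomorphic_on half_plane 0 \<and> \<Phi> \<in> half_plane 0 \<rightarrow> half_plane 0 \<and>
         (\<exists>c::nat. \<exists>\<phi>\<in>dirichlet_class. \<forall>s\<in>half_plane 0. \<Phi> s = of_nat c * s + \<phi> s)}"

definition G_algebra :: "(complex \<Rightarrow> complex) set" where
  "G_algebra =
     {\<Phi>\<in>G_infinity. \<forall>M>0.
         uniformly_continuous_on {s\<in>half_plane 0. 0 < Re (\<Phi> s) \<and> Re (\<Phi> s) < M} \<Phi>}"

end

theory Submission
  imports Defs
begin

text \<open>Suppose \<open>C\<^sub>\<Phi>\<close> acts on the algebra, so that every \<open>n powr - \<Phi>\<close> is a Dirichlet series. Taking logarithms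
  of \<open>n powr - \<Phi>(s) = b N\<^bsup>-s\<^esup> (1 + \<dots>)\<close>, with \<open>b N\<^bsup>-s\<^esup>\<close> the leading term, gives \<open>\<Phi>(s) = c s + \<phi>(s)\<close> with
  \<open>c = ln N / ln n\<close>. Comparing growth, \<open>c\<close> does not depend on \<open>n\<close>, so \<open>n\<^bsup>c\<^esup>\<close> is an integer for every \<open>n\<close>,
  which forces \<open>c\<close> to be one. The frequencies of \<open>\<phi>\<close> have denominators dividing a power of \<open>n\<close>; taking
  \<open>n = 2\<close> and \<open>n = 3\<close> they must be integers. Uniform continuity of \<open>\<Phi>\<close> where \<open>Re \<Phi> < M\<close> follows from that of
  \<open>2 powr - \<Phi>\<close>, which is bounded away from \<open>0\<close> there.

  Conversely, \<open>f \<circ> \<Phi>\<close> is a bounded holomorphic function given by an absolutely convergent Dirichlet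
  series far to the right, so the series converges on the whole half-plane by Bohr's theorem. It is
  uniformly continuous because \<open>f\<close> is, and because \<open>f\<close> is nearly constant where \<open>Re \<Phi>\<close> is large.\<close>

section \<open>Integer-valued real powers\<close>

text \<open>Members of the algebra may converge only conditionally on \<open>half_plane 0\<close>,
  whereas products, logarithms and compositions need rearrangement. All such operations are
  therefore done far to the right, where the coefficients are absolutely summable, and where moving
  the abscissa further right makes everything small compared with the leading term. Bohr's theorem
  brings the result back to \<open>half_plane 0\<close>. Two points need extra care. A logarithm is
  only known modulo \<open>2 * pi * \<i>\<close>, both when \<Phi> is recovered from
  \<open>n powr - \<Phi>\<close> and when its uniform continuity is read off from
  \<open>2 powr - \<Phi>\<close>; each time a continuous function on a connected set with values in
  a discrete set is shown to be constant. And if c = 0, the factor \<open>n powr - (c * s)\<close>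
  supplies no decay, so \<Phi> cannot be substituted termwise into the series of f; instead f is
  expanded in a Taylor disc around the constant coefficient of \<phi>, which must first be shown to
  lie inside the open half-plane.\<close>

primrec fdiff :: "nat \<Rightarrow> (real \<Rightarrow> real) \<Rightarrow> real \<Rightarrow> real" where
  "fdiff 0 f = f"
| "fdiff (Suc k) f = fdiff k (\<lambda>x. f (x + 1) - f x)"

lemma fdiff_Ints:
  assumes "\<And>n::nat. n \<ge> 1 \<Longrightarrow> f (real n) \<in> \<int>" "n \<ge> 1"
  shows "fdiff k f (real n) \<in> \<int>"
  using assms
proof (induction k arbitrary: f)
  case 0
  then show ?case by simp
next
  case (Suc k)
  have "f (real n + 1) - f (real n) \<in> \<int>" if "n \<ge> 1" for n :: nat
  proof -
    have "f (real (Suc n)) \<in> \<int>" by (rule Suc.prems(1)) simp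
    then show ?thesis
      using Suc.prems(1)[OF that] by (intro Ints_diff) (simp_all add: add.commute)
  qed
  from Suc.IH[of "\<lambda>x. f (x + 1) - f x", OF this Suc.prems(2)] show ?case by simp
qed

text \<open>Iterated mean value theorem. The family is kept as a sequence of successive derivatives
  because the unit differences \<open>G j\<close> form such a sequence again: the induction
  hypothesis applied to \<open>G\<close> gives \<open>G k y\<close>, and one ordinary mean value
  step turns this first difference into \<open>F (Suc k) z\<close>.\<close>

lemma fdiff_mvt:
  assumes "\<And>j x. x > 0 \<Longrightarrow> (F j has_real_derivative F (Suc j) x) (at x)" "x > 0"
  shows "\<exists>\<xi>\<ge>x. fdiff k (F 0) x = F k \<xi>"
  using assms
proof (induction k arbitrary: F)
  case 0
  then show ?case by auto
next
  case (Suc k)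
  define G where "G j x = F j (x + 1) - F j x" for j x
  have "(G j has_real_derivative G (Suc j) x) (at x)" if "x > 0" for j x
    unfolding G_def using that
    by (intro DERIV_diff Suc.prems(1) DERIV_shift[THEN iffD1]) auto
  from Suc.IH[of G, OF this Suc.prems(2)] obtain y where y: "y \<ge> x" "fdiff k (G 0) x = G k y"
    by blast
  have "\<exists>z. y < z \<and> z < y + 1 \<and> F k (y + 1) - F k y = (y + 1 - y) * F (Suc k) z"
    using y Suc.prems by (intro MVT2) auto
  then obtain z where z: "y < z" "F k (y + 1) - F k y = F (Suc k) z" by auto
  have "fdiff (Suc k) (F 0) x = F (Suc k) z"
    using y(2) z(2) by (simp add: G_def[abs_def])
  then show ?case using y(1) z(1) by (intro exI[of _ z]) auto
qed

text \<open>Take the difference of order k, where k is the first integer above c. It is an integer,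
  and by the mean value theorem it equals \<open>C * \<xi> powr (c - k)\<close> with \<xi> at least
  n. The exponent is negative, so this is less than 1 in modulus for large n; it is nonzero because
  the product \<open>C\<close> vanishes only for natural c.\<close>

lemma Nats_of_powr_Ints:
  fixes c :: real
  assumes int: "\<And>n::nat. n \<ge> 1 \<Longrightarrow> real n powr c \<in> \<int>" and "c \<ge> 0"
  shows "c \<in> \<nat>"
proof (rule ccontr)
  assume c: "c \<notin> \<nat>"
  define F where "F j x = (\<Prod>i<j. c - real i) * x powr (c - real j)" for j x
  have der: "(F j has_real_derivative F (Suc j) x) (at x)" if "x > 0" for j x
    unfolding F_def using that
    by (auto intro!: derivative_eq_intros simp: algebra_simps)
  define k where "k = Suc (nat \<lfloor>c\<rfloor>)"
  define C where "C = (\<Prod>i<k. c - real i)"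
  have "C \<noteq> 0" using c by (auto simp: C_def)
  have k: "c - real k < 0" using \<open>c \<ge> 0\<close> unfolding k_def by linarith
  have "((\<lambda>n. \<bar>C\<bar> * real n powr (c - real k)) \<longlongrightarrow> \<bar>C\<bar> * 0) sequentially"
    by (intro tendsto_mult tendsto_const tendsto_neg_powr k filterlim_real_sequentially)
  then have "eventually (\<lambda>n. \<bar>C\<bar> * real n powr (c - real k) < 1) sequentially"
    by (intro order_tendstoD) auto
  then obtain n where n: "\<bar>C\<bar> * real n powr (c - real k) < 1" "n \<ge> 1"
    using eventually_ge_at_top[of 1] by (metis (mono_tags, lifting) eventually_at_top_linorder linorder_le_cases)
  obtain \<xi> where \<xi>: "\<xi> \<ge> real n" "fdiff k (F 0) (real n) = F k \<xi>"
    using fdiff_mvt[of F "real n" k] der n(2) by auto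
  have "F k \<xi> \<in> \<int>"
    unfolding \<xi>(2)[symmetric] using n(2) int by (intro fdiff_Ints) (auto simp: F_def)
  moreover have "\<bar>F k \<xi>\<bar> \<le> \<bar>C\<bar> * real n powr (c - real k)"
    unfolding F_def C_def[symmetric] abs_mult using \<xi> n k
    by (intro mult_left_mono) (auto intro!: powr_mono2')
  moreover have "F k \<xi> \<noteq> 0" using \<open>C \<noteq> 0\<close> \<xi> n by (auto simp: F_def C_def)
  ultimately show False
    using n(1) Ints_nonzero_abs_less1 by fastforce
qed

section \<open>Bohr's theorem\<close>

text \<open>The Perron integral is cut off at height \<open>T\<close>. Every estimate carries an
  explicit error in \<open>T\<close>, and \<open>T\<close> tends to infinity only at the very end,
  so no improper integral occurs.\<close>

definition vint :: "real \<Rightarrow> real \<Rightarrow> (complex \<Rightarrow> complex) \<Rightarrow> complex" where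
  "vint c T f = contour_integral (linepath (Complex c (-T)) (Complex c T)) f"

lemma closed_segment_vertical:
  "T \<ge> 0 \<Longrightarrow> closed_segment (Complex c (-T)) (Complex c T) = {w. Re w = c \<and> \<bar>Im w\<bar> \<le> T}"
  by (auto simp: closed_segment_same_Re closed_segment_eq_real_ivl)

lemma norm_vint_le:
  assumes "T > 0" "continuous_on {w. Re w = c \<and> \<bar>Im w\<bar> \<le> T} f"
    and "\<And>w. Re w = c \<Longrightarrow> \<bar>Im w\<bar> \<le> T \<Longrightarrow> norm (f w) \<le> B"
  shows "norm (vint c T f) \<le> B * (2 * T)"
proof -
  have B: "B \<ge> 0" using assms(3)[of "Complex c 0"] \<open>T > 0\<close> by (auto intro: order_trans[OF norm_ge_zero])
  have "norm (vint c T f) \<le> B * norm (Complex c T - Complex c (-T))"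
    unfolding vint_def using assms B
    by (intro contour_integral_bound_linepath contour_integrable_continuous_linepath)
       (auto simp: closed_segment_vertical)
  also have "Complex c T - Complex c (-T) = of_real (2 * T) * \<i>" by (simp add: complex_eq_iff)
  finally show ?thesis using \<open>T > 0\<close> by (simp add: norm_mult)
qed

lemma rectpath_vint:
  assumes "a < b" "T > 0"
    and cont: "continuous_on (path_image (rectpath (Complex a (-T)) (Complex b T))) f"
    and M: "\<And>w. Re w \<in> {a..b} \<Longrightarrow> \<bar>Im w\<bar> = T \<Longrightarrow> norm (f w) \<le> M"
  shows "norm (vint b T f - vint a T f - contour_integral (rectpath (Complex a (-T)) (Complex b T)) f)
           \<le> 2 * (b - a) * M"
proof -
  let ?a1 = "Complex a (-T)" and ?a2 = "Complex b (-T)" and ?a3 = "Complex b T" and ?a4 = "Complex a T"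
  have pi: "path_image (rectpath ?a1 ?a3) =
      closed_segment ?a1 ?a2 \<union> closed_segment ?a2 ?a3 \<union> closed_segment ?a3 ?a4 \<union> closed_segment ?a4 ?a1"
    by (simp add: rectpath_def Let_def path_image_join Un_assoc)
  have c: "continuous_on (closed_segment ?a1 ?a2) f" "continuous_on (closed_segment ?a2 ?a3) f"
    "continuous_on (closed_segment ?a3 ?a4) f" "continuous_on (closed_segment ?a4 ?a1) f"
    by (rule continuous_on_subset[OF cont], unfold pi, blast)+
  note int = c[THEN contour_integrable_continuous_linepath]
  have "contour_integral (rectpath ?a1 ?a3) f =
      contour_integral (linepath ?a1 ?a2) f + vint b T f + contour_integral (linepath ?a3 ?a4) f
        + contour_integral (linepath ?a4 ?a1) f"
    using int by (simp add: rectpath_def Let_def vint_def add.assoc)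
  also have "contour_integral (linepath ?a4 ?a1) f = - vint a T f"
    unfolding vint_def using c(4) by (rule contour_integral_reverse_linepath)
  finally have eq: "vint b T f - vint a T f - contour_integral (rectpath ?a1 ?a3) f =
      - (contour_integral (linepath ?a1 ?a2) f + contour_integral (linepath ?a3 ?a4) f)"
    by simp
  have "norm (f ?a1) \<le> M" using assms by (intro M) auto
  then have "M \<ge> 0" by (rule order_trans[OF norm_ge_zero])
  have "norm (contour_integral (linepath ?a1 ?a2) f) \<le> M * norm (?a2 - ?a1)"
    using assms \<open>M \<ge> 0\<close> by (intro contour_integral_bound_linepath int M)
      (auto simp: closed_segment_same_Im closed_segment_eq_real_ivl)
  moreover have "norm (contour_integral (linepath ?a3 ?a4) f) \<le> M * norm (?a4 - ?a3)"
    using assms \<open>M \<ge> 0\<close> by (intro contour_integral_bound_linepath int M)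
      (auto simp: closed_segment_same_Im closed_segment_eq_real_ivl)
  moreover have "?a2 - ?a1 = of_real (b - a)" "?a4 - ?a3 = - of_real (b - a)"
    by (auto simp: complex_eq_iff)
  ultimately have "norm (contour_integral (linepath ?a1 ?a2) f + contour_integral (linepath ?a3 ?a4) f)
     \<le> M * (b - a) + M * (b - a)"
    using \<open>a < b\<close> by (intro norm_triangle_mono) (auto simp del: of_real_diff)
  then show ?thesis unfolding eq norm_minus_cancel by (simp add: algebra_simps)
qed

lemma norm_divide_sq_le:
  fixes F w :: complex
  assumes "norm F \<le> M" "norm w \<ge> T" "T > 0"
  shows "norm (F / w\<^sup>2) \<le> M / T\<^sup>2"
proof -
  have "norm (F / w\<^sup>2) = norm F / (norm w)\<^sup>2" by (simp add: norm_divide norm_power)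
  also have "\<dots> \<le> M / T\<^sup>2"
    using assms by (intro frac_le power_mono) (auto intro: order_trans[OF norm_ge_zero])
  finally show ?thesis .
qed

text \<open>The kernel \<open>1 / w\<^sup>2\<close> has a double pole, so the residue is
  \<open>deriv F 0\<close> instead of \<open>F 0\<close>. In exchange the horizontal sides
  contribute only \<open>O(M / T\<^sup>2)\<close>, and the vertical integrals converge absolutely
  for bounded F.\<close>

lemma vint_shift:
  assumes "a < b" "T > 0" "0 \<notin> {a, b}" "open S" "convex S"
    and S: "{w. a \<le> Re w \<and> Re w \<le> b \<and> \<bar>Im w\<bar> \<le> T} \<subseteq> S" and F: "F holomorphic_on S"
    and M: "\<And>w. Re w \<in> {a..b} \<Longrightarrow> \<bar>Im w\<bar> = T \<Longrightarrow> norm (F w) \<le> M"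
  shows "norm (vint b T (\<lambda>w. F w / w\<^sup>2) - vint a T (\<lambda>w. F w / w\<^sup>2)
           - (if a < 0 \<and> 0 < b then 2 * pi * \<i> * deriv F 0 else 0)) \<le> 2 * (b - a) * (M / T\<^sup>2)"
proof -
  let ?R = "rectpath (Complex a (-T)) (Complex b T)"
  let ?f = "\<lambda>w. F w / w\<^sup>2"
  have pi: "path_image ?R = {z. Re z \<in> {a, b} \<and> Im z \<in> {-T..T}} \<union> {z. Im z \<in> {-T, T} \<and> Re z \<in> {a..b}}"
    using assms by (simp add: path_image_rectpath)
  have sub: "path_image ?R \<subseteq> S - {0}" using S assms unfolding pi by auto
  have hol: "?f holomorphic_on S - {0}"
    using F by (intro holomorphic_intros) (auto intro: holomorphic_on_subset)
  have cont: "continuous_on (path_image ?R) ?f"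
    using holomorphic_on_imp_continuous_on[OF hol] sub by (rule continuous_on_subset)
  have bnd: "norm (?f w) \<le> M / T\<^sup>2" if "Re w \<in> {a..b}" "\<bar>Im w\<bar> = T" for w
    using that M abs_Im_le_cmod[of w] \<open>T > 0\<close> by (intro norm_divide_sq_le) auto
  have "contour_integral ?R ?f = (if a < 0 \<and> 0 < b then 2 * pi * \<i> * deriv F 0 else 0)"
  proof (cases "0 \<in> S")
    case True
    have "contour_integral ?R ?f = 2 * pi * \<i> * (\<Sum>p\<in>{0}. winding_number ?R p * residue ?f p)"
    proof (rule Residue_theorem)
      show "\<forall>z. z \<notin> S \<longrightarrow> winding_number ?R z = 0"
        using sub \<open>convex S\<close> by (auto intro!: winding_number_zero_outside[of _ S])
    qed (use assms hol sub in \<open>auto intro: convex_connected\<close>)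
    also have "(\<Sum>p\<in>{0}. winding_number ?R p * residue ?f p) = winding_number ?R 0 * residue ?f 0"
      by simp
    also have "residue ?f 0 = deriv F 0"
      using residue_holomorphic_over_power'[OF \<open>open S\<close> True F, of 1] by (simp add: numeral_2_eq_2)
    also have "winding_number ?R 0 = (if a < 0 \<and> 0 < b then 1 else 0)"
    proof (cases "a < 0 \<and> 0 < b")
      case True
      then show ?thesis using \<open>T > 0\<close> by (auto intro!: winding_number_rectpath simp: in_box_complex_iff)
    next
      case False
      then show ?thesis using assms by (auto intro!: winding_number_rectpath_outside simp: in_cbox_complex_iff)
    qed
    finally show ?thesis by simp
  next
    case False
    then have "\<not> (a < 0 \<and> 0 < b)" using S[THEN subsetD, of 0] assms by auto
    moreover have "(?f has_contour_integral 0) ?R"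
      using hol sub False \<open>convex S\<close> by (intro Cauchy_theorem_convex_simple[of _ S]) auto
    ultimately show ?thesis by (auto dest: contour_integral_unique)
  qed
  with rectpath_vint[OF assms(1,2) cont bnd] show ?thesis by simp
qed

lemma norm_le_of_norm_diff_le:
  fixes x y z :: "'a :: real_normed_vector"
  shows "norm (x - y - z) \<le> A \<Longrightarrow> norm y \<le> B \<Longrightarrow> norm (x - z) \<le> A + B"
  using norm_triangle_ineq[of "x - y - z" y] by (simp add: algebra_simps)

text \<open>The line of integration is moved to the left for \<open>x \<ge> 0\<close> and to the right for \<open>x < 0\<close>, where the
  exponential decays.\<close>

lemma vint_exp_over_square:
  assumes "\<kappa> > 0" "T \<ge> \<kappa>"
  shows "norm (vint \<kappa> T (\<lambda>w. exp (of_real x * w) / w\<^sup>2) - 2 * pi * \<i> * of_real (max 0 x)) \<le> 6 * exp (\<kappa> * x) / T"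
proof (cases "x \<ge> 0")
  case True
  have T: "T > 0" using assms by simp
  have e: "x * Re w \<le> \<kappa> * x" if "Re w \<le> \<kappa>" for w
    using mult_left_mono[OF that True] by (simp add: mult.commute)
  \<comment> \<open>The left edge is placed at \<open>-T\<close>: every point of it has modulus at
    least \<open>T\<close> and its length is \<open>2 * T\<close>, so it costs
    \<open>O(1 / T)\<close>, and so do the horizontal sides of length at most
    \<open>2 * T\<close>.\<close>
  have "norm (vint \<kappa> T (\<lambda>w. exp (of_real x * w) / w\<^sup>2) - vint (-T) T (\<lambda>w. exp (of_real x * w) / w\<^sup>2)
           - (if -T < 0 \<and> 0 < \<kappa> then 2 * pi * \<i> * deriv (\<lambda>w. exp (of_real x * w)) 0 else 0))
           \<le> 2 * (\<kappa> - (-T)) * (exp (\<kappa> * x) / T\<^sup>2)"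
    using assms T by (intro vint_shift[where S = UNIV]) (auto intro!: holomorphic_intros intro: e)
  moreover have "deriv (\<lambda>w. exp (of_real x * w)) 0 = complex_of_real x"
    by (rule DERIV_imp_deriv) (auto intro!: derivative_eq_intros)
  moreover have "norm (vint (-T) T (\<lambda>w. exp (of_real x * w) / w\<^sup>2)) \<le> (exp (\<kappa> * x) / T\<^sup>2) * (2 * T)"
  proof (rule norm_vint_le)
    show "continuous_on {w. Re w = -T \<and> \<bar>Im w\<bar> \<le> T} (\<lambda>w. exp (of_real x * w) / w\<^sup>2)"
      using T by (intro continuous_intros) auto
    fix w assume w: "Re w = -T" "\<bar>Im w\<bar> \<le> T"
    then have "norm w \<ge> T" using abs_Re_le_cmod[of w] T by simp
    with e[of w] w T assms show "norm (exp (of_real x * w) / w\<^sup>2) \<le> exp (\<kappa> * x) / T\<^sup>2"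
      by (intro norm_divide_sq_le) auto
  qed (use T in auto)
  ultimately have *: "norm (vint \<kappa> T (\<lambda>w. exp (of_real x * w) / w\<^sup>2) - 2 * pi * \<i> * x)
    \<le> 2 * (\<kappa> + T) * (exp (\<kappa> * x) / T\<^sup>2) + (exp (\<kappa> * x) / T\<^sup>2) * (2 * T)"
    using T assms by (intro norm_le_of_norm_diff_le) simp_all
  \<comment> \<open>Origin of the constant 6: with \<kappa> \<le> T the horizontal sides give 4 and
    the left edge gives 2. For negative x the same count is 2 + 2.\<close>
  have "2 * (\<kappa> + T) * (exp (\<kappa> * x) / T\<^sup>2) + (exp (\<kappa> * x) / T\<^sup>2) * (2 * T)
     \<le> 2 * (T + T) * (exp (\<kappa> * x) / T\<^sup>2) + (exp (\<kappa> * x) / T\<^sup>2) * (2 * T)"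
    using assms by (intro add_right_mono mult_right_mono mult_left_mono) auto
  also have "\<dots> = 6 * exp (\<kappa> * x) / T" using T by (simp add: field_simps power2_eq_square)
  finally show ?thesis using * True by simp
next
  case False
  have T: "T > 0" using assms by simp
  have e: "x * Re w \<le> \<kappa> * x" if "Re w \<ge> \<kappa>" for w
    using False mult_left_mono_neg[OF that, of x] by (simp add: mult.commute)
  let ?V = "\<lambda>c. vint c T (\<lambda>w. exp (of_real x * w) / w\<^sup>2)"
  have "norm (vint (\<kappa> + T) T (\<lambda>w. exp (of_real x * w) / w\<^sup>2) - vint \<kappa> T (\<lambda>w. exp (of_real x * w) / w\<^sup>2)
           - (if \<kappa> < 0 \<and> 0 < \<kappa> + T then 2 * pi * \<i> * deriv (\<lambda>w. exp (of_real x * w)) 0 else 0))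
           \<le> 2 * ((\<kappa> + T) - \<kappa>) * (exp (\<kappa> * x) / T\<^sup>2)"
    using assms T by (intro vint_shift[where S = UNIV]) (auto intro!: holomorphic_intros intro: e)
  then have "norm (?V (\<kappa> + T) - ?V \<kappa>) \<le> 2 * T * (exp (\<kappa> * x) / T\<^sup>2)"
    using \<open>\<kappa> > 0\<close> by simp
  moreover have "norm (vint (\<kappa> + T) T (\<lambda>w. exp (of_real x * w) / w\<^sup>2)) \<le> (exp (\<kappa> * x) / T\<^sup>2) * (2 * T)"
  proof (rule norm_vint_le)
    show "continuous_on {w. Re w = \<kappa> + T \<and> \<bar>Im w\<bar> \<le> T} (\<lambda>w. exp (of_real x * w) / w\<^sup>2)"
      using T assms by (intro continuous_intros) auto
    fix w assume w: "Re w = \<kappa> + T" "\<bar>Im w\<bar> \<le> T"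
    then have "norm w \<ge> T" using abs_Re_le_cmod[of w] T assms by simp
    with e[of w] w T assms show "norm (exp (of_real x * w) / w\<^sup>2) \<le> exp (\<kappa> * x) / T\<^sup>2"
      by (intro norm_divide_sq_le) auto
  qed (use T in auto)
  ultimately have *: "norm (vint \<kappa> T (\<lambda>w. exp (of_real x * w) / w\<^sup>2))
    \<le> 2 * T * (exp (\<kappa> * x) / T\<^sup>2) + (exp (\<kappa> * x) / T\<^sup>2) * (2 * T)"
    using norm_triangle_ineq2[of "?V \<kappa>" "?V (\<kappa> + T)"] norm_minus_commute[of "?V \<kappa>" "?V (\<kappa> + T)"]
    by linarith
  also have "\<dots> = 4 * exp (\<kappa> * x) / T" using T by (simp add: field_simps power2_eq_square)
  also have "\<dots> \<le> 6 * exp (\<kappa> * x) / T" using T by (intro divide_right_mono) auto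
  finally show ?thesis using False by simp
qed

text \<open>On a finite segment of \<open>Re w = \<kappa>\<close> the series converges uniformly, so
  it may be integrated termwise. Replacing the n-th integral by its limit costs
  \<open>6 * exp (\<kappa> * (X - l n)) / T\<close>, and these errors are summable against
  \<open>b\<close>. The double pole produces the weights \<open>max 0 (X - l n)\<close>, that is, a
  Riesz mean of order one; its summability follows from the same comparison.\<close>

lemma perron_sum:
  fixes b :: "nat \<Rightarrow> complex" and l :: "nat \<Rightarrow> real"
  assumes "\<kappa> > 0" "T \<ge> \<kappa>" and sm: "summable (\<lambda>n. norm (b n) * exp (- \<kappa> * l n))"
    and G: "\<And>w. Re w = \<kappa> \<Longrightarrow> (\<lambda>n. b n * exp (- of_real (l n) * w)) sums G w"
  shows "norm (vint \<kappa> T (\<lambda>w. G w * exp (of_real X * w) / w\<^sup>2)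
            - 2 * pi * \<i> * (\<Sum>n. b n * of_real (max 0 (X - l n))))
          \<le> 6 * exp (\<kappa> * X) * (\<Sum>n. norm (b n) * exp (- \<kappa> * l n)) / T"
    and "summable (\<lambda>n. b n * of_real (max 0 (X - l n)))"
proof -
  have T: "T > 0" using assms by simp
  define f where "f n w = b n * (exp (of_real (X - l n) * w) / w\<^sup>2)" for n w
  let ?V = "{w. Re w = \<kappa> \<and> \<bar>Im w\<bar> \<le> T}"
  have V: "closed_segment (Complex \<kappa> (-T)) (Complex \<kappa> T) = ?V"
    using T by (intro closed_segment_vertical) auto
  have nf: "norm (f n w) \<le> (norm (b n) * exp (- \<kappa> * l n)) * (exp (\<kappa> * X) / \<kappa>\<^sup>2)" if "w \<in> ?V" for n w
  proof -
    have "norm (exp (of_real (X - l n) * w) / w\<^sup>2) \<le> exp ((X - l n) * \<kappa>) / \<kappa>\<^sup>2"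
      using that assms abs_Re_le_cmod[of w] by (intro norm_divide_sq_le) auto
    then have "norm (f n w) \<le> norm (b n) * (exp ((X - l n) * \<kappa>) / \<kappa>\<^sup>2)"
      unfolding f_def norm_mult by (intro mult_left_mono) auto
    also have "exp ((X - l n) * \<kappa>) = exp (- \<kappa> * l n) * exp (\<kappa> * X)"
      by (simp add: exp_add[symmetric] algebra_simps)
    finally show ?thesis by (simp add: mult_ac)
  qed
  have sums_f: "(\<lambda>n. f n w) sums (G w * exp (of_real X * w) / w\<^sup>2)" if "w \<in> ?V" for w
  proof -
    have "(\<lambda>n. b n * exp (- of_real (l n) * w) * (exp (of_real X * w) / w\<^sup>2))
        sums (G w * (exp (of_real X * w) / w\<^sup>2))"
      using that by (intro sums_mult2 G) auto
    also have "(\<lambda>n. b n * exp (- of_real (l n) * w) * (exp (of_real X * w) / w\<^sup>2)) = (\<lambda>n. f n w)"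
      by (auto simp: f_def exp_diff exp_minus algebra_simps field_simps)
    finally show ?thesis by simp
  qed
  have "uniform_limit ?V (\<lambda>N w. \<Sum>n<N. f n w) (\<lambda>w. \<Sum>n. f n w) sequentially"
    using summable_mult2[OF sm] nf by (rule Weierstrass_m_test[rotated]) auto
  also have "?this \<longleftrightarrow> uniform_limit ?V (\<lambda>N w. \<Sum>n<N. f n w) (\<lambda>w. G w * exp (of_real X * w) / w\<^sup>2) sequentially"
    using sums_f by (intro uniform_limit_cong') (auto simp: sums_iff)
  finally have ul: "uniform_limit ?V (\<lambda>N w. \<Sum>n<N. f n w) (\<lambda>w. G w * exp (of_real X * w) / w\<^sup>2) sequentially" .
  have c0: "continuous_on ?V (\<lambda>w. exp (of_real x * w) / w\<^sup>2)" for x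
    using assms by (intro continuous_intros) auto
  have c: "continuous_on ?V (f n)" for n
    unfolding f_def[abs_def] by (intro continuous_on_mult_left c0)
  obtain J where J: "((\<lambda>w. G w * exp (of_real X * w) / w\<^sup>2) has_contour_integral J) (linepath (Complex \<kappa> (-T)) (Complex \<kappa> T))"
    "(\<lambda>n. contour_integral (linepath (Complex \<kappa> (-T)) (Complex \<kappa> T)) (f n)) sums J"
    using contour_integral_sums_linepath[where a = "Complex \<kappa> (-T)" and b = "Complex \<kappa> T" and f = f] ul c unfolding V by blast
  have J': "J = vint \<kappa> T (\<lambda>w. G w * exp (of_real X * w) / w\<^sup>2)"
    unfolding vint_def using contour_integral_unique[OF J(1)] by simp
  define P where "P x = vint \<kappa> T (\<lambda>w. exp (of_real x * w) / w\<^sup>2)" for x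
  have "contour_integral (linepath (Complex \<kappa> (-T)) (Complex \<kappa> T)) (f n) = b n * P (X - l n)" for n
    unfolding P_def vint_def f_def
    by (rule contour_integral_lmul) (intro contour_integrable_continuous_linepath, unfold V, rule c0)
  with J(2) have sJ: "(\<lambda>n. b n * P (X - l n)) sums J" by simp
  define E where "E n = b n * (P (X - l n) - 2 * pi * \<i> * of_real (max 0 (X - l n)))" for n
  define M where "M n = (norm (b n) * exp (- \<kappa> * l n)) * (6 * exp (\<kappa> * X) / T)" for n
  have nE: "norm (E n) \<le> M n" for n
  proof -
    have "norm (E n) \<le> norm (b n) * (6 * exp (\<kappa> * (X - l n)) / T)"
      unfolding E_def norm_mult P_def using vint_exp_over_square[OF assms(1,2), of "X - l n"]
      by (intro mult_left_mono) auto
    also have "exp (\<kappa> * (X - l n)) = exp (- \<kappa> * l n) * exp (\<kappa> * X)"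
      by (simp add: exp_add[symmetric] algebra_simps)
    finally show ?thesis by (simp add: M_def mult_ac)
  qed
  have sM: "summable M" unfolding M_def by (intro summable_mult2 sm)
  have sE: "summable (\<lambda>n. norm (E n))"
    by (rule summable_comparison_test'[OF sM, of 0]) (simp add: nE)
  then have "E sums (\<Sum>n. E n)" by (rule summable_sums[OF summable_norm_cancel])
  with sJ have "(\<lambda>n. b n * P (X - l n) - E n) sums (J - (\<Sum>n. E n))" by (rule sums_diff)
  then have "(\<lambda>n. (b n * P (X - l n) - E n) / (2 * pi * \<i>)) sums ((J - (\<Sum>n. E n)) / (2 * pi * \<i>))"
    by (rule sums_divide)
  also have "(\<lambda>n. (b n * P (X - l n) - E n) / (2 * pi * \<i>)) = (\<lambda>n. b n * of_real (max 0 (X - l n)))"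
    by (simp add: E_def algebra_simps)
  finally have D: "(\<lambda>n. b n * of_real (max 0 (X - l n))) sums ((J - (\<Sum>n. E n)) / (2 * pi * \<i>))" .
  then show "summable (\<lambda>n. b n * of_real (max 0 (X - l n)))" by (simp add: sums_iff)
  have "norm (\<Sum>n. E n) \<le> (\<Sum>n. M n)"
    by (rule order_trans[OF summable_norm[OF sE] suminf_le[OF nE sE sM]])
  also have "(\<Sum>n. M n) = 6 * exp (\<kappa> * X) * (\<Sum>n. norm (b n) * exp (- \<kappa> * l n)) / T"
    unfolding M_def suminf_mult2[OF sm, symmetric] by simp
  finally have nS: "norm (\<Sum>n. E n) \<le> 6 * exp (\<kappa> * X) * (\<Sum>n. norm (b n) * exp (- \<kappa> * l n)) / T" .
  have "2 * pi * \<i> * (\<Sum>n. b n * of_real (max 0 (X - l n))) = J - (\<Sum>n. E n)"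
    unfolding sums_unique[OF D, symmetric] by simp
  then show "norm (vint \<kappa> T (\<lambda>w. G w * exp (of_real X * w) / w\<^sup>2)
            - 2 * pi * \<i> * (\<Sum>n. b n * of_real (max 0 (X - l n))))
          \<le> 6 * exp (\<kappa> * X) * (\<Sum>n. norm (b n) * exp (- \<kappa> * l n)) / T"
    using nS by (simp add: J')
qed

section \<open>Integral estimates on the shifted line\<close>

lemma norm_exp_minus_one_le:
  assumes "Re z \<le> 0"
  shows "norm (exp z - 1) \<le> norm (z :: complex)"
proof -
  have "norm (exp z - exp 0) \<le> 1 * norm (z - 0)"
  proof (rule field_differentiable_bound[where S = "{z. Re z \<le> 0}" and f' = exp])
    show "convex {z. Re z \<le> 0}" by (rule convex_halfspace_Re_le)
  qed (use assms in \<open>auto intro!: derivative_eq_intros\<close>)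
  then show ?thesis by simp
qed

text \<open>Interpolates between the bounds \<open>norm z\<close> and 2. Applied to
  \<open>z = \<eta> * w\<close> and divided by \<open>w\<^sup>2\<close>, the first would leave
  \<open>1 / norm w\<close>, which is not integrable along a line; the second would not be small in
  \<eta>, losing a full power of N after division by \<eta>. The exponent 1 - p avoids both.\<close>

lemma norm_exp_minus_one_le_powr:
  assumes "Re z \<le> 0" "z \<noteq> 0" "0 \<le> p" "p \<le> 1"
  shows "norm (exp z - 1) \<le> 2 * norm (z :: complex) powr (1 - p)"
proof (cases "norm z \<le> 1")
  case True
  have "norm z powr 1 \<le> norm z powr (1 - p)" using True assms by (intro powr_mono') auto
  then show ?thesis using norm_exp_minus_one_le[OF assms(1)] assms
    by (smt (verit) norm_ge_zero powr_one)
next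
  case False
  have "norm (exp z - 1) \<le> exp (Re z) + 1" by (rule order_trans[OF norm_triangle_ineq4]) simp
  also have "\<dots> \<le> 2 * 1" using assms by simp
  also have "\<dots> \<le> 2 * norm z powr (1 - p)" using False assms by (intro mult_left_mono ge_one_powr_ge_zero) auto
  finally show ?thesis .
qed

lemma integral_powr_le:
  fixes p T :: real
  assumes "p > 0" "T > 0"
  shows "(\<lambda>y. (1 + \<bar>y\<bar>) powr (-1 - p)) integrable_on {-T..T}"
    and "integral {-T..T} (\<lambda>y. (1 + \<bar>y\<bar>) powr (-1 - p)) \<le> 2 / p"
proof -
  have e: "- p - 1 = - 1 - p" by simp
  define F G where "F y = - ((1 + y) powr (-p) / p)" and "G y = (1 - y) powr (-p) / p" for y :: real
  have 1: "((\<lambda>y. (1 + \<bar>y\<bar>) powr (-1 - p)) has_integral F T - F 0) {0..T}"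
    unfolding F_def using assms
    by (intro fundamental_theorem_of_calculus)
       (auto intro!: derivative_eq_intros simp: has_real_derivative_iff_has_vector_derivative[symmetric] e)
  have 2: "((\<lambda>y. (1 + \<bar>y\<bar>) powr (-1 - p)) has_integral G 0 - G (-T)) {-T..0}"
    unfolding G_def using assms
    by (intro fundamental_theorem_of_calculus)
       (auto intro!: derivative_eq_intros simp: has_real_derivative_iff_has_vector_derivative[symmetric] e)
  have 3: "((\<lambda>y. (1 + \<bar>y\<bar>) powr (-1 - p)) has_integral (G 0 - G (-T)) + (F T - F 0)) {-T..T}"
    using assms by (intro has_integral_combine[OF _ _ 2 1]) auto
  then show "(\<lambda>y. (1 + \<bar>y\<bar>) powr (-1 - p)) integrable_on {-T..T}" by blast
  have "integral {-T..T} (\<lambda>y. (1 + \<bar>y\<bar>) powr (-1 - p)) = (G 0 - G (-T)) + (F T - F 0)"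
    using 3 by (rule integral_unique)
  also have "\<dots> \<le> 2 / p" using assms by (simp add: F_def G_def)
  finally show "integral {-T..T} (\<lambda>y. (1 + \<bar>y\<bar>) powr (-1 - p)) \<le> 2 / p" .
qed

text \<open>The bound does not depend on \<open>T\<close>, so it survives the limit. On the line,
  \<open>norm w\<close> dominates both \<epsilon> and \<open>\<bar>Im w\<bar>\<close>, hence a
  multiple of \<open>1 + \<bar>Im w\<bar>\<close>, whose power has an elementary
  antiderivative.\<close>

lemma norm_vint_le_powr:
  assumes "T > 0" "\<epsilon> > 0" "p > 0" "Q \<ge> 0" and cont: "continuous_on {w. Re w = - \<epsilon> \<and> \<bar>Im w\<bar> \<le> T} f"
    and bnd: "\<And>w. Re w = - \<epsilon> \<Longrightarrow> norm (f w) \<le> Q * norm w powr (-1 - p)"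
  shows "norm (vint (- \<epsilon>) T f) \<le> Q * (\<epsilon> / (1 + \<epsilon>)) powr (-1 - p) * (2 / p)"
proof -
  let ?q = "\<epsilon> / (1 + \<epsilon>)"
  have q: "?q > 0" using assms by simp
  have w: "norm (Complex (-\<epsilon>) y) \<ge> ?q * (1 + \<bar>y\<bar>)" for y
  proof -
    have m: "norm (Complex (-\<epsilon>) y) \<ge> \<epsilon>" "norm (Complex (-\<epsilon>) y) \<ge> \<bar>y\<bar>"
      using abs_Re_le_cmod[of "Complex (-\<epsilon>) y"] abs_Im_le_cmod[of "Complex (-\<epsilon>) y"] \<open>\<epsilon> > 0\<close> by auto
    then have "\<epsilon> * norm (Complex (-\<epsilon>) y) \<ge> \<epsilon> * \<bar>y\<bar>" using \<open>\<epsilon> > 0\<close> by (intro mult_left_mono) auto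
    with m(1) have "\<epsilon> * (1 + \<bar>y\<bar>) \<le> norm (Complex (-\<epsilon>) y) * (1 + \<epsilon>)" by (simp add: algebra_simps)
    then show ?thesis using \<open>\<epsilon> > 0\<close> by (simp add: field_simps)
  qed
  have "vint (-\<epsilon>) T f = \<i> * integral {-T..T} (\<lambda>y. f (Complex (-\<epsilon>) y))"
    unfolding vint_def using assms by (intro contour_integral_linepath_same_Re) auto
  then have "norm (vint (-\<epsilon>) T f) = norm (integral {-T..T} (\<lambda>y. f (Complex (-\<epsilon>) y)))"
    by (simp add: norm_mult)
  also have "\<dots> \<le> integral {-T..T} (\<lambda>y. Q * ?q powr (-1 - p) * (1 + \<bar>y\<bar>) powr (-1 - p))"
  proof (rule integral_norm_bound_integral)
    show "(\<lambda>y. f (Complex (-\<epsilon>) y)) integrable_on {-T..T}"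
      by (intro integrable_continuous_real continuous_on_compose2[OF cont])
         (auto intro!: continuous_intros simp: Complex_eq)
    show "(\<lambda>y. Q * ?q powr (-1 - p) * (1 + \<bar>y\<bar>) powr (-1 - p)) integrable_on {-T..T}"
      using integral_powr_le(1)[OF \<open>p > 0\<close> \<open>T > 0\<close>] by (rule integrable_on_mult_right)
    fix y assume "y \<in> {-T..T}"
    have "norm (f (Complex (-\<epsilon>) y)) \<le> Q * norm (Complex (-\<epsilon>) y) powr (-1 - p)" by (rule bnd) simp
    also have "\<dots> \<le> Q * (?q * (1 + \<bar>y\<bar>)) powr (-1 - p)"
      using assms q w[of y] by (intro mult_left_mono powr_mono2') auto
    also have "\<dots> = Q * ?q powr (-1 - p) * (1 + \<bar>y\<bar>) powr (-1 - p)" using q by (subst powr_mult) (auto simp: mult.assoc)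
    finally show "norm (f (Complex (-\<epsilon>) y)) \<le> Q * ?q powr (-1 - p) * (1 + \<bar>y\<bar>) powr (-1 - p)" .
  qed
  also have "\<dots> = Q * ?q powr (-1 - p) * integral {-T..T} (\<lambda>y. (1 + \<bar>y\<bar>) powr (-1 - p))"
    by (rule integral_mult_right)
  also have "\<dots> \<le> Q * ?q powr (-1 - p) * (2 / p)"
    using assms by (intro mult_left_mono integral_powr_le) auto
  finally show ?thesis .
qed

text \<open>With \<open>L = ln N\<close> and \<open>L + \<eta> = ln (N + 1)\<close>, integrating \<open>g (s + w)\<close> over a vertical line far to the
  right against the kernel \<open>(exp ((L + \<eta>) w) - exp (L w)) / (\<eta> w\<^sup>2)\<close> gives exactly the \<open>N\<close>-th partial sum.
  Moving the line to \<open>Re w = -\<epsilon>\<close> leaves the residue \<open>g s\<close> at \<open>0\<close>, and there the kernel is bounded by a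
  multiple of \<open>N powr (p - \<epsilon>) * norm w powr (-1 - p)\<close>, so the remaining integral tends to \<open>0\<close>.\<close>

theorem bohr_convergence:
  assumes hol: "g holomorphic_on half_plane 0"
    and bnd: "\<And>s. s \<in> half_plane 0 \<Longrightarrow> norm (g s) \<le> B"
    and abs: "summable (\<lambda>n. norm (a (Suc n)) * real (Suc n) powr - \<kappa>0)"
    and ser: "\<And>s. Re s \<ge> \<kappa>0 \<Longrightarrow> (\<lambda>n. a (Suc n) * of_nat (Suc n) powr - s) sums g s"
  shows "has_dirichlet_series_on a g (half_plane 0)"
  unfolding has_dirichlet_series_on_def
proof
  fix s assume "s \<in> half_plane 0"
  then have \<sigma>: "Re s > 0" by (simp add: half_plane_def)
  \<comment> \<open>With \<epsilon> half of \<open>Re s\<close>, the points \<open>s + w\<close> on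
    the line \<open>Re w = -\<epsilon>\<close> remain in the half-plane where g is bounded. The
    exponent p is positive for integrability and smaller than \<epsilon> so that
    \<open>N powr (p - \<epsilon>)\<close> tends to 0. Taking \<kappa> at least 1 allows
    \<open>1 / T\<^sup>2 \<le> 1 / T\<close> whenever T \<ge> \<kappa>.\<close>
  define \<epsilon> p \<kappa> where "\<epsilon> = Re s / 2" and "p = min (\<epsilon> / 2) (1 / 2)" and "\<kappa> = max 1 \<kappa>0"
  have pos: "\<epsilon> > 0" "p > 0" "p \<le> 1" "p < \<epsilon>" "\<kappa> > 0" using \<sigma> by (auto simp: \<epsilon>_def p_def \<kappa>_def)
  define b where "b n = a (Suc n) * of_nat (Suc n) powr - s" for n
  define l where "l n = ln (real (Suc n))" for n
  have pw: "of_nat (Suc n) powr - w = exp (- of_real (l n) * w)" for n and w :: complex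
  proof -
    have "Ln (of_nat (Suc n)) = of_real (l n)"
      unfolding l_def by (metis Ln_of_real of_nat_0_less_iff of_real_of_nat_eq zero_less_Suc)
    then show ?thesis by (simp add: powr_def mult.commute del: of_nat_Suc)
  qed
  have B: "B \<ge> 0" using bnd[OF \<open>s \<in> half_plane 0\<close>] by (rule order_trans[OF norm_ge_zero])
  have nb: "norm (b n) * exp (- \<kappa> * l n) \<le> norm (a (Suc n)) * real (Suc n) powr - \<kappa>0" for n
  proof -
    have "norm (b n) * exp (- \<kappa> * l n) = norm (a (Suc n)) * exp (- (Re s + \<kappa>) * l n)"
      by (simp add: b_def pw norm_mult exp_add[symmetric] algebra_simps del: of_nat_Suc)
    also have "\<dots> \<le> norm (a (Suc n)) * exp (- \<kappa>0 * l n)"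
    proof -
      have "- (Re s + \<kappa>) * l n \<le> - \<kappa>0 * l n"
        using \<sigma> by (intro mult_right_mono) (auto simp: \<kappa>_def l_def)
      then show ?thesis by (intro mult_left_mono) auto
    qed
    also have "exp (- \<kappa>0 * l n) = real (Suc n) powr - \<kappa>0" by (simp add: powr_def l_def)
    finally show ?thesis .
  qed
  have sm: "summable (\<lambda>n. norm (b n) * exp (- \<kappa> * l n))"
    by (rule summable_comparison_test'[OF abs, of 0]) (use nb in \<open>simp add: abs_mult del: of_nat_Suc\<close>)
  have G: "(\<lambda>n. b n * exp (- of_real (l n) * w)) sums g (s + w)" if "Re w = \<kappa>" for w
  proof -
    have "(\<lambda>n. a (Suc n) * of_nat (Suc n) powr - (s + w)) sums g (s + w)"
      using that \<sigma> by (intro ser) (auto simp: \<kappa>_def)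
    also have "(\<lambda>n. a (Suc n) * of_nat (Suc n) powr - (s + w)) = (\<lambda>n. b n * exp (- of_real (l n) * w))"
      unfolding b_def pw by (simp add: exp_add[symmetric] algebra_simps)
    finally show ?thesis .
  qed
  define h where "h X w = g (s + w) * exp (of_real X * w) / w\<^sup>2" for X :: real and w
  define D where "D X = (\<Sum>n. b n * of_real (max 0 (X - l n)))" for X
  define A where "A = (\<Sum>n. norm (b n) * exp (- \<kappa> * l n))"
  let ?S = "{w. Re w > - Re s}"
  have gs: "(\<lambda>w. g (s + w)) holomorphic_on ?S"
    by (rule holomorphic_on_compose_gen[OF _ hol, unfolded o_def])
       (auto intro!: holomorphic_intros simp: half_plane_def)
  have gsd: "((\<lambda>w. g (s + w)) has_field_derivative deriv g s) (at 0)"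
  proof -
    have "(g has_field_derivative deriv g s) (at (s + 0))"
      using \<open>s \<in> half_plane 0\<close> hol
      by (auto intro!: holomorphic_derivI[of _ "half_plane 0"] simp: half_plane_def open_halfspace_Re_gt)
    moreover have "((\<lambda>w. s + w) has_field_derivative 1) (at 0)" by (auto intro!: derivative_eq_intros)
    ultimately show ?thesis using DERIV_chain2[where f = g and g = "\<lambda>w. s + w" and x = 0] by fastforce
  qed
  define K where "K = 2 * B * (\<epsilon> / (1 + \<epsilon>)) powr (-1 - p) * (2 / p) / (2 * pi)"
  have K: "K \<ge> 0" using B pos unfolding K_def by (intro divide_nonneg_nonneg mult_nonneg_nonneg) auto
  have main: "norm ((\<Sum>n<N. b n) - g s) \<le> K * 2 powr p * real N powr (p - \<epsilon>)" if "N \<ge> 1" for N :: nat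
  proof -
    define L \<eta> where "L = ln (real N)" and "\<eta> = ln (real N + 1) - ln (real N)"
    have L: "L \<ge> 0" using that by (simp add: L_def)
    \<comment> \<open>The lower bound is needed because division by \<eta> will leave
      \<open>\<eta> powr (-p)\<close>, which must not exceed \<open>(2 * N) powr p\<close>.\<close>
    have \<eta>: "\<eta> > 0" "\<eta> \<ge> 1 / (2 * real N)"
    proof -
      show "\<eta> > 0" using that by (simp add: \<eta>_def)
      have "ln (real N / (real N + 1)) \<le> real N / (real N + 1) - 1" using that by (intro ln_le_minus_one) auto
      then have "\<eta> \<ge> 1 / (real N + 1)" using that by (simp add: \<eta>_def ln_div field_simps)
      moreover have "1 / (real N + 1) \<ge> 1 / (2 * real N)" using that by (intro divide_left_mono) auto
      ultimately show "\<eta> \<ge> 1 / (2 * real N)" by linarith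
    qed
    \<comment> \<open>\<open>D\<close> is piecewise linear with breakpoints at the logarithms of
      integers, and none lies strictly between \<open>ln N\<close> and \<open>ln (N + 1)\<close>. So
      each term with \<open>Suc n \<le> N\<close> grows by \<open>\<eta> * b n\<close>, and every
      later term is 0 at both ends.\<close>
    have DD: "D (L + \<eta>) - D L = of_real \<eta> * (\<Sum>n<N. b n)"
    proof -
      have "(\<lambda>n. b n * of_real (max 0 (L + \<eta> - l n)) - b n * of_real (max 0 (L - l n))) sums (D (L + \<eta>) - D L)"
        unfolding D_def
        by (intro sums_diff summable_sums perron_sum(2)[of \<kappa> \<kappa> b l "\<lambda>w. g (s + w)"] sm G pos) auto
      moreover have "b n * of_real (max 0 (L + \<eta> - l n)) - b n * of_real (max 0 (L - l n)) =
         (if n < N then of_real \<eta> * b n else 0)" for n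
      proof (cases "n < N")
        case True
        then have "l n \<le> L" by (simp add: l_def L_def)
        then have "max 0 (L + \<eta> - l n) = L + \<eta> - l n" "max 0 (L - l n) = L - l n" using \<eta> by auto
        then show ?thesis using True by (simp add: algebra_simps)
      next
        case False
        then have "l n \<ge> L + \<eta>" using that by (simp add: l_def L_def \<eta>_def)
        then have "max 0 (L + \<eta> - l n) = 0" "max 0 (L - l n) = 0" using \<eta> by auto
        then show ?thesis using False by simp
      qed
      ultimately have "(\<lambda>n. if n \<in> {..<N} then of_real \<eta> * b n else 0) sums (D (L + \<eta>) - D L)" by simp
      moreover have "(\<lambda>n. if n \<in> {..<N} then of_real \<eta> * b n else 0) sums (\<Sum>n<N. of_real \<eta> * b n)"
        by (rule sums_If_finite_set) simp
      ultimately show ?thesis by (simp add: sums_unique2 sum_distrib_left)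
    qed
    define C where "C X = 6 * exp (\<kappa> * X) * A + 2 * (\<kappa> + \<epsilon>) * (B * exp (\<kappa> * X))" for X
    \<comment> \<open>The residue at 0 is the derivative of \<open>g (s + w) * exp (X * w)\<close>,
      namely \<open>deriv g s + X * g s\<close>. Subtracting the estimates at
      \<open>L + \<eta>\<close> and \<open>L\<close> cancels \<open>deriv g s\<close> and leaves
      \<open>\<eta> * g s\<close>. The constant \<open>C X\<close> is free of \<open>T\<close>, so
      this error disappears in the limit.\<close>
    have est: "norm (2 * pi * \<i> * D X - vint (-\<epsilon>) T (h X) - 2 * pi * \<i> * (deriv g s + of_real X * g s)) \<le> C X / T"
      if T: "T \<ge> \<kappa>" and X: "X \<ge> 0" for T X
    proof -
      have T0: "T > 0" "T \<ge> 1" using T pos by (auto simp: \<kappa>_def)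
      have 1: "norm (vint \<kappa> T (h X) - 2 * pi * \<i> * D X) \<le> 6 * exp (\<kappa> * X) * A / T"
        unfolding h_def D_def A_def by (rule perron_sum(1)[OF _ T sm G]) (use pos in auto)
      have d: "deriv (\<lambda>w. g (s + w) * exp (of_real X * w)) 0 = deriv g s + of_real X * g s"
        by (rule DERIV_imp_deriv) (auto intro!: derivative_eq_intros gsd)
      have "norm (vint \<kappa> T (h X) - vint (-\<epsilon>) T (h X)
           - (if -\<epsilon> < 0 \<and> 0 < \<kappa> then 2 * pi * \<i> * deriv (\<lambda>w. g (s + w) * exp (of_real X * w)) 0 else 0))
           \<le> 2 * (\<kappa> - (-\<epsilon>)) * (B * exp (\<kappa> * X) / T\<^sup>2)"
        unfolding h_def
      proof (rule vint_shift[where S = ?S])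
        show "open ?S" "convex ?S" by (auto simp: open_halfspace_Re_gt convex_halfspace_Re_gt)
        show "(\<lambda>w. g (s + w) * exp (of_real X * w)) holomorphic_on ?S"
          by (intro holomorphic_intros gs)
        fix w assume w: "Re w \<in> {-\<epsilon>..\<kappa>}" "\<bar>Im w\<bar> = T"
        then have "norm (g (s + w)) \<le> B" using \<sigma> by (intro bnd) (auto simp: half_plane_def \<epsilon>_def)
        moreover have "X * Re w \<le> \<kappa> * X" using w X mult_left_mono[of "Re w" \<kappa> X] by (auto simp: mult.commute)
        ultimately show "norm (g (s + w) * exp (of_real X * w)) \<le> B * exp (\<kappa> * X)"
          unfolding norm_mult using B by (intro mult_mono) auto
      qed (use pos \<sigma> T0 in \<open>auto simp: \<epsilon>_def\<close>)
      then have 2: "norm (vint \<kappa> T (h X) - vint (-\<epsilon>) T (h X) - 2 * pi * \<i> * (deriv g s + of_real X * g s))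
          \<le> 2 * (\<kappa> + \<epsilon>) * (B * exp (\<kappa> * X)) / T\<^sup>2"
        unfolding d using pos by simp
      have "2 * (\<kappa> + \<epsilon>) * (B * exp (\<kappa> * X)) / T\<^sup>2 \<le> 2 * (\<kappa> + \<epsilon>) * (B * exp (\<kappa> * X)) / T"
        using T0 pos B by (intro divide_left_mono) (auto simp: power2_eq_square)
      moreover have "norm (2 * pi * \<i> * D X - vint (-\<epsilon>) T (h X) - 2 * pi * \<i> * (deriv g s + of_real X * g s)) \<le>
          norm (vint \<kappa> T (h X) - vint (-\<epsilon>) T (h X) - 2 * pi * \<i> * (deriv g s + of_real X * g s))
          + norm (vint \<kappa> T (h X) - 2 * pi * \<i> * D X)"
        by (rule order_trans[OF _ norm_triangle_ineq4]) (simp add: algebra_simps)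
      ultimately show ?thesis using 1 2 unfolding C_def add_divide_distrib by linarith
    qed
    have vi: "norm (vint (-\<epsilon>) T (h (L + \<eta>)) - vint (-\<epsilon>) T (h L)) \<le> K * (2 * pi) * exp (- \<epsilon> * L) * \<eta> powr (1 - p)"
      if T: "T > 0" for T
    proof -
      have hc: "continuous_on {w. Re w = - \<epsilon> \<and> \<bar>Im w\<bar> \<le> T} (h X)" for X
        unfolding h_def[abs_def] using pos \<sigma>
        by (intro continuous_intros continuous_on_subset[OF holomorphic_on_imp_continuous_on[OF gs]])
           (auto simp: \<epsilon>_def)
      have "vint (-\<epsilon>) T (h (L + \<eta>)) - vint (-\<epsilon>) T (h L) = vint (-\<epsilon>) T (\<lambda>w. h (L + \<eta>) w - h L w)"
        unfolding vint_def using T hc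
        by (intro contour_integral_diff[symmetric] contour_integrable_continuous_linepath) (auto simp: closed_segment_vertical)
      also have "norm \<dots> \<le> (2 * B * exp (- \<epsilon> * L) * \<eta> powr (1 - p)) * (\<epsilon> / (1 + \<epsilon>)) powr (-1 - p) * (2 / p)"
      proof (rule norm_vint_le_powr)
        show "continuous_on {w. Re w = - \<epsilon> \<and> \<bar>Im w\<bar> \<le> T} (\<lambda>w. h (L + \<eta>) w - h L w)"
          by (intro continuous_intros hc)
        fix w assume w: "Re w = - \<epsilon>"
        then have w0: "norm w > 0" using pos by auto
        have "h (L + \<eta>) w - h L w = g (s + w) * exp (of_real L * w) * (exp (of_real \<eta> * w) - 1) / w\<^sup>2"
          unfolding h_def by (simp add: algebra_simps exp_add diff_divide_distrib)
        then have "norm (h (L + \<eta>) w - h L w) =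
           norm (g (s + w)) * exp (- \<epsilon> * L) * norm (exp (of_real \<eta> * w) - 1) / norm w ^ 2"
          using w by (simp add: norm_divide norm_mult norm_power mult_ac)
        also have "\<dots> \<le> B * exp (- \<epsilon> * L) * (2 * norm (of_real \<eta> * w) powr (1 - p)) / norm w ^ 2"
          using w \<sigma> pos \<eta> B
          by (intro divide_right_mono mult_mono norm_exp_minus_one_le_powr bnd)
             (auto simp: half_plane_def \<epsilon>_def)
        also have "norm (of_real \<eta> * w) powr (1 - p) = \<eta> powr (1 - p) * norm w powr (1 - p)"
          using \<eta> by (simp add: norm_mult powr_mult)
        also have "B * exp (- \<epsilon> * L) * (2 * (\<eta> powr (1 - p) * norm w powr (1 - p))) / norm w ^ 2
           = (2 * B * exp (- \<epsilon> * L) * \<eta> powr (1 - p)) * (norm w powr (1 - p) / norm w powr 2)"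
          using w0 by (simp add: mult_ac)
        also have "norm w powr (1 - p) / norm w powr 2 = norm w powr ((1 - p) - 2)"
          by (simp only: powr_diff)
        also have "(1 - p) - 2 = -1 - p" by simp
        finally show "norm (h (L + \<eta>) w - h L w) \<le> (2 * B * exp (- \<epsilon> * L) * \<eta> powr (1 - p)) * norm w powr (-1 - p)" .
      qed (use T pos B in auto)
      also have "\<dots> = K * (2 * pi) * exp (- \<epsilon> * L) * \<eta> powr (1 - p)" by (simp add: K_def)
      finally show ?thesis .
    qed
    let ?Z = "2 * pi * \<i> * (of_real \<eta> * ((\<Sum>n<N. b n) - g s))"
    have "norm ?Z \<le> K * (2 * pi) * exp (- \<epsilon> * L) * \<eta> powr (1 - p) + (C (L + \<eta>) + C L) / T" if T: "T \<ge> \<kappa>" for T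
    proof -
      let ?E = "\<lambda>X. 2 * pi * \<i> * D X - vint (-\<epsilon>) T (h X) - 2 * pi * \<i> * (deriv g s + of_real X * g s)"
      have "?Z = 2 * pi * \<i> * ((D (L + \<eta>) - D L) - of_real \<eta> * g s)"
        unfolding DD by (simp add: algebra_simps)
      also have "\<dots> = ?E (L + \<eta>) - ?E L + (vint (-\<epsilon>) T (h (L + \<eta>)) - vint (-\<epsilon>) T (h L))"
        by (simp add: algebra_simps)
      also have "norm \<dots> \<le> (C (L + \<eta>) / T + C L / T) + K * (2 * pi) * exp (- \<epsilon> * L) * \<eta> powr (1 - p)"
        using T L \<eta> pos by (intro norm_triangle_mono vi order_trans[OF norm_triangle_ineq4] add_mono est) auto
      finally show ?thesis by (simp add: add_divide_distrib)
    qed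
    then have "\<forall>\<^sub>F T in at_top. norm ?Z \<le> K * (2 * pi) * exp (- \<epsilon> * L) * \<eta> powr (1 - p) + (C (L + \<eta>) + C L) / T"
      by (intro eventually_at_top_linorderI[of \<kappa>])
    moreover have "((\<lambda>T. K * (2 * pi) * exp (- \<epsilon> * L) * \<eta> powr (1 - p) + (C (L + \<eta>) + C L) / T)
        \<longlongrightarrow> K * (2 * pi) * exp (- \<epsilon> * L) * \<eta> powr (1 - p) + 0) at_top"
      by (intro tendsto_intros tendsto_divide_0[OF tendsto_const] filterlim_at_top_imp_at_infinity filterlim_ident)
    ultimately have lim: "norm ?Z \<le> K * (2 * pi) * exp (- \<epsilon> * L) * \<eta> powr (1 - p) + 0"
      by (intro tendsto_lowerbound[of _ _ at_top]) auto
    have "(2 * pi * \<eta>) * norm ((\<Sum>n<N. b n) - g s) = norm ?Z"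
      using \<eta> by (simp add: norm_mult)
    also note lim
    \<comment> \<open>One factor \<eta> cancels against the left side; what remains is the small
      loss \<open>\<eta> powr (-p)\<close>, which the decay \<open>exp (- \<epsilon> * L)\<close>
      outweighs.\<close>
    also have "\<eta> powr (1 - p) = \<eta> * \<eta> powr (- p)"
      using powr_add[of \<eta> 1 "- p"] \<eta> by simp
    finally have "(2 * pi * \<eta>) * norm ((\<Sum>n<N. b n) - g s) \<le> (2 * pi * \<eta>) * (K * exp (- \<epsilon> * L) * \<eta> powr (-p))"
      by (simp only: add_0_right mult_ac)
    then have "norm ((\<Sum>n<N. b n) - g s) \<le> K * exp (- \<epsilon> * L) * \<eta> powr (-p)"
      using \<eta> by (subst (asm) mult_le_cancel_left_pos) auto
    also have "\<dots> \<le> K * exp (- \<epsilon> * L) * (1 / (2 * real N)) powr (-p)"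
      using \<eta> K pos that by (intro mult_left_mono powr_mono2') auto
    also have "exp (- \<epsilon> * L) = real N powr (-\<epsilon>)" using that by (simp add: L_def powr_def)
    also have "(1 / (2 * real N)) powr (-p) = 2 powr p * real N powr p"
      using that by (simp add: powr_minus powr_divide powr_mult)
    finally show ?thesis using that by (simp add: powr_diff powr_minus field_simps)
  qed
  have "((\<lambda>N. K * 2 powr p * real N powr (p - \<epsilon>)) \<longlongrightarrow> K * 2 powr p * 0) sequentially"
    using pos by (intro tendsto_intros tendsto_neg_powr filterlim_real_sequentially) auto
  then have lim0: "((\<lambda>N. K * 2 powr p * real N powr (p - \<epsilon>)) \<longlongrightarrow> 0) sequentially" by simp
  have "((\<lambda>N. (\<Sum>n<N. b n) - g s) \<longlongrightarrow> 0) sequentially"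
    by (rule Lim_null_comparison[OF _ lim0], rule eventually_sequentiallyI[of 1], rule main)
  then have "b sums g s" unfolding sums_def by (simp add: LIM_zero_iff)
  then show "(\<lambda>n. a (Suc n) * of_nat (Suc n) powr - s) sums g s" by (simp add: b_def[abs_def])
qed

section \<open>Absolutely convergent general Dirichlet series\<close>

text \<open>Dividing a Dirichlet series by its leading term produces non-integer frequencies. We therefore admit
  series \<open>\<Sum>l\<in>\<Lambda>. a l * l powr - s\<close> over a set \<open>\<Lambda>\<close> of real frequencies; in \<open>gds \<Lambda> \<sigma> K f\<close> the number \<open>K\<close>
  bounds the weighted \<open>\<ell>\<^sup>1\<close> norm of the coefficients, which is submultiplicative.\<close>

definition gds_coeff :: "real set \<Rightarrow> real \<Rightarrow> (real \<Rightarrow> complex) \<Rightarrow> (complex \<Rightarrow> complex) \<Rightarrow> bool" where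
  "gds_coeff \<Lambda> \<sigma> a f \<longleftrightarrow> (\<lambda>l. norm (a l) * l powr - \<sigma>) summable_on \<Lambda> \<and>
     (\<forall>s. Re s \<ge> \<sigma> \<longrightarrow> ((\<lambda>l. a l * of_real l powr - s) has_sum f s) \<Lambda>)"

definition gds :: "real set \<Rightarrow> real \<Rightarrow> real \<Rightarrow> (complex \<Rightarrow> complex) \<Rightarrow> bool" where
  "gds \<Lambda> \<sigma> K f \<longleftrightarrow> (\<exists>a. gds_coeff \<Lambda> \<sigma> a f \<and> (\<Sum>\<^sub>\<infinity>l\<in>\<Lambda>. norm (a l) * l powr - \<sigma>) \<le> K)"

text \<open>Frequencies at least 1 make the weights decrease when the abscissa grows; the element 1
  provides constants, and closure under products provides multiplication of series.\<close>

definition freq_monoid :: "real set \<Rightarrow> bool" where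
  "freq_monoid \<Lambda> \<longleftrightarrow> \<Lambda> \<subseteq> {1..} \<and> 1 \<in> \<Lambda> \<and> (\<forall>x\<in>\<Lambda>. \<forall>y\<in>\<Lambda>. x * y \<in> \<Lambda>)"

lemma norm_of_real_powr: "l > 0 \<Longrightarrow> norm (complex_of_real l powr s) = l powr Re s"
  by (simp add: norm_powr_real_powr)

lemma of_real_mult_powr: "l > 0 \<Longrightarrow> m > 0 \<Longrightarrow> complex_of_real (l * m) powr s = of_real l powr s * of_real m powr s"
  by (simp add: powr_times_real)

lemma norm_term_le:
  assumes "l \<ge> 1" "Re s \<ge> \<sigma>"
  shows "norm (c * complex_of_real l powr - s) \<le> norm c * l powr - \<sigma>"
proof -
  have "norm (c * complex_of_real l powr - s) = norm c * l powr - Re s"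
    using assms by (simp add: norm_mult norm_of_real_powr)
  also have "\<dots> \<le> norm c * l powr - \<sigma>"
    using assms by (intro mult_left_mono powr_mono) auto
  finally show ?thesis .
qed

lemma has_sum_times:
  fixes x :: "'i \<Rightarrow> 'a :: {real_normed_field, banach}" and y :: "'j \<Rightarrow> 'a"
  assumes "(x has_sum X) A" "(y has_sum Y) B"
    and "(\<lambda>i. norm (x i)) summable_on A" "(\<lambda>j. norm (y j)) summable_on B"
  shows "((\<lambda>(i, j). x i * y j) has_sum X * Y) (A \<times> B)"
proof (rule has_sum_SigmaI[where g = "\<lambda>i. x i * Y"])
  show "((\<lambda>j. case (i, j) of (i, j) \<Rightarrow> x i * y j) has_sum x i * Y) B" for i
    using assms(2) by (simp add: has_sum_cmult_right)
  show "((\<lambda>i. x i * Y) has_sum X * Y) A" using assms(1) by (rule has_sum_cmult_left)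
  have "(\<lambda>p. norm (case p of (i, j) \<Rightarrow> x i * y j)) summable_on A \<times> B"
  proof (rule summable_on_SigmaI[where g = "\<lambda>i. norm (x i) * (\<Sum>\<^sub>\<infinity>j\<in>B. norm (y j))"])
    show "((\<lambda>j. norm (case (i, j) of (i, j) \<Rightarrow> x i * y j)) has_sum norm (x i) * (\<Sum>\<^sub>\<infinity>j\<in>B. norm (y j))) B" for i
      using assms(4) by (auto simp: norm_mult intro!: has_sum_cmult_right)
    show "(\<lambda>i. norm (x i) * (\<Sum>\<^sub>\<infinity>j\<in>B. norm (y j))) summable_on A"
      using assms(3) by (rule summable_on_cmult_left)
  qed auto
  then show "(\<lambda>(i, j). x i * y j) summable_on A \<times> B" by (rule abs_summable_summable)
qed

text \<open>The map \<open>m\<close> need not be injective: terms with equal frequency are collected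
  fibrewise, and the triangle inequality shows that this cannot increase the weighted norm.
  Products, infinite sums and rescaled series are all instances with a suitable index set.\<close>

lemma gds_family:
  assumes \<Lambda>: "\<Lambda> \<subseteq> {1..}" and m: "\<And>i. i \<in> I \<Longrightarrow> m i \<in> \<Lambda>"
    and norm: "((\<lambda>i. norm (c i) * m i powr - \<sigma>) has_sum K) I"
    and val: "\<And>s. Re s \<ge> \<sigma> \<Longrightarrow> ((\<lambda>i. c i * of_real (m i) powr - s) has_sum f s) I"
  shows "gds \<Lambda> \<sigma> K f"
proof -
  define B where "B l = {i \<in> I. m i = l}" for l
  define a where "a l = infsum c (B l)" for l
  define n where "n l = (\<Sum>\<^sub>\<infinity>i\<in>B l. norm (c i))" for l
  have sig: "(F \<circ> snd has_sum S) (Sigma \<Lambda> B) \<longleftrightarrow> (F has_sum S) I" for F :: "'a \<Rightarrow> 'b :: {comm_monoid_add, topological_space}" and S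
    using m by (intro has_sum_reindex_bij_witness[of _ "\<lambda>i. (m i, i)" snd]) (auto simp: B_def)
  have nB: "(\<lambda>i. norm (c i)) summable_on B l" if "l \<in> \<Lambda>" for l
  proof -
    have "(\<lambda>i. norm (c i) * m i powr - \<sigma>) summable_on B l"
      using has_sum_imp_summable[OF norm] by (rule summable_on_subset) (auto simp: B_def)
    also have "?this \<longleftrightarrow> (\<lambda>i. norm (c i) * l powr - \<sigma>) summable_on B l"
      by (intro summable_on_cong) (auto simp: B_def)
    finally have "(\<lambda>i. norm (c i) * l powr - \<sigma> * l powr \<sigma>) summable_on B l" by (rule summable_on_cmult_left)
    moreover have "l > 0" using that \<Lambda> by force
    then have "l powr - \<sigma> * l powr \<sigma> = 1" by (simp add: powr_add[symmetric])
    ultimately show ?thesis by (simp add: mult.assoc)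
  qed
  have hn: "((\<lambda>l. n l * l powr - \<sigma>) has_sum K) \<Lambda>"
  proof (rule has_sum_SigmaD[OF norm[folded sig]])
    fix l assume l: "l \<in> \<Lambda>"
    have "((\<lambda>i. norm (c i) * l powr - \<sigma>) has_sum n l * l powr - \<sigma>) (B l)"
      unfolding n_def using nB[OF l] by (intro has_sum_cmult_left) simp
    then show "((\<lambda>y. ((\<lambda>i. norm (c i) * m i powr - \<sigma>) \<circ> snd) (l, y)) has_sum n l * l powr - \<sigma>) (B l)"
      by (rule has_sum_cong[THEN iffD1, rotated]) (auto simp: B_def)
  qed
  have an: "norm (a l) \<le> n l" if "l \<in> \<Lambda>" for l
    unfolding a_def n_def using nB[OF that] by (rule norm_infsum_bound)
  have sa: "(\<lambda>l. norm (a l) * l powr - \<sigma>) summable_on \<Lambda>"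
    using Infinite_Sum.abs_summable_on_comparison_test'[OF has_sum_imp_summable[OF hn], of "\<lambda>l. norm (a l) * l powr - \<sigma>"] an
    by (simp add: mult_right_mono)
  have "(\<Sum>\<^sub>\<infinity>l\<in>\<Lambda>. norm (a l) * l powr - \<sigma>) \<le> (\<Sum>\<^sub>\<infinity>l\<in>\<Lambda>. n l * l powr - \<sigma>)"
    using sa has_sum_imp_summable[OF hn] an by (intro infsum_mono) (auto intro: mult_right_mono)
  also have "\<dots> = K" using hn by (rule infsumI)
  finally have le: "(\<Sum>\<^sub>\<infinity>l\<in>\<Lambda>. norm (a l) * l powr - \<sigma>) \<le> K" .
  have "((\<lambda>l. a l * of_real l powr - s) has_sum f s) \<Lambda>" if "Re s \<ge> \<sigma>" for s
  proof (rule has_sum_SigmaD[OF val[OF that, folded sig]])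
    fix l assume l: "l \<in> \<Lambda>"
    have "((\<lambda>i. c i * of_real l powr - s) has_sum a l * of_real l powr - s) (B l)"
      unfolding a_def using abs_summable_summable[OF nB[OF l]] by (intro has_sum_cmult_left) simp
    then show "((\<lambda>y. ((\<lambda>i. c i * of_real (m i) powr - s) \<circ> snd) (l, y)) has_sum a l * of_real l powr - s) (B l)"
      by (rule has_sum_cong[THEN iffD1, rotated]) (auto simp: B_def)
  qed
  with sa le show ?thesis unfolding gds_def gds_coeff_def by blast
qed

lemma gds_mono:
  assumes "gds \<Lambda> \<sigma> K f" "K \<le> K'"
  shows "gds \<Lambda> \<sigma> K' f"
  using assms unfolding gds_def by (meson order_trans)

lemma gds_cong:
  assumes "gds \<Lambda> \<sigma> K f" "\<And>s. Re s \<ge> \<sigma> \<Longrightarrow> f s = g s"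
  shows "gds \<Lambda> \<sigma> K g"
  using assms by (auto simp: gds_def gds_coeff_def)

lemma gds_coeff_mono:
  assumes "gds_coeff \<Lambda> \<sigma> a f" "\<Lambda> \<subseteq> {1..}" "\<sigma> \<le> \<sigma>'"
  shows "gds_coeff \<Lambda> \<sigma>' a f"
    and "(\<Sum>\<^sub>\<infinity>l\<in>\<Lambda>. norm (a l) * l powr - \<sigma>') \<le> (\<Sum>\<^sub>\<infinity>l\<in>\<Lambda>. norm (a l) * l powr - \<sigma>)"
proof -
  have le: "norm (a l) * l powr - \<sigma>' \<le> norm (a l) * l powr - \<sigma>" if "l \<in> \<Lambda>" for l
    using assms that by (intro mult_left_mono powr_mono) auto
  have s: "(\<lambda>l. norm (a l) * l powr - \<sigma>) summable_on \<Lambda>" using assms by (auto simp: gds_coeff_def)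
  have s': "(\<lambda>l. norm (a l) * l powr - \<sigma>') summable_on \<Lambda>"
    using Infinite_Sum.abs_summable_on_comparison_test'[OF s, of "\<lambda>l. norm (a l) * l powr - \<sigma>'"] le by simp
  show "gds_coeff \<Lambda> \<sigma>' a f" using assms s' by (auto simp: gds_coeff_def)
  show "(\<Sum>\<^sub>\<infinity>l\<in>\<Lambda>. norm (a l) * l powr - \<sigma>') \<le> (\<Sum>\<^sub>\<infinity>l\<in>\<Lambda>. norm (a l) * l powr - \<sigma>)"
    using s' s le by (rule infsum_mono)
qed

lemma gds_mono_abscissa:
  assumes "gds \<Lambda> \<sigma> K f" "\<Lambda> \<subseteq> {1..}" "\<sigma> \<le> \<sigma>'"
  shows "gds \<Lambda> \<sigma>' K f"
proof -
  obtain a where a: "gds_coeff \<Lambda> \<sigma> a f" "(\<Sum>\<^sub>\<infinity>l\<in>\<Lambda>. norm (a l) * l powr - \<sigma>) \<le> K"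
    using assms by (auto simp: gds_def)
  show ?thesis unfolding gds_def
    using gds_coeff_mono[OF a(1) assms(2,3)] a(2) by (intro exI[of _ a]) auto
qed

lemma gds_norm_le:
  assumes "gds \<Lambda> \<sigma> K f" "\<Lambda> \<subseteq> {1..}" "Re s \<ge> \<sigma>"
  shows "norm (f s) \<le> K"
proof -
  obtain a where a: "gds_coeff \<Lambda> \<sigma> a f" "(\<Sum>\<^sub>\<infinity>l\<in>\<Lambda>. norm (a l) * l powr - \<sigma>) \<le> K"
    using assms by (auto simp: gds_def)
  have "norm (f s) \<le> (\<Sum>\<^sub>\<infinity>l\<in>\<Lambda>. norm (a l) * l powr - \<sigma>)"
  proof (rule norm_infsum_le)
    show "((\<lambda>l. a l * of_real l powr - s) has_sum f s) \<Lambda>"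
      using a assms by (simp add: gds_coeff_def)
    show "((\<lambda>l. norm (a l) * l powr - \<sigma>) has_sum (\<Sum>\<^sub>\<infinity>l\<in>\<Lambda>. norm (a l) * l powr - \<sigma>)) \<Lambda>"
      using a by (simp add: gds_coeff_def)
    show "norm (a l * of_real l powr - s) \<le> norm (a l) * l powr - \<sigma>" if "l \<in> \<Lambda>" for l
      using assms that by (intro norm_term_le) auto
  qed
  then show ?thesis using a(2) by linarith
qed

lemma gds_monomial:
  assumes "\<Lambda> \<subseteq> {1..}" "l \<in> \<Lambda>"
  shows "gds \<Lambda> \<sigma> (norm c * l powr - \<sigma>) (\<lambda>s. c * of_real l powr - s)"
  using assms by (intro gds_family[where I = "{()}" and m = "\<lambda>_. l" and c = "\<lambda>_. c"]) (auto simp: has_sum_finite_iff)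

lemma gds_const: "\<Lambda> \<subseteq> {1..} \<Longrightarrow> 1 \<in> \<Lambda> \<Longrightarrow> gds \<Lambda> \<sigma> (norm c) (\<lambda>s. c)"
  using gds_monomial[of \<Lambda> 1 \<sigma> c] by simp

lemma gds_times:
  assumes "gds \<Lambda> \<sigma> K f" "gds \<Lambda> \<sigma> L g" "freq_monoid \<Lambda>"
  shows "gds \<Lambda> \<sigma> (K * L) (\<lambda>s. f s * g s)"
proof -
  obtain a where a: "gds_coeff \<Lambda> \<sigma> a f" "(\<Sum>\<^sub>\<infinity>l\<in>\<Lambda>. norm (a l) * l powr - \<sigma>) \<le> K"
    using assms by (auto simp: gds_def)
  obtain b where b: "gds_coeff \<Lambda> \<sigma> b g" "(\<Sum>\<^sub>\<infinity>l\<in>\<Lambda>. norm (b l) * l powr - \<sigma>) \<le> L"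
    using assms by (auto simp: gds_def)
  have \<Lambda>: "\<Lambda> \<subseteq> {1..}" "x \<in> \<Lambda> \<Longrightarrow> y \<in> \<Lambda> \<Longrightarrow> x * y \<in> \<Lambda>" for x y
    using assms by (auto simp: freq_monoid_def)
  then have pos: "l \<in> \<Lambda> \<Longrightarrow> l > 0" for l by force
  let ?A = "\<Sum>\<^sub>\<infinity>l\<in>\<Lambda>. norm (a l) * l powr - \<sigma>" and ?B = "\<Sum>\<^sub>\<infinity>l\<in>\<Lambda>. norm (b l) * l powr - \<sigma>"
  have sa: "(\<lambda>l. norm (a l) * l powr - \<sigma>) summable_on \<Lambda>" and sb: "(\<lambda>l. norm (b l) * l powr - \<sigma>) summable_on \<Lambda>"
    using a b by (auto simp: gds_coeff_def)
  have "gds \<Lambda> \<sigma> (?A * ?B) (\<lambda>s. f s * g s)"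
  proof (rule gds_family[where I = "\<Lambda> \<times> \<Lambda>" and m = "\<lambda>(l, k). l * k" and c = "\<lambda>(l, k). a l * b k"])
    have "((\<lambda>(l, k). (norm (a l) * l powr - \<sigma>) * (norm (b k) * k powr - \<sigma>)) has_sum ?A * ?B) (\<Lambda> \<times> \<Lambda>)"
      using sa sb by (intro has_sum_times) auto
    then show "((\<lambda>i. norm (case i of (l, k) \<Rightarrow> a l * b k) * (case i of (l, k) \<Rightarrow> l * k) powr - \<sigma>) has_sum ?A * ?B) (\<Lambda> \<times> \<Lambda>)"
      by (rule has_sum_cong[THEN iffD1, rotated]) (auto simp: norm_mult powr_mult pos less_imp_le)
    fix s assume s: "Re s \<ge> \<sigma>"
    have "(\<lambda>l. norm (a l * of_real l powr - s)) summable_on \<Lambda>" "(\<lambda>l. norm (b l * of_real l powr - s)) summable_on \<Lambda>"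
      by (rule Infinite_Sum.abs_summable_on_comparison_test'[OF sa] Infinite_Sum.abs_summable_on_comparison_test'[OF sb],
          rule norm_term_le[OF _ s], use \<Lambda>(1) in auto)+
    then have "((\<lambda>(l, k). (a l * of_real l powr - s) * (b k * of_real k powr - s)) has_sum f s * g s) (\<Lambda> \<times> \<Lambda>)"
      using a(1) b(1) s unfolding gds_coeff_def by (intro has_sum_times) simp_all
    then show "((\<lambda>i. (case i of (l, k) \<Rightarrow> a l * b k) * of_real (case i of (l, k) \<Rightarrow> l * k) powr - s) has_sum f s * g s) (\<Lambda> \<times> \<Lambda>)"
      by (rule has_sum_cong[THEN iffD1, rotated]) (auto simp: of_real_mult_powr pos simp del: of_real_mult)
  qed (use \<Lambda> in auto)
  moreover have "?A \<ge> 0" "?B \<ge> 0" by (auto intro!: infsum_nonneg)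
  then have "?A * ?B \<le> K * L" using a b by (intro mult_mono) auto
  ultimately show ?thesis by (rule gds_mono)
qed

lemma gds_sum:
  assumes f: "\<And>k::nat. gds \<Lambda> \<sigma> (K k) (f k)" and K: "summable K" and \<Lambda>: "\<Lambda> \<subseteq> {1..}"
    and F: "\<And>s. Re s \<ge> \<sigma> \<Longrightarrow> (\<lambda>k. f k s) sums F s"
  shows "gds \<Lambda> \<sigma> (\<Sum>k. K k) F"
proof -
  obtain a where a: "\<And>k. gds_coeff \<Lambda> \<sigma> (a k) (f k)" "\<And>k. (\<Sum>\<^sub>\<infinity>l\<in>\<Lambda>. norm (a k l) * l powr - \<sigma>) \<le> K k"
    using f unfolding gds_def by metis
  define n where "n k = (\<Sum>\<^sub>\<infinity>l\<in>\<Lambda>. norm (a k l) * l powr - \<sigma>)" for k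
  have n: "0 \<le> n k" "n k \<le> K k" for k using a(2)[of k] unfolding n_def by (auto intro!: infsum_nonneg)
  have sn: "summable n" by (rule summable_comparison_test'[OF K, of 0]) (use n in auto)
  then have nsum: "(n has_sum (\<Sum>k. n k)) UNIV"
    using n by (intro norm_summable_imp_has_sum summable_sums) auto
  have inner: "((\<lambda>l. norm (a k l) * l powr - \<sigma>) has_sum n k) \<Lambda>" for k
    unfolding n_def using a(1)[of k] by (auto simp: gds_coeff_def)
  have sm: "(\<lambda>(k, l). norm (a k l) * l powr - \<sigma>) summable_on UNIV \<times> \<Lambda>"
    using inner has_sum_imp_summable[OF nsum] by (intro summable_on_SigmaI[where g = n]) auto
  have "gds \<Lambda> \<sigma> (\<Sum>k. n k) F"
  proof (rule gds_family[where I = "UNIV \<times> \<Lambda>" and m = snd and c = "\<lambda>(k, l). a k l"])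
    have "((\<lambda>(k, l). norm (a k l) * l powr - \<sigma>) has_sum (\<Sum>k. n k)) (UNIV \<times> \<Lambda>)"
      using inner nsum sm by (intro has_sum_SigmaI[where g = n]) auto
    then show "((\<lambda>i. norm (case i of (k, l) \<Rightarrow> a k l) * snd i powr - \<sigma>) has_sum (\<Sum>k. n k)) (UNIV \<times> \<Lambda>)"
      by (simp add: case_prod_unfold)
    fix s assume s: "Re s \<ge> \<sigma>"
    have nf: "norm (f k s) \<le> K k" for k using gds_norm_le[OF f \<Lambda> s] .
    have "((\<lambda>(k, l). a k l * of_real l powr - s) has_sum F s) (UNIV \<times> \<Lambda>)"
    proof (rule has_sum_SigmaI[where g = "\<lambda>k. f k s"])
      show "((\<lambda>k. f k s) has_sum F s) UNIV"
        by (rule norm_summable_imp_has_sum[OF summable_comparison_test'[OF K, of 0] F[OF s]]) (simp add: nf)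
      show "((\<lambda>l. case (k, l) of (k, l) \<Rightarrow> a k l * of_real l powr - s) has_sum f k s) \<Lambda>" for k
        using a(1)[of k] s by (auto simp: gds_coeff_def)
      show "(\<lambda>(k, l). a k l * of_real l powr - s) summable_on UNIV \<times> \<Lambda>"
        by (rule abs_summable_summable, rule Infinite_Sum.abs_summable_on_comparison_test'[OF sm])
           (use \<Lambda> s in \<open>auto intro!: norm_term_le\<close>)
    qed
    then show "((\<lambda>i. (case i of (k, l) \<Rightarrow> a k l) * of_real (snd i) powr - s) has_sum F s) (UNIV \<times> \<Lambda>)"
      by (simp add: case_prod_unfold)
  qed (use \<Lambda> in auto)
  moreover have "(\<Sum>k. n k) \<le> (\<Sum>k. K k)" using n sn K by (intro suminf_le) auto
  ultimately show ?thesis by (rule gds_mono)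
qed

lemma gds_power:
  assumes "gds \<Lambda> \<sigma> K f" "freq_monoid \<Lambda>"
  shows "gds \<Lambda> \<sigma> (K ^ n) (\<lambda>s. f s ^ n)"
proof (induction n)
  case 0
  then show ?case using gds_const[of \<Lambda> \<sigma> 1] assms by (simp add: freq_monoid_def)
next
  case (Suc n)
  then show ?case using gds_times[OF assms(1) Suc assms(2)] by simp
qed

lemma gds_cmult:
  assumes "gds \<Lambda> \<sigma> K f" "freq_monoid \<Lambda>"
  shows "gds \<Lambda> \<sigma> (norm c * K) (\<lambda>s. c * f s)"
  using gds_times[OF gds_const assms(1,2)] assms by (simp add: freq_monoid_def)

text \<open>Functional calculus in the weighted coefficient algebra: the power series must converge
  absolutely at the coefficient bound \<open>K\<close>, which is stronger than convergence at the
  values of f.\<close>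

lemma gds_power_series:
  assumes "gds \<Lambda> \<sigma> K f" "freq_monoid \<Lambda>" "summable (\<lambda>k. norm (p k) * K ^ k)"
    and "\<And>s. Re s \<ge> \<sigma> \<Longrightarrow> (\<lambda>k. p k * f s ^ k) sums F s"
  shows "gds \<Lambda> \<sigma> (\<Sum>k. norm (p k) * K ^ k) F"
  using assms by (intro gds_sum[where f = "\<lambda>k s. p k * f s ^ k"] gds_cmult gds_power) (auto simp: freq_monoid_def)

lemma gds_exp:
  assumes "gds \<Lambda> \<sigma> K f" "freq_monoid \<Lambda>"
  shows "gds \<Lambda> \<sigma> (exp K) (\<lambda>s. exp (f s))"
proof -
  have K: "(\<lambda>k. norm (1 / fact k :: complex) * K ^ k) sums exp K"
    using exp_converges[of K] by (simp add: norm_divide scaleR_conv_of_real inverse_eq_divide)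
  have "gds \<Lambda> \<sigma> (\<Sum>k. norm (1 / fact k :: complex) * K ^ k) (\<lambda>s. exp (f s))"
  proof (rule gds_power_series[OF assms])
    show "(\<lambda>k. 1 / fact k * f s ^ k) sums exp (f s)" for s
      using exp_converges[of "f s"] by (simp add: scaleR_conv_of_real divide_inverse mult.commute)
  qed (use K in \<open>simp add: sums_iff\<close>)
  then show ?thesis using K by (simp add: sums_iff)
qed

lemma gds_add:
  assumes "gds \<Lambda> \<sigma> K f" "gds \<Lambda> \<sigma> L g" "\<Lambda> \<subseteq> {1..}"
  shows "gds \<Lambda> \<sigma> (K + L) (\<lambda>s. f s + g s)"
proof -
  obtain a where a: "gds_coeff \<Lambda> \<sigma> a f" "(\<Sum>\<^sub>\<infinity>l\<in>\<Lambda>. norm (a l) * l powr - \<sigma>) \<le> K"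
    using assms by (auto simp: gds_def)
  obtain b where b: "gds_coeff \<Lambda> \<sigma> b g" "(\<Sum>\<^sub>\<infinity>l\<in>\<Lambda>. norm (b l) * l powr - \<sigma>) \<le> L"
    using assms by (auto simp: gds_def)
  have sa: "(\<lambda>l. norm (a l) * l powr - \<sigma>) summable_on \<Lambda>" and sb: "(\<lambda>l. norm (b l) * l powr - \<sigma>) summable_on \<Lambda>"
    using a b by (auto simp: gds_coeff_def)
  have le: "norm (a l + b l) * l powr - \<sigma> \<le> norm (a l) * l powr - \<sigma> + norm (b l) * l powr - \<sigma>" for l
    unfolding distrib_right[symmetric] by (intro mult_right_mono norm_triangle_ineq) auto
  have sab: "(\<lambda>l. norm (a l) * l powr - \<sigma> + norm (b l) * l powr - \<sigma>) summable_on \<Lambda>"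
    using sa sb by (rule summable_on_add)
  have s: "(\<lambda>l. norm (a l + b l) * l powr - \<sigma>) summable_on \<Lambda>"
    using Infinite_Sum.abs_summable_on_comparison_test'[OF sab, of "\<lambda>l. norm (a l + b l) * l powr - \<sigma>"] le by simp
  have "gds_coeff \<Lambda> \<sigma> (\<lambda>l. a l + b l) (\<lambda>s. f s + g s)"
    using a(1) b(1) s by (auto simp: gds_coeff_def distrib_right intro!: has_sum_add)
  moreover have "(\<Sum>\<^sub>\<infinity>l\<in>\<Lambda>. norm (a l + b l) * l powr - \<sigma>) \<le> K + L"
    using infsum_mono[OF s sab le] infsum_add[OF sa sb] a(2) b(2) by linarith
  ultimately show ?thesis unfolding gds_def by blast
qed

section \<open>Leading terms of series with discrete frequencies\<close>

definition discrete_freq :: "real set \<Rightarrow> bool" where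
  "discrete_freq \<Lambda> \<longleftrightarrow> (\<forall>X. finite (\<Lambda> \<inter> {..X}))"

text \<open>Discreteness leaves a gap between \<mu> and the next frequency, so the tail decays like
  \<open>\<nu> powr - \<sigma>\<close> with \<nu> strictly above \<mu>. This follows by writing
  \<open>l powr - \<sigma>\<close> as
  \<open>l powr - \<sigma>0 * l powr (\<sigma>0 - \<sigma>)\<close> and bounding the second factor
  at \<nu>.\<close>

lemma gds_coeff_tail:
  assumes a: "gds_coeff \<Lambda> \<sigma>0 a f" and \<Lambda>: "\<Lambda> \<subseteq> {1..}" "discrete_freq \<Lambda>" and "\<mu> \<ge> 1"
  defines "J \<equiv> {l \<in> \<Lambda>. \<mu> < l}"
  obtains \<nu> C where "\<nu> > \<mu>" "C \<ge> 0"
    "\<And>\<sigma>. \<sigma> \<ge> \<sigma>0 \<Longrightarrow> (\<lambda>l. norm (a l) * l powr - \<sigma>) summable_on J"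
    "\<And>\<sigma>. \<sigma> \<ge> \<sigma>0 \<Longrightarrow> (\<Sum>\<^sub>\<infinity>l\<in>J. norm (a l) * l powr - \<sigma>) \<le> C * \<nu> powr - \<sigma>"
proof -
  \<comment> \<open>The next frequency above \<mu>, capped at \<open>\<mu> + 1\<close> so that the
    minimum is over a nonempty finite set even if no frequency follows soon.\<close>
  define \<nu> where "\<nu> = Min (insert (\<mu> + 1) (J \<inter> {..\<mu> + 1}))"
  have fin: "finite (J \<inter> {..\<mu> + 1})"
    by (rule finite_subset[of _ "\<Lambda> \<inter> {..\<mu> + 1}"]) (use \<Lambda> in \<open>auto simp: discrete_freq_def J_def\<close>)
  then have \<nu>: "\<nu> > \<mu>" unfolding \<nu>_def by (subst Min_gr_iff) (auto simp: J_def)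
  have \<nu>le: "\<nu> \<le> l" if "l \<in> J" for l
  proof (cases "l \<le> \<mu> + 1")
    case True
    then show ?thesis unfolding \<nu>_def using fin that by (intro Min_le) auto
  next
    case False
    have "\<nu> \<le> \<mu> + 1" unfolding \<nu>_def using fin by (intro Min_le) auto
    then show ?thesis using False by linarith
  qed
  define S where "S = (\<Sum>\<^sub>\<infinity>l\<in>J. norm (a l) * l powr - \<sigma>0)"
  have S0: "S \<ge> 0" unfolding S_def by (intro infsum_nonneg) auto
  have s0: "(\<lambda>l. norm (a l) * l powr - \<sigma>0) summable_on J"
    using a by (auto simp: gds_coeff_def J_def intro: summable_on_subset)
  have s: "(\<lambda>l. norm (a l) * l powr - \<sigma>) summable_on J" if "\<sigma> \<ge> \<sigma>0" for \<sigma>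
    using gds_coeff_mono(1)[OF a \<Lambda>(1) that] by (auto simp: gds_coeff_def J_def intro: summable_on_subset)
  show ?thesis
  proof (rule that[of \<nu> "S * \<nu> powr \<sigma>0"])
    fix \<sigma> assume \<sigma>: "\<sigma> \<ge> \<sigma>0"
    have "(\<Sum>\<^sub>\<infinity>l\<in>J. norm (a l) * l powr - \<sigma>) \<le> (\<Sum>\<^sub>\<infinity>l\<in>J. norm (a l) * l powr - \<sigma>0 * \<nu> powr (\<sigma>0 - \<sigma>))"
    proof (rule infsum_mono[OF s[OF \<sigma>] summable_on_cmult_left[OF s0]])
      fix l assume l: "l \<in> J"
      have "l powr - \<sigma> = l powr - \<sigma>0 * l powr (\<sigma>0 - \<sigma>)"
        by (simp add: powr_add[symmetric])
      also have "\<dots> \<le> l powr - \<sigma>0 * \<nu> powr (\<sigma>0 - \<sigma>)"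
        using \<nu>le[OF l] \<nu> \<open>\<mu> \<ge> 1\<close> \<sigma> by (intro mult_left_mono powr_mono2') auto
      finally show "norm (a l) * l powr - \<sigma> \<le> norm (a l) * l powr - \<sigma>0 * \<nu> powr (\<sigma>0 - \<sigma>)"
        by (simp add: mult.assoc mult_left_mono)
    qed
    also have "\<dots> = S * \<nu> powr (\<sigma>0 - \<sigma>)"
      unfolding S_def using s0 by (intro infsum_cmult_left) auto
    also have "\<dots> = S * \<nu> powr \<sigma>0 * \<nu> powr - \<sigma>" by (simp add: powr_add[symmetric] mult.assoc)
    finally show "(\<Sum>\<^sub>\<infinity>l\<in>J. norm (a l) * l powr - \<sigma>) \<le> S * \<nu> powr \<sigma>0 * \<nu> powr - \<sigma>" .
  qed (use \<nu> s S0 in auto)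
qed

lemma gds_coeff_remove_leading:
  assumes a: "gds_coeff \<Lambda> \<sigma> a f" and \<mu>: "\<mu> \<in> \<Lambda>" "\<And>l. l \<in> \<Lambda> \<Longrightarrow> l < \<mu> \<Longrightarrow> a l = 0" and s: "Re s \<ge> \<sigma>"
  shows "((\<lambda>l. a l * of_real l powr - s) has_sum (f s - a \<mu> * of_real \<mu> powr - s)) {l \<in> \<Lambda>. \<mu> < l}"
proof -
  have f: "((\<lambda>l. a l * of_real l powr - s) has_sum f s) \<Lambda>" using a s by (auto simp: gds_coeff_def)
  have "((\<lambda>l. a l * of_real l powr - s) has_sum (f s - a \<mu> * of_real \<mu> powr - s)) (\<Lambda> - {\<mu>})"
    by (rule has_sum_Diff[OF f has_sum_finiteI]) (use \<mu>(1) in auto)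
  also have "?this \<longleftrightarrow> ?thesis"
    using \<mu> by (intro has_sum_cong_neutral) auto
  finally show ?thesis .
qed

lemma gds_coeff_leading:
  assumes a: "gds_coeff \<Lambda> \<sigma>0 a f" and \<Lambda>: "\<Lambda> \<subseteq> {1..}" "discrete_freq \<Lambda>"
    and \<mu>: "\<mu> \<in> \<Lambda>" "\<And>l. l \<in> \<Lambda> \<Longrightarrow> l < \<mu> \<Longrightarrow> a l = 0"
  obtains \<nu> C where "\<nu> > \<mu>" "C \<ge> 0"
    "\<And>s. Re s \<ge> \<sigma>0 \<Longrightarrow> norm (f s - a \<mu> * of_real \<mu> powr - s) \<le> C * \<nu> powr - Re s"
proof -
  have "\<mu> \<ge> 1" using \<mu> \<Lambda> by auto
  from gds_coeff_tail[OF a \<Lambda> this] obtain \<nu> C where \<nu>: "\<nu> > \<mu>" "C \<ge> 0"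
    and sm: "\<And>\<sigma>. \<sigma> \<ge> \<sigma>0 \<Longrightarrow> (\<lambda>l. norm (a l) * l powr - \<sigma>) summable_on {l \<in> \<Lambda>. \<mu> < l}"
    and le: "\<And>\<sigma>. \<sigma> \<ge> \<sigma>0 \<Longrightarrow> (\<Sum>\<^sub>\<infinity>l\<in>{l \<in> \<Lambda>. \<mu> < l}. norm (a l) * l powr - \<sigma>) \<le> C * \<nu> powr - \<sigma>"
    by blast
  show ?thesis
  proof (rule that[OF \<nu>])
    fix s assume s: "Re s \<ge> \<sigma>0"
    have "norm (f s - a \<mu> * of_real \<mu> powr - s) \<le> (\<Sum>\<^sub>\<infinity>l\<in>{l \<in> \<Lambda>. \<mu> < l}. norm (a l) * l powr - Re s)"
    proof (rule norm_infsum_le)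
      show "((\<lambda>l. a l * of_real l powr - s) has_sum (f s - a \<mu> * of_real \<mu> powr - s)) {l \<in> \<Lambda>. \<mu> < l}"
        by (rule gds_coeff_remove_leading[OF a \<mu> s])
      show "norm (a l * of_real l powr - s) \<le> norm (a l) * l powr - Re s" if "l \<in> {l \<in> \<Lambda>. \<mu> < l}" for l
        using \<Lambda> that by (intro norm_term_le) auto
    qed (use sm[OF s] in simp)
    with le[OF s] show "norm (f s - a \<mu> * of_real \<mu> powr - s) \<le> C * \<nu> powr - Re s" by linarith
  qed
qed

lemma powr_ratio_tendsto_0:
  assumes "0 < \<mu>" "\<mu> < (\<nu>::real)"
  shows "((\<lambda>\<sigma>. C * \<nu> powr - \<sigma> * \<mu> powr \<sigma>) \<longlongrightarrow> 0) at_top"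
proof -
  have "((\<lambda>\<sigma>. C * exp (- (ln (\<nu> / \<mu>) * \<sigma>))) \<longlongrightarrow> C * 0) at_top"
    using assms
    by (intro tendsto_intros filterlim_compose[OF exp_at_bot] filterlim_compose[OF filterlim_uminus_at_bot_at_top]
        filterlim_tendsto_pos_mult_at_top[OF tendsto_const] filterlim_ident) auto
  moreover have "\<nu> powr - \<sigma> * \<mu> powr \<sigma> = exp (- (ln (\<nu> / \<mu>) * \<sigma>))" for \<sigma>
    using assms by (simp add: powr_def exp_add[symmetric] ln_div algebra_simps)
  ultimately show ?thesis by (simp add: mult.assoc)
qed

lemma first_coeff_exists:
  assumes "discrete_freq \<Lambda>" "l \<in> \<Lambda>" "a l \<noteq> (0::complex)"
  obtains \<mu> where "\<mu> \<in> \<Lambda>" "a \<mu> \<noteq> 0" "\<And>k. k \<in> \<Lambda> \<Longrightarrow> k < \<mu> \<Longrightarrow> a k = 0" "\<mu> \<le> l"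
proof -
  let ?S = "{k \<in> \<Lambda> \<inter> {..l}. a k \<noteq> 0}"
  have fin: "finite ?S"
    by (rule finite_subset[of _ "\<Lambda> \<inter> {..l}"]) (use assms in \<open>auto simp: discrete_freq_def\<close>)
  have ne: "?S \<noteq> {}" using assms by auto
  have "Min ?S \<in> ?S" using fin ne by (rule Min_in)
  moreover have "a k = 0" if "k \<in> \<Lambda>" "k < Min ?S" for k
  proof (rule ccontr)
    assume "a k \<noteq> 0"
    then have "k \<in> ?S" using that \<open>Min ?S \<in> ?S\<close> by auto
    then show False using Min_le[OF fin] that by fastforce
  qed
  ultimately show ?thesis using that[of "Min ?S"] by blast
qed

text \<open>Uniqueness of coefficients. If \<mu> were the first frequency with a nonzero
  coefficient, multiplying by \<open>\<mu> powr \<sigma>\<close> at real \<open>s = \<sigma>\<close>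
  would bound this fixed coefficient by a tail that tends to 0.\<close>

lemma gds_coeff_zero:
  assumes a: "gds_coeff \<Lambda> \<sigma>0 a (\<lambda>_. 0)" and \<Lambda>: "\<Lambda> \<subseteq> {1..}" "discrete_freq \<Lambda>" and l: "l \<in> \<Lambda>"
  shows "a l = 0"
proof (rule ccontr)
  assume "a l \<noteq> 0"
  from first_coeff_exists[where a = a, OF \<Lambda>(2) l this] obtain \<mu> where
    \<mu>: "\<mu> \<in> \<Lambda>" "a \<mu> \<noteq> 0" "\<And>k. k \<in> \<Lambda> \<Longrightarrow> k < \<mu> \<Longrightarrow> a k = 0" by blast
  have pos: "\<mu> > 0" using \<mu> \<Lambda> by force
  obtain \<nu> C where \<nu>: "\<nu> > \<mu>" "C \<ge> 0"
    "\<And>s. Re s \<ge> \<sigma>0 \<Longrightarrow> norm (0 - a \<mu> * of_real \<mu> powr - s) \<le> C * \<nu> powr - Re s"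
    using gds_coeff_leading[OF a \<Lambda> \<mu>(1,3)] by blast
  have le: "norm (a \<mu>) \<le> C * \<nu> powr - \<sigma> * \<mu> powr \<sigma>" if "\<sigma> \<ge> \<sigma>0" for \<sigma>
  proof -
    have "norm (a \<mu>) * \<mu> powr - \<sigma> \<le> C * \<nu> powr - \<sigma>"
      using \<nu>(3)[of "of_real \<sigma>"] that pos by (simp add: norm_mult norm_of_real_powr)
    then have "norm (a \<mu>) * \<mu> powr - \<sigma> * \<mu> powr \<sigma> \<le> C * \<nu> powr - \<sigma> * \<mu> powr \<sigma>"
      by (intro mult_right_mono) auto
    then show ?thesis using pos by (simp add: mult.assoc powr_add[symmetric])
  qed
  have "eventually (\<lambda>\<sigma>. norm (a \<mu>) \<le> C * \<nu> powr - \<sigma> * \<mu> powr \<sigma>) at_top"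
    using le by (rule eventually_at_top_linorderI)
  with powr_ratio_tendsto_0[OF pos \<nu>(1)] have "norm (a \<mu>) \<le> 0"
    by (rule tendsto_lowerbound) simp
  then show False using \<mu> by simp
qed

text \<open>Smallness is obtained in the coefficient norm, not merely in the sup norm, as the
  functional calculus requires.\<close>

lemma gds_coeff_minus_const:
  assumes a: "gds_coeff \<Lambda> \<sigma>0 a f" and \<Lambda>: "\<Lambda> \<subseteq> {1..}" "discrete_freq \<Lambda>" "1 \<in> \<Lambda>" and "\<epsilon> > 0"
  obtains \<sigma> where "\<sigma> \<ge> \<sigma>0" "gds \<Lambda> \<sigma> \<epsilon> (\<lambda>s. f s - a 1)"
proof -
  let ?J = "{l \<in> \<Lambda>. 1 < l}"
  have none: "\<And>l. l \<in> \<Lambda> \<Longrightarrow> l < 1 \<Longrightarrow> a l = 0" using \<Lambda> by auto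
  obtain \<nu> C where \<nu>: "\<nu> > 1" "C \<ge> 0"
    and sm: "\<And>\<sigma>. \<sigma> \<ge> \<sigma>0 \<Longrightarrow> (\<lambda>l. norm (a l) * l powr - \<sigma>) summable_on ?J"
    and le: "\<And>\<sigma>. \<sigma> \<ge> \<sigma>0 \<Longrightarrow> (\<Sum>\<^sub>\<infinity>l\<in>?J. norm (a l) * l powr - \<sigma>) \<le> C * \<nu> powr - \<sigma>"
    using gds_coeff_tail[OF a \<Lambda>(1,2) order_refl] by blast
  have "eventually (\<lambda>\<sigma>. C * \<nu> powr - \<sigma> * 1 powr \<sigma> < \<epsilon>) at_top"
    using powr_ratio_tendsto_0[of 1 \<nu> C] \<nu> \<open>\<epsilon> > 0\<close> by (intro order_tendstoD) auto
  then have "eventually (\<lambda>\<sigma>. \<sigma> \<ge> \<sigma>0 \<and> C * \<nu> powr - \<sigma> < \<epsilon>) at_top"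
    using eventually_ge_at_top[of \<sigma>0] by eventually_elim simp
  then obtain \<sigma> where \<sigma>: "\<sigma> \<ge> \<sigma>0" "C * \<nu> powr - \<sigma> < \<epsilon>"
    by (auto dest: eventually_happens)
  have "gds \<Lambda> \<sigma> (\<Sum>\<^sub>\<infinity>l\<in>?J. norm (a l) * l powr - \<sigma>) (\<lambda>s. f s - a 1)"
  proof (rule gds_family[where I = ?J and m = "\<lambda>l. l" and c = a])
    fix s assume "Re s \<ge> \<sigma>"
    then show "((\<lambda>l. a l * of_real l powr - s) has_sum (f s - a 1)) ?J"
      using gds_coeff_remove_leading[OF a \<Lambda>(3) none, of s] \<sigma>(1) by simp
  qed (use \<Lambda> sm[OF \<sigma>(1)] in auto)
  then show ?thesis using le[OF \<sigma>(1)] \<sigma> by (intro that[of \<sigma>] gds_mono[of _ _ _ _ \<epsilon>]) auto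
qed

text \<open>Factoring out the leading term turns each later frequency l into
  \<open>l / \<mu>\<close>, which exceeds 1 but is usually no integer; \<open>M\<close> collects
  these ratios. Since the tail decays strictly faster than the leading term, a large abscissa makes
  the relative remainder small enough for a logarithm.\<close>

lemma gds_coeff_quotient:
  assumes a: "gds_coeff \<Lambda> \<sigma>0 a f" and \<Lambda>: "\<Lambda> \<subseteq> {1..}" "discrete_freq \<Lambda>"
    and \<mu>: "\<mu> \<in> \<Lambda>" "a \<mu> \<noteq> 0" "\<And>l. l \<in> \<Lambda> \<Longrightarrow> l < \<mu> \<Longrightarrow> a l = 0"
    and M: "M \<subseteq> {1..}" "\<And>l. l \<in> \<Lambda> \<Longrightarrow> \<mu> < l \<Longrightarrow> l / \<mu> \<in> M" and "\<epsilon> > 0"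
  obtains \<sigma> where "\<sigma> \<ge> \<sigma>0" "gds M \<sigma> \<epsilon> (\<lambda>s. f s * of_real \<mu> powr s / a \<mu> - 1)"
proof -
  let ?J = "{l \<in> \<Lambda>. \<mu> < l}"
  have \<mu>1: "\<mu> \<ge> 1" using \<mu> \<Lambda> by auto
  from gds_coeff_tail[OF a \<Lambda> \<mu>1] obtain \<nu> C where \<nu>: "\<nu> > \<mu>" "C \<ge> 0"
    and sm: "\<And>\<sigma>. \<sigma> \<ge> \<sigma>0 \<Longrightarrow> (\<lambda>l. norm (a l) * l powr - \<sigma>) summable_on ?J"
    and le: "\<And>\<sigma>. \<sigma> \<ge> \<sigma>0 \<Longrightarrow> (\<Sum>\<^sub>\<infinity>l\<in>?J. norm (a l) * l powr - \<sigma>) \<le> C * \<nu> powr - \<sigma>"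
    by blast
  have "eventually (\<lambda>\<sigma>. C / norm (a \<mu>) * \<nu> powr - \<sigma> * \<mu> powr \<sigma> < \<epsilon>) at_top"
    using powr_ratio_tendsto_0[of \<mu> \<nu> "C / norm (a \<mu>)"] \<nu> \<mu>1 \<open>\<epsilon> > 0\<close> by (intro order_tendstoD) auto
  then have "eventually (\<lambda>\<sigma>. \<sigma> \<ge> \<sigma>0 \<and> C / norm (a \<mu>) * \<nu> powr - \<sigma> * \<mu> powr \<sigma> < \<epsilon>) at_top"
    using eventually_ge_at_top[of \<sigma>0] by eventually_elim simp
  then obtain \<sigma> where \<sigma>: "\<sigma> \<ge> \<sigma>0" "C / norm (a \<mu>) * \<nu> powr - \<sigma> * \<mu> powr \<sigma> < \<epsilon>"
    by (auto dest: eventually_happens)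
  let ?S = "\<Sum>\<^sub>\<infinity>l\<in>?J. norm (a l) * l powr - \<sigma>"
  have dv: "(l / \<mu>) powr - \<sigma> = l powr - \<sigma> * \<mu> powr \<sigma>" if "l \<in> ?J" for l
    using that \<mu>1 by (simp add: powr_divide powr_minus field_simps)
  have dvc: "of_real (l / \<mu>) powr - s = of_real l powr - s * complex_of_real \<mu> powr s" if "l \<in> ?J" for l s
  proof -
    have "complex_of_real l powr - s = of_real (l / \<mu> * \<mu>) powr - s" using \<mu>1 by simp
    also have "\<dots> = of_real (l / \<mu>) powr - s * of_real \<mu> powr - s"
      using that \<mu>1 by (intro of_real_mult_powr) auto
    finally show ?thesis using \<mu>1 by (simp add: powr_minus field_simps)
  qed
  have "gds M \<sigma> (?S * (\<mu> powr \<sigma> / norm (a \<mu>))) (\<lambda>s. f s * of_real \<mu> powr s / a \<mu> - 1)"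
  proof (rule gds_family[where I = ?J and m = "\<lambda>l. l / \<mu>" and c = "\<lambda>l. a l / a \<mu>"])
    have "((\<lambda>l. norm (a l) * l powr - \<sigma> * (\<mu> powr \<sigma> / norm (a \<mu>))) has_sum (?S * (\<mu> powr \<sigma> / norm (a \<mu>)))) ?J"
      using sm[OF \<sigma>(1)] by (intro has_sum_cmult_left) simp
    then show "((\<lambda>l. norm (a l / a \<mu>) * (l / \<mu>) powr - \<sigma>) has_sum (?S * (\<mu> powr \<sigma> / norm (a \<mu>)))) ?J"
      by (rule has_sum_cong[THEN iffD1, rotated]) (simp add: dv norm_divide)
    fix s assume s: "Re s \<ge> \<sigma>"
    have "((\<lambda>l. a l * of_real l powr - s * (of_real \<mu> powr s / a \<mu>)) has_sum
        ((f s - a \<mu> * of_real \<mu> powr - s) * (of_real \<mu> powr s / a \<mu>))) ?J"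
      using gds_coeff_remove_leading[OF a \<mu>(1,3), of s] s \<sigma>(1) by (intro has_sum_cmult_left) simp
    also have "(f s - a \<mu> * of_real \<mu> powr - s) * (of_real \<mu> powr s / a \<mu>) = f s * of_real \<mu> powr s / a \<mu> - 1"
      using \<mu>(2) \<mu>1 by (simp add: powr_minus field_simps)
    finally show "((\<lambda>l. a l / a \<mu> * of_real (l / \<mu>) powr - s) has_sum (f s * of_real \<mu> powr s / a \<mu> - 1)) ?J"
      by (rule has_sum_cong[THEN iffD1, rotated]) (simp add: dvc del: of_real_divide)
  qed (use M in auto)
  moreover have "?S * (\<mu> powr \<sigma> / norm (a \<mu>)) \<le> \<epsilon>"
  proof -
    have "?S * (\<mu> powr \<sigma> / norm (a \<mu>)) \<le> (C * \<nu> powr - \<sigma>) * (\<mu> powr \<sigma> / norm (a \<mu>))"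
      using le[OF \<sigma>(1)] by (intro mult_right_mono) auto
    then show ?thesis using \<sigma>(2) by (simp add: mult_ac)
  qed
  ultimately show ?thesis using \<sigma>(1) by (intro that[of \<sigma>] gds_mono[of _ _ _ _ \<epsilon>])
qed

section \<open>Ordinary Dirichlet series\<close>

definition nat_freq :: "real set" where
  "nat_freq = range (\<lambda>n. real (Suc n))"

lemma nat_freq_ge_1: "nat_freq \<subseteq> {1..}"
  by (auto simp: nat_freq_def)

lemma nat_freq_iff: "l \<in> nat_freq \<longleftrightarrow> (\<exists>n\<ge>1. l = real n)"
proof
  assume "\<exists>n\<ge>1. l = real n"
  then obtain n where "n \<ge> 1" "l = real n" by blast
  then show "l \<in> nat_freq" unfolding nat_freq_def by (intro image_eqI[of _ _ "n - 1"]) auto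
next
  assume "l \<in> nat_freq"
  then obtain n where "l = real (Suc n)" by (auto simp: nat_freq_def)
  then show "\<exists>n\<ge>1. l = real n" by (intro exI[of _ "Suc n"]) simp
qed

lemma freq_monoid_nat_freq: "freq_monoid nat_freq"
proof -
  have "x * y \<in> nat_freq" if xy: "x \<in> nat_freq" "y \<in> nat_freq" for x y
  proof -
    obtain m n where "m \<ge> 1" "x = real m" "n \<ge> 1" "y = real n"
      using xy unfolding nat_freq_iff by blast
    then show ?thesis unfolding nat_freq_iff by (intro exI[of _ "m * n"]) (simp add: Suc_le_eq)
  qed
  then show ?thesis using nat_freq_ge_1 nat_freq_iff[of 1] by (auto simp: freq_monoid_def)
qed

lemma discrete_freq_nat_freq: "discrete_freq nat_freq"
  unfolding discrete_freq_def
proof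
  fix X
  have "nat_freq \<inter> {..X} \<subseteq> real ` {..nat \<lceil>X\<rceil>}"
    by (auto simp: nat_freq_iff image_iff) (use of_nat_ceiling in \<open>linarith\<close>)
  then show "finite (nat_freq \<inter> {..X})" by (rule finite_subset) simp
qed

lemma summable_shifted_powr:
  assumes "p < -1"
  shows "summable (\<lambda>n. real (Suc n) powr p)"
  using assms unfolding summable_Suc_iff[of "\<lambda>n. real n powr p"] summable_real_powr_iff by simp

text \<open>Convergence at s bounds the terms there, and the extra factor
  \<open>n powr (Re s - \<sigma>)\<close> has exponent below -1. This is the passage from
  conditional to absolute convergence.\<close>

lemma dirichlet_abs_summable:
  assumes "summable (\<lambda>n. a (Suc n) * of_nat (Suc n) powr - s)" "\<sigma> > Re s + 1"
  shows "summable (\<lambda>n. norm (a (Suc n) :: complex) * real (Suc n) powr - \<sigma>)"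
proof -
  have "Bseq (\<lambda>n. a (Suc n) * of_nat (Suc n) powr - s)"
    using summable_LIMSEQ_zero[OF assms(1)] by (intro convergent_imp_Bseq) (auto simp: convergent_def)
  then obtain B where B: "\<And>n. norm (a (Suc n) * of_nat (Suc n) powr - s) \<le> B" by (auto simp: Bseq_def)
  have nb: "norm (a (Suc n)) * real (Suc n) powr - \<sigma> \<le> B * real (Suc n) powr (Re s - \<sigma>)" for n
  proof -
    have "norm (a (Suc n)) * real (Suc n) powr - \<sigma> =
        (norm (a (Suc n)) * real (Suc n) powr - Re s) * real (Suc n) powr (Re s - \<sigma>)"
      unfolding mult.assoc powr_add[symmetric] by simp
    also have "norm (a (Suc n)) * real (Suc n) powr - Re s = norm (a (Suc n) * of_nat (Suc n) powr - s)"
      using norm_of_real_powr[of "real (Suc n)" "- s"] by (simp add: norm_mult)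
    also have "\<dots> * real (Suc n) powr (Re s - \<sigma>) \<le> B * real (Suc n) powr (Re s - \<sigma>)"
      by (intro mult_right_mono B) auto
    finally show ?thesis .
  qed
  have "summable (\<lambda>n. B * real (Suc n) powr (Re s - \<sigma>))"
    using assms(2) by (intro summable_mult summable_shifted_powr) auto
  then show ?thesis
    by (rule summable_comparison_test'[of _ 0]) (simp add: abs_mult nb del: of_nat_Suc)
qed

lemma gds_coeff_nat_freq_iff:
  "gds_coeff nat_freq \<sigma> a f \<longleftrightarrow> summable (\<lambda>n. norm (a (real (Suc n))) * real (Suc n) powr - \<sigma>) \<and>
     (\<forall>s. Re s \<ge> \<sigma> \<longrightarrow> (\<lambda>n. a (real (Suc n)) * of_nat (Suc n) powr - s) sums f s)" (is "?L \<longleftrightarrow> ?R")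
proof -
  have inj: "inj (\<lambda>n. real (Suc n))" by (auto intro: injI)
  have 1: "(\<lambda>l. norm (a l) * l powr - \<sigma>) summable_on nat_freq \<longleftrightarrow>
      summable (\<lambda>n. norm (a (real (Suc n))) * real (Suc n) powr - \<sigma>)"
    unfolding nat_freq_def
    by (subst summable_on_reindex[OF inj]) (simp add: o_def summable_on_UNIV_nonneg_real_iff del: of_nat_Suc)
  have 2: "((\<lambda>l. a l * of_real l powr - s) has_sum f s) nat_freq \<longleftrightarrow>
      ((\<lambda>n. a (real (Suc n)) * of_nat (Suc n) powr - s) has_sum f s) UNIV" for s
    unfolding nat_freq_def by (subst has_sum_reindex[OF inj]) (simp add: o_def)
  have 3: "((\<lambda>n. a (real (Suc n)) * of_nat (Suc n) powr - s) has_sum f s) UNIV \<longleftrightarrow>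
      (\<lambda>n. a (real (Suc n)) * of_nat (Suc n) powr - s) sums f s"
    if s: "Re s \<ge> \<sigma>" and sm: "summable (\<lambda>n. norm (a (real (Suc n))) * real (Suc n) powr - \<sigma>)" for s
  proof
    have "norm (a (real (Suc n)) * of_nat (Suc n) powr - s) \<le> norm (a (real (Suc n))) * real (Suc n) powr - \<sigma>" for n
      using norm_term_le[of "real (Suc n)" \<sigma> s] s by simp
    then have "summable (\<lambda>n. norm (a (real (Suc n)) * of_nat (Suc n) powr - s))"
      by (intro summable_comparison_test'[OF sm, of 0]) simp
    then show "(\<lambda>n. a (real (Suc n)) * of_nat (Suc n) powr - s) sums f s \<Longrightarrow>
      ((\<lambda>n. a (real (Suc n)) * of_nat (Suc n) powr - s) has_sum f s) UNIV"
      by (rule norm_summable_imp_has_sum)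
  qed (rule has_sum_imp_sums)
  show ?thesis unfolding gds_coeff_def 1 2 using 3 by blast
qed

text \<open>General series carry coefficients indexed by real frequencies;
  \<open>nat \<lfloor>l\<rfloor>\<close> recovers the integer index, exactly on
  \<open>nat_freq\<close>.\<close>

lemma has_dirichlet_series_on_gds_coeff:
  assumes "has_dirichlet_series_on a f (half_plane \<theta>)" "\<sigma> > \<theta> + 1"
  shows "gds_coeff nat_freq \<sigma> (\<lambda>l. a (nat \<lfloor>l\<rfloor>)) f"
proof -
  \<comment> \<open>Convergence is known only strictly to the right of \<theta>, and absolute
    convergence costs more than one further unit; the strict inequality on \<sigma> leaves room for
    such a base point.\<close>
  obtain \<theta>' where \<theta>': "\<theta> < \<theta>'" "\<theta>' + 1 < \<sigma>"
    using dense[of \<theta> "\<sigma> - 1"] assms(2) by (auto simp: field_simps)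
  have "summable (\<lambda>n. a (Suc n) * of_nat (Suc n) powr - of_real \<theta>')"
    using assms(1) \<theta>' by (auto simp: has_dirichlet_series_on_def half_plane_def sums_iff)
  then have "summable (\<lambda>n. norm (a (Suc n)) * real (Suc n) powr - \<sigma>)"
    using \<theta>' by (intro dirichlet_abs_summable) auto
  moreover have "nat \<lfloor>real (Suc n)\<rfloor> = Suc n" for n by (metis floor_of_nat nat_int)
  ultimately show ?thesis
    using assms unfolding gds_coeff_nat_freq_iff has_dirichlet_series_on_def half_plane_def
    by (simp del: of_nat_Suc)
qed

lemma gds_imp_dirichlet:
  assumes "gds nat_freq \<sigma> K f"
  obtains a where "summable (\<lambda>n. norm (a (Suc n)) * real (Suc n) powr - \<sigma>)"
    "\<And>s. Re s \<ge> \<sigma> \<Longrightarrow> (\<lambda>n. a (Suc n) * of_nat (Suc n) powr - s) sums f s"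
proof -
  obtain a where "gds_coeff nat_freq \<sigma> a f" using assms by (auto simp: gds_def)
  then show ?thesis using that[of "\<lambda>n. a (real n)"] by (auto simp: gds_coeff_nat_freq_iff)
qed

section \<open>Uniform convergence, holomorphy and members of the algebra\<close>

lemma norm_powr_diff_le:
  assumes "m \<ge> 1" "Re z \<ge> \<delta>" "\<delta> \<ge> 0"
  shows "norm (of_real m powr - z - of_real (m + 1) powr - z) \<le> norm z * m powr (- \<delta> - 1)"
proof -
  let ?S = "closed_segment (complex_of_real m) (of_real (m + 1))"
  have "norm (of_real m powr - z - of_real (m + 1) powr - z) \<le> (norm z * m powr (- \<delta> - 1)) * norm (of_real m - complex_of_real (m + 1))"
  proof (rule field_differentiable_bound[where S = ?S and f' = "\<lambda>w. - z * w powr (- z - 1)"])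
    fix w assume "w \<in> ?S"
    then obtain t where t: "w = of_real t" "t \<ge> m"
      using assms unfolding closed_segment_of_real by (auto simp: closed_segment_eq_real_ivl)
    show "((\<lambda>w. w powr - z) has_field_derivative - z * w powr (- z - 1)) (at w within ?S)"
      using t assms has_field_derivative_powr[of w "- z"]
      by (auto intro!: has_field_derivative_at_within simp: complex_nonpos_Reals_iff)
    have "norm (- z * w powr (- z - 1)) = norm z * t powr (- Re z - 1)"
      using t assms by (simp add: norm_mult norm_of_real_powr)
    also have "\<dots> \<le> norm z * t powr (- \<delta> - 1)"
      using t assms by (intro mult_left_mono powr_mono) auto
    also have "\<dots> \<le> norm z * m powr (- \<delta> - 1)"
      using t assms by (intro mult_left_mono powr_mono2') auto
    finally show "norm (- z * w powr (- z - 1)) \<le> norm z * m powr (- \<delta> - 1)" .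
  qed auto
  then show ?thesis by simp
qed

lemma summation_by_parts:
  fixes c b :: "nat \<Rightarrow> 'a :: comm_ring"
  shows "(\<Sum>n<N. c n * b n) = (\<Sum>k<N. c k) * b N + (\<Sum>n<N. (\<Sum>k<Suc n. c k) * (b n - b (Suc n)))"
  by (induction N) (simp_all add: algebra_simps)

text \<open>Convergence of \<open>c\<close> may be conditional, so its terms give no summable
  majorant. Summation by parts uses instead that its partial sums are bounded: the boundary term
  decays like \<open>N powr - \<delta>\<close>, and the increments of \<open>n powr - z\<close> are
  at most \<open>R * n powr (- \<delta> - 1)\<close>, which permits the Weierstrass test.\<close>

lemma dirichlet_uniform_limit:
  assumes c: "summable (\<lambda>n. c n :: complex)" and "\<delta> > 0"
    and S: "\<And>z. z \<in> S \<Longrightarrow> Re z \<ge> \<delta>" "\<And>z. z \<in> S \<Longrightarrow> norm z \<le> R"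
    and f: "\<And>z. z \<in> S \<Longrightarrow> (\<lambda>n. c n * of_nat (Suc n) powr - z) sums f z"
  shows "uniform_limit S (\<lambda>N z. \<Sum>n<N. c n * of_nat (Suc n) powr - z) f sequentially"
proof (cases "S = {}")
  case False
  then have R: "R \<ge> 0" using S(2) by (meson equals0I norm_ge_zero order_trans)
  have "Bseq (\<lambda>n. \<Sum>k<n. c k)"
    using summable_LIMSEQ[OF c] by (intro convergent_imp_Bseq) (auto simp: convergent_def)
  then obtain K where K: "K > 0" "\<And>n. norm (\<Sum>k<n. c k) \<le> K" by (auto simp: Bseq_def)
  let ?b = "\<lambda>z n. of_nat (Suc n) powr - (z :: complex)"
  define u where "u N z = (\<Sum>k<N. c k) * ?b z N" for N z
  define v where "v n z = (\<Sum>k<Suc n. c k) * (?b z n - ?b z (Suc n))" for n z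
  have "uniform_limit S u (\<lambda>_. 0) sequentially"
  proof (rule uniform_limit_sequentially_iff[THEN iffD2], safe)
    fix e :: real assume "e > 0"
    have "(\<lambda>N. K * real (Suc N) powr - \<delta>) \<longlonglongrightarrow> K * 0"
      using \<open>\<delta> > 0\<close> by (intro tendsto_intros tendsto_neg_powr filterlim_compose[OF filterlim_real_sequentially filterlim_Suc]) auto
    then have "eventually (\<lambda>N. K * real (Suc N) powr - \<delta> < e) sequentially"
      using \<open>e > 0\<close> by (intro order_tendstoD) auto
    then obtain N0 where N0: "\<And>N. N \<ge> N0 \<Longrightarrow> K * real (Suc N) powr - \<delta> < e"
      by (auto simp: eventually_sequentially)
    show "\<exists>N. \<forall>n\<ge>N. \<forall>x\<in>S. dist (u n x) 0 < e"
    proof (intro exI allI impI ballI)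
      fix N z assume N: "N \<ge> N0" and z: "z \<in> S"
      have "norm (u N z) \<le> norm (\<Sum>k<N. c k) * real (Suc N) powr - \<delta>"
        unfolding u_def using norm_term_le[of "real (Suc N)" \<delta> z "\<Sum>k<N. c k"] S(1)[OF z] by simp
      also have "\<dots> \<le> K * real (Suc N) powr - \<delta>" by (intro mult_right_mono K) auto
      finally show "dist (u N z) 0 < e" using N0[OF N] by (simp del: of_nat_Suc)
    qed
  qed
  moreover have "uniform_limit S (\<lambda>N z. \<Sum>n<N. v n z) (\<lambda>z. \<Sum>n. v n z) sequentially"
  proof (rule Weierstrass_m_test)
    show "summable (\<lambda>n. K * R * real (Suc n) powr (- \<delta> - 1))"
      using \<open>\<delta> > 0\<close> by (intro summable_mult summable_shifted_powr) auto
    fix n z assume z: "z \<in> S"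
    have "norm (?b z n - ?b z (Suc n)) \<le> norm z * real (Suc n) powr (- \<delta> - 1)"
      using norm_powr_diff_le[of "real (Suc n)" \<delta> z] S(1)[OF z] \<open>\<delta> > 0\<close> by (simp add: add.commute)
    also have "\<dots> \<le> R * real (Suc n) powr (- \<delta> - 1)" using S(2)[OF z] by (intro mult_right_mono) auto
    finally have "norm (v n z) \<le> K * (R * real (Suc n) powr (- \<delta> - 1))"
      unfolding v_def norm_mult by (intro mult_mono K(2)) (use K(1) in auto)
    then show "norm (v n z) \<le> K * R * real (Suc n) powr (- \<delta> - 1)" by (simp add: mult.assoc)
  qed
  ultimately have "uniform_limit S (\<lambda>N z. u N z + (\<Sum>n<N. v n z)) (\<lambda>z. 0 + (\<Sum>n. v n z)) sequentially"
    by (rule uniform_limit_add)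
  also have "(\<lambda>N z. u N z + (\<Sum>n<N. v n z)) = (\<lambda>N z. \<Sum>n<N. c n * ?b z n)"
    unfolding u_def v_def by (intro ext summation_by_parts[symmetric])
  finally have ul: "uniform_limit S (\<lambda>N z. \<Sum>n<N. c n * ?b z n) (\<lambda>z. 0 + (\<Sum>n. v n z)) sequentially" .
  have "0 + (\<Sum>n. v n z) = f z" if "z \<in> S" for z
    using tendsto_uniform_limitI[OF ul that] f[OF that] unfolding sums_def by (rule LIMSEQ_unique)
  then show ?thesis using ul by (subst (asm) uniform_limit_cong'[where i = f]) auto
qed simp

lemma dirichlet_series_holomorphic:
  assumes "has_dirichlet_series_on a f (half_plane \<theta>)"
  shows "f holomorphic_on half_plane \<theta>"
proof (rule holomorphic_uniform_sequence[where f = "\<lambda>N s. \<Sum>n<N. a (Suc n) * of_nat (Suc n) powr - s"])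
  show op: "open (half_plane \<theta>)" by (simp add: half_plane_def open_halfspace_Re_gt)
  show "(\<lambda>s. \<Sum>n<N. a (Suc n) * of_nat (Suc n) powr - s) holomorphic_on half_plane \<theta>" for N
    by (intro holomorphic_intros)
  fix x assume x: "x \<in> half_plane \<theta>"
  \<comment> \<open>A third of the distance to the boundary line: the series is summed at
    \<open>s0\<close> on \<open>\<theta> + d\<close>, while the ball of radius d around x lies
    beyond \<open>\<theta> + 2 * d\<close>. Hence every \<open>s - s0\<close> has real part at least
    d.\<close>
  define d where "d = (Re x - \<theta>) / 3"
  have d: "d > 0" using x by (simp add: d_def half_plane_def)
  define s0 where "s0 = complex_of_real (\<theta> + d)"
  have re: "Re s \<ge> \<theta> + 2 * d" if "s \<in> cball x d" for s
  proof -
    have "Re x = \<theta> + 3 * d" by (simp add: d_def field_simps)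
    then show ?thesis using that abs_Re_le_cmod[of "x - s"] by (simp add: dist_norm)
  qed
  show "\<exists>d>0. cball x d \<subseteq> half_plane \<theta> \<and> uniform_limit (cball x d) (\<lambda>N s. \<Sum>n<N. a (Suc n) * of_nat (Suc n) powr - s) f sequentially"
  proof (intro exI[of _ d] conjI)
    show "cball x d \<subseteq> half_plane \<theta>" using re d by (force simp: half_plane_def)
    define c where "c n = a (Suc n) * of_nat (Suc n) powr - s0" for n
    have cs: "c n * of_nat (Suc n) powr - (s - s0) = a (Suc n) * of_nat (Suc n) powr - s" for n s
      unfolding c_def by (simp add: mult.assoc powr_add[symmetric] del: of_nat_Suc)
    have "uniform_limit ((\<lambda>s. s - s0) ` cball x d) (\<lambda>N z. \<Sum>n<N. c n * of_nat (Suc n) powr - z) (\<lambda>z. f (z + s0)) sequentially"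
    proof (rule dirichlet_uniform_limit)
      have "s0 \<in> half_plane \<theta>" using d by (simp add: half_plane_def s0_def)
      then have "(\<lambda>n. c n) sums f s0" using assms unfolding c_def has_dirichlet_series_on_def by blast
      then show "summable c" by (rule sums_summable)
      show "Re z \<ge> d" if "z \<in> (\<lambda>s. s - s0) ` cball x d" for z
        using that re by (force simp: s0_def)
      show "norm z \<le> norm x + d + norm s0" if z: "z \<in> (\<lambda>s. s - s0) ` cball x d" for z
      proof -
        obtain s where s: "z = s - s0" "dist x s \<le> d" using z by auto
        have "norm s \<le> norm x + dist x s" using norm_triangle_ineq2[of s x] by (simp add: dist_norm norm_minus_commute)
        then show ?thesis unfolding s(1) using s(2) norm_triangle_ineq4[of s s0] by linarith
      qed
      show "(\<lambda>n. c n * of_nat (Suc n) powr - z) sums f (z + s0)" if z: "z \<in> (\<lambda>s. s - s0) ` cball x d" for z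
      proof -
        obtain s where s: "z = s - s0" "s \<in> cball x d" using z by auto
        have "s \<in> half_plane \<theta>" using re[OF s(2)] d by (simp add: half_plane_def)
        then have "(\<lambda>n. a (Suc n) * of_nat (Suc n) powr - s) sums f s"
          using assms by (simp add: has_dirichlet_series_on_def)
        then show ?thesis unfolding s(1) cs by simp
      qed
    qed (rule d)
    from uniform_limit_compose'[OF this, of "\<lambda>s. s - s0" "cball x d"]
    have "uniform_limit (cball x d) (\<lambda>N s. \<Sum>n<N. c n * of_nat (Suc n) powr - (s - s0)) (\<lambda>s. f (s - s0 + s0)) sequentially"
      by blast
    then show "uniform_limit (cball x d) (\<lambda>N s. \<Sum>n<N. a (Suc n) * of_nat (Suc n) powr - s) f sequentially"
      unfolding cs by simp
  qed (rule d)
qed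

lemma convex_half_plane: "convex (half_plane \<theta>)"
  by (simp add: half_plane_def convex_halfspace_Re_gt)

lemma dirichlet_algebra_bounded:
  assumes "f \<in> dirichlet_algebra"
  obtains B where "\<And>s. s \<in> half_plane 0 \<Longrightarrow> norm (f s) \<le> B"
proof -
  obtain a where a: "has_dirichlet_series_on a f (half_plane 0)" and uc: "uniformly_continuous_on (half_plane 0) f"
    using assms by (auto simp: dirichlet_algebra_def)
  have "gds nat_freq 2 (\<Sum>\<^sub>\<infinity>l\<in>nat_freq. norm (a (nat \<lfloor>l\<rfloor>)) * l powr - 2) f"
    unfolding gds_def using has_dirichlet_series_on_gds_coeff[OF a, of 2] by auto
  then obtain K where K: "\<And>s. Re s \<ge> 2 \<Longrightarrow> norm (f s) \<le> K"
    using gds_norm_le[OF _ nat_freq_ge_1] by blast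
  obtain \<delta> where \<delta>: "\<delta> > 0" "\<And>s s'. s \<in> half_plane 0 \<Longrightarrow> s' \<in> half_plane 0 \<Longrightarrow> dist s' s < \<delta> \<Longrightarrow> dist (f s') (f s) < 1"
    using uc unfolding uniformly_continuous_on_def by (metis zero_less_one)
  \<comment> \<open>\<open>N\<close> steps to the right, each of length
    \<open>2 / N < \<delta>\<close>, lead from any point of the half-plane to
    \<open>Re s \<ge> 2\<close>; each changes \<open>norm (f s)\<close> by at most 1.\<close>
  define N where "N = nat \<lceil>2 / \<delta>\<rceil> + 1"
  have N: "N > 0" "2 / real N < \<delta>"
  proof -
    show "N > 0" by (simp add: N_def)
    have "2 / \<delta> < real N" unfolding N_def by linarith
    then show "2 / real N < \<delta>" using \<delta> \<open>N > 0\<close> by (simp add: field_simps)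
  qed
  have step: "norm (f s) \<le> norm (f (s + of_real (real k * (2 / real N)))) + real k" if "Re s > 0" for s k
  proof (induction k)
    case (Suc k)
    let ?w = "\<lambda>k. s + of_real (real k * (2 / real N))"
    have "dist (?w k) (?w (Suc k)) = norm (complex_of_real (2 / real N))"
      unfolding dist_norm by (subst norm_minus_commute) (simp add: algebra_simps add_divide_distrib)
    then have "dist (?w k) (?w (Suc k)) < \<delta>" using N by (simp del: of_real_divide)
    then have "dist (f (?w k)) (f (?w (Suc k))) < 1"
      using that by (intro \<delta>) (auto simp: half_plane_def add_pos_nonneg)
    then have "norm (f (?w k)) \<le> norm (f (?w (Suc k))) + 1"
      using norm_triangle_ineq2[of "f (?w k)" "f (?w (Suc k))"] by (simp add: dist_norm)
    then show ?case using Suc by simp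
  qed simp
  have "norm (f s) \<le> K + real N" if "s \<in> half_plane 0" for s
  proof -
    have "norm (f s) \<le> norm (f (s + of_real (real N * (2 / real N)))) + real N"
      using that by (intro step) (simp add: half_plane_def)
    also have "norm (f (s + of_real (real N * (2 / real N)))) \<le> K"
      using that N by (intro K) (simp add: half_plane_def)
    finally show ?thesis by simp
  qed
  then show ?thesis by (rule that)
qed

lemma dirichlet_uniform_limit_infinity:
  assumes "has_dirichlet_series_on a f (half_plane 0)" "\<epsilon> > 0"
  obtains M where "M > 0" "\<And>s. Re s \<ge> M \<Longrightarrow> norm (f s - a 1) \<le> \<epsilon>"
proof -
  have "gds_coeff nat_freq 2 (\<lambda>l. a (nat \<lfloor>l\<rfloor>)) f"
    using assms by (intro has_dirichlet_series_on_gds_coeff) auto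
  then obtain \<sigma> where "\<sigma> \<ge> 2" "gds nat_freq \<sigma> \<epsilon> (\<lambda>s. f s - a (nat \<lfloor>1::real\<rfloor>))"
    using gds_coeff_minus_const[OF _ nat_freq_ge_1 discrete_freq_nat_freq _ \<open>\<epsilon> > 0\<close>] freq_monoid_nat_freq
    by (metis freq_monoid_def)
  then show ?thesis using gds_norm_le[OF _ nat_freq_ge_1] by (intro that[of \<sigma>]) auto
qed

text \<open>These are the test functions fed to the operator to recover its symbol. The derivative
  has modulus at most \<open>ln n\<close> on the half-plane, which gives a Lipschitz
  constant.\<close>

lemma power_in_dirichlet_algebra:
  assumes "n \<ge> 1"
  shows "(\<lambda>s. of_nat n powr - s) \<in> dirichlet_algebra"
proof -
  obtain m where m: "n = Suc m" using assms by (cases n) auto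
  have "(\<lambda>k. (if Suc k = n then 1 else 0) * of_nat (Suc k) powr - s) sums (of_nat n powr - s)" for s :: complex
  proof -
    have "(\<lambda>k. if k = m then of_nat (Suc k) powr - s else 0) sums (of_nat (Suc m) powr - s)"
      by (rule sums_single)
    moreover have "(\<lambda>k. if k = m then of_nat (Suc k) powr - s else 0) = (\<lambda>k. (if Suc k = n then 1 else 0) * of_nat (Suc k) powr - s)"
      using m by auto
    ultimately show ?thesis using m by simp
  qed
  then have "has_dirichlet_series_on (\<lambda>k. if k = n then 1 else 0) (\<lambda>s. of_nat n powr - s) (half_plane 0)"
    unfolding has_dirichlet_series_on_def by simp
  moreover have "uniformly_continuous_on (half_plane 0) (\<lambda>s. complex_of_nat n powr - s)"
  proof (rule lipschitz_on_uniformly_continuous[OF lipschitz_onI])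
    fix s t assume "s \<in> half_plane 0" "t \<in> half_plane 0"
    have "norm (of_nat n powr - s - complex_of_nat n powr - t) \<le> ln (real n) * norm (s - t)"
    proof (rule field_differentiable_bound[where S = "half_plane 0" and f' = "\<lambda>s. - (Ln (of_nat n) * of_nat n powr - s)"])
      fix z assume z: "z \<in> half_plane 0"
      have "((\<lambda>s. - s) has_field_derivative - 1) (at z within half_plane 0)"
        by (auto intro!: derivative_eq_intros)
      from DERIV_chain2[OF has_field_derivative_powr_right this, of "of_nat n"]
      show "((\<lambda>s. of_nat n powr - s) has_field_derivative - (Ln (of_nat n) * of_nat n powr - z)) (at z within half_plane 0)"
        using assms by simp
      have "norm (complex_of_nat n powr - z) \<le> 1"
        using z assms norm_of_real_powr[of "real n" "- z"] powr_mono[of "- Re z" 0 "real n"]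
        by (simp add: half_plane_def)
      moreover have "norm (Ln (complex_of_nat n)) = ln (real n)" using assms by (simp add: Ln_of_nat)
      ultimately show "norm (- (Ln (of_nat n) * complex_of_nat n powr - z)) \<le> ln (real n)"
        using assms by (simp add: norm_mult mult_left_le)
    qed (use \<open>s \<in> half_plane 0\<close> \<open>t \<in> half_plane 0\<close> convex_half_plane in auto)
    then show "dist (of_nat n powr - s) (complex_of_nat n powr - t) \<le> ln (real n) * dist s t"
      by (simp add: dist_norm)
  qed (use assms in simp)
  ultimately show ?thesis by (auto simp: dirichlet_algebra_def)
qed

section \<open>Symbols of composition operators\<close>

text \<open>Contains the multiplicative monoid generated by the ratios \<open>k / u\<close> with \<open>k > u\<close>: a product of \<open>j\<close> of them
  is at least \<open>(1 + 1/u)\<^sup>j\<close>, which makes the set discrete.\<close>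

definition ratio_freq :: "nat \<Rightarrow> real set" where
  "ratio_freq u = {r. r \<ge> 1 \<and> (\<exists>j. r * real u ^ j \<in> \<nat> \<and> r \<ge> (1 + 1 / real u) ^ j)}"

lemma ratio_freq_ge_1: "ratio_freq u \<subseteq> {1..}"
  by (auto simp: ratio_freq_def)

lemma freq_monoid_ratio_freq: "freq_monoid (ratio_freq u)"
  unfolding freq_monoid_def
proof (intro conjI ballI)
  show "1 \<in> ratio_freq u" by (auto simp: ratio_freq_def intro!: exI[of _ 0])
  fix x y assume "x \<in> ratio_freq u" "y \<in> ratio_freq u"
  then obtain j k where x: "x \<ge> 1" "x * real u ^ j \<in> \<nat>" "x \<ge> (1 + 1 / real u) ^ j"
    and y: "y \<ge> 1" "y * real u ^ k \<in> \<nat>" "y \<ge> (1 + 1 / real u) ^ k"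
    by (auto simp: ratio_freq_def)
  have "(x * real u ^ j) * (y * real u ^ k) \<in> \<nat>" using x(2) y(2) by (rule Nats_mult)
  then have "x * y * real u ^ (j + k) \<in> \<nat>" by (simp add: power_add mult_ac)
  moreover have "x * y \<ge> (1 + 1 / real u) ^ (j + k)"
    unfolding power_add using x y by (intro mult_mono) auto
  moreover have "x * y \<ge> 1" using mult_mono[of 1 x 1 y] x y by simp
  ultimately show "x * y \<in> ratio_freq u" unfolding ratio_freq_def by blast
qed (rule ratio_freq_ge_1)

text \<open>A bound X on r bounds the number j of factors by some \<open>J\<close>, so
  \<open>u ^ J\<close> is a common denominator and only finitely many numerators remain.\<close>

lemma discrete_freq_ratio_freq:
  assumes "u \<ge> 1"
  shows "discrete_freq (ratio_freq u)"
  unfolding discrete_freq_def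
proof
  fix X :: real
  have "1 + 1 / real u > 1" using assms by simp
  from real_arch_pow[OF this, of X] obtain J where J: "X < (1 + 1 / real u) ^ J" by blast
  have "r \<in> (\<lambda>k. real k / real u ^ J) ` {..nat \<lceil>X * real u ^ J\<rceil>}" if r: "r \<in> ratio_freq u" "r \<le> X" for r
  proof -
    from r obtain j where j: "r * real u ^ j \<in> \<nat>" "r \<ge> (1 + 1 / real u) ^ j" by (auto simp: ratio_freq_def)
    have "(1 + 1 / real u) ^ j < (1 + 1 / real u) ^ J" using j(2) r(2) J by linarith
    then have "j < J" using assms by (subst (asm) power_strict_increasing_iff) auto
    have "r * real u ^ j * real (u ^ (J - j)) \<in> \<nat>"
      by (rule Nats_mult[OF j(1) of_nat_in_Nats])
    also have "r * real u ^ j * real (u ^ (J - j)) = r * real u ^ J"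
      using \<open>j < J\<close> by (simp add: mult.assoc power_add[symmetric])
    finally obtain k where k: "r * real u ^ J = real k" by (auto elim: Nats_cases)
    have "real k \<le> X * real u ^ J" unfolding k[symmetric] using r by (intro mult_right_mono) auto
    then have "k \<le> nat \<lceil>X * real u ^ J\<rceil>" by linarith
    moreover have "r = real k / real u ^ J" using k assms by (simp add: field_simps)
    ultimately show ?thesis by auto
  qed
  then have "ratio_freq u \<inter> {..X} \<subseteq> (\<lambda>k. real k / real u ^ J) ` {..nat \<lceil>X * real u ^ J\<rceil>}" by auto
  then show "finite (ratio_freq u \<inter> {..X})" by (rule finite_subset) simp
qed

lemma divide_in_ratio_freq:
  assumes "l \<in> nat_freq" "real u < l" "u \<ge> 1"
  shows "l / real u \<in> ratio_freq u"
proof -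
  obtain n where n: "l = real n" using assms by (auto simp: nat_freq_iff)
  then have "real u + 1 \<le> l" using assms by simp
  then have "(real u + 1) / real u \<le> l / real u" by (rule divide_right_mono) simp
  then have "1 + 1 / real u \<le> l / real u" using assms by (simp add: add_divide_distrib)
  moreover have "l / real u * real u ^ 1 \<in> \<nat>" using n assms by simp
  moreover have "1 \<le> l / real u" using assms by simp
  ultimately show ?thesis unfolding ratio_freq_def by (auto intro!: exI[of _ 1])
qed

text \<open>Allows two expansions over different ratio sets to be compared inside one common
  discrete set.\<close>

lemma ratio_freq_mult_mono:
  assumes "u \<ge> 1" "v \<ge> 1"
  shows "ratio_freq u \<subseteq> ratio_freq (u * v)"
proof
  fix r assume "r \<in> ratio_freq u"
  then obtain j where j: "r \<ge> 1" "r * real u ^ j \<in> \<nat>" "r \<ge> (1 + 1 / real u) ^ j"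
    by (auto simp: ratio_freq_def)
  have "r * real u ^ j * real (v ^ j) \<in> \<nat>" by (rule Nats_mult[OF j(2) of_nat_in_Nats])
  then have "r * real (u * v) ^ j \<in> \<nat>" by (simp add: power_mult_distrib mult_ac)
  moreover have "(1 + 1 / real (u * v)) ^ j \<le> (1 + 1 / real u) ^ j"
    using assms by (intro power_mono) (auto simp: field_simps)
  ultimately show "r \<in> ratio_freq (u * v)" using j unfolding ratio_freq_def by force
qed

text \<open>A number with a denominator dividing a power of u and another dividing a power of v is
  an integer: from \<open>p * v ^ k = q * u ^ j\<close> coprimality gives
  \<open>u ^ j dvd p\<close>.\<close>

lemma ratio_freq_inter_coprime:
  assumes "coprime u v" "u \<ge> 1" "v \<ge> 1"
  shows "ratio_freq u \<inter> ratio_freq v \<subseteq> nat_freq"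
proof
  fix r assume r: "r \<in> ratio_freq u \<inter> ratio_freq v"
  obtain j p where p: "r * real u ^ j = real p" using r by (auto simp: ratio_freq_def elim: Nats_cases)
  obtain k q where q: "r * real v ^ k = real q" using r by (auto simp: ratio_freq_def elim: Nats_cases)
  have "real (p * v ^ k) = real (q * u ^ j)" unfolding of_nat_mult p[symmetric] q[symmetric] by simp
  then have "p * v ^ k = q * u ^ j" by (simp only: of_nat_eq_iff)
  then have "u ^ j dvd p * v ^ k" by simp
  then have "u ^ j dvd p" using assms(1) by (simp add: coprime_dvd_mult_left_iff)
  then obtain m where m: "p = u ^ j * m" by (auto elim: dvdE)
  then have "r = real m" using p assms(2) by simp
  moreover have "r \<ge> 1" using r by (auto simp: ratio_freq_def)
  ultimately show "r \<in> nat_freq" unfolding nat_freq_iff by (intro exI[of _ m]) auto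
qed

section \<open>Uniqueness of expansions, and logarithms of Dirichlet series\<close>

lemma gds_coeff_extend:
  assumes "gds_coeff M1 \<sigma> a f" "M1 \<subseteq> M"
  shows "gds_coeff M \<sigma> (\<lambda>l. if l \<in> M1 then a l else 0) f"
proof -
  have "(\<lambda>l. norm (if l \<in> M1 then a l else 0) * l powr - \<sigma>) summable_on M \<longleftrightarrow> (\<lambda>l. norm (a l) * l powr - \<sigma>) summable_on M1"
    using assms(2) by (intro summable_on_cong_neutral) auto
  moreover have "((\<lambda>l. (if l \<in> M1 then a l else 0) * of_real l powr - s) has_sum f s) M \<longleftrightarrow>
      ((\<lambda>l. a l * of_real l powr - s) has_sum f s) M1" for s
    using assms(2) by (intro has_sum_cong_neutral) auto
  ultimately show ?thesis using assms(1) by (simp add: gds_coeff_def)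
qed

lemma gds_coeff_diff:
  assumes "gds_coeff M \<sigma> a f" "gds_coeff M \<sigma> b g"
  shows "gds_coeff M \<sigma> (\<lambda>l. a l - b l) (\<lambda>s. f s - g s)"
proof -
  have s: "(\<lambda>l. norm (a l) * l powr - \<sigma> + norm (b l) * l powr - \<sigma>) summable_on M"
    using assms by (intro summable_on_add) (auto simp: gds_coeff_def)
  have "norm (a l - b l) * l powr - \<sigma> \<le> norm (a l) * l powr - \<sigma> + norm (b l) * l powr - \<sigma>" for l
    unfolding distrib_right[symmetric] by (intro mult_right_mono norm_triangle_ineq4) auto
  then have "(\<lambda>l. norm (a l - b l) * l powr - \<sigma>) summable_on M"
    using Infinite_Sum.abs_summable_on_comparison_test'[OF s, of "\<lambda>l. norm (a l - b l) * l powr - \<sigma>"] by simp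
  moreover have "((\<lambda>l. (a l - b l) * of_real l powr - s) has_sum (f s - g s)) M" if "Re s \<ge> \<sigma>" for s
  proof -
    have "((\<lambda>l. a l * of_real l powr - s + - (b l * of_real l powr - s)) has_sum (f s + - g s)) M"
      using assms that by (intro has_sum_add has_sum_uminus[THEN iffD2]) (auto simp: gds_coeff_def)
    then show ?thesis by (simp add: left_diff_distrib)
  qed
  ultimately show ?thesis by (simp add: gds_coeff_def)
qed

text \<open>Extended by zero to \<open>M\<close>, the two expansions have a difference that
  represents 0. Uniqueness makes them agree, so each coefficient supported outside the other set
  vanishes.\<close>

lemma gds_inter:
  assumes f1: "gds M1 \<sigma> K1 f" and f2: "gds M2 \<sigma> K2 f"
    and M: "M1 \<subseteq> M" "M2 \<subseteq> M" "M \<subseteq> {1..}" "discrete_freq M" and \<Lambda>: "M1 \<inter> M2 \<subseteq> \<Lambda>"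
  shows "\<exists>K. gds \<Lambda> \<sigma> K f"
proof -
  obtain a b where a: "gds_coeff M1 \<sigma> a f" and b: "gds_coeff M2 \<sigma> b f"
    using f1 f2 by (auto simp: gds_def)
  let ?a = "\<lambda>l. if l \<in> M1 then a l else 0" and ?b = "\<lambda>l. if l \<in> M2 then b l else 0"
  have "gds_coeff M \<sigma> (\<lambda>l. ?a l - ?b l) (\<lambda>s. f s - f s)"
    by (intro gds_coeff_diff gds_coeff_extend a b M)
  then have "?a l - ?b l = 0" if "l \<in> M" for l
    using that M(3,4) gds_coeff_zero[where a = "\<lambda>l. ?a l - ?b l"] by simp
  then have z: "a l = 0" if "l \<in> M1 - M2" for l using that M(1) by force
  have "gds_coeff (M1 \<inter> M2) \<sigma> a f"
  proof -
    have "(\<lambda>l. norm (a l) * l powr - \<sigma>) summable_on (M1 \<inter> M2) \<longleftrightarrow> (\<lambda>l. norm (a l) * l powr - \<sigma>) summable_on M1"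
      using z by (intro summable_on_cong_neutral) auto
    moreover have "((\<lambda>l. a l * of_real l powr - s) has_sum f s) (M1 \<inter> M2) \<longleftrightarrow>
        ((\<lambda>l. a l * of_real l powr - s) has_sum f s) M1" for s
      using z by (intro has_sum_cong_neutral) auto
    ultimately show ?thesis using a by (simp add: gds_coeff_def)
  qed
  from gds_coeff_extend[OF this \<Lambda>] show ?thesis unfolding gds_def by blast
qed

text \<open>The values lie in the multiples of \<open>2 * pi * \<i>\<close>, and distinct ones are
  more than 1 apart. This compares logarithms without fixing a branch for the function whose
  logarithm is sought.\<close>

lemma exp_eq_one_constant_on:
  fixes D :: "'a :: topological_space \<Rightarrow> complex"
  assumes "connected S" "continuous_on S D" "\<And>x. x \<in> S \<Longrightarrow> exp (D x) = 1"
  shows "D constant_on S"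
proof (rule continuous_discrete_range_constant[OF assms(1,2)])
  fix x assume x: "x \<in> S"
  have "1 \<le> norm (D y - D x)" if y: "y \<in> S" "D y \<noteq> D x" for y
  proof -
    obtain n :: int where n: "D y = D x + (of_int (2 * n) * pi) * \<i>"
      using assms(3)[OF x] assms(3)[OF y(1)] exp_eq[of "D y" "D x"] by auto
    then have "n \<noteq> 0" using y by auto
    have "norm (D y - D x) = 2 * real_of_int \<bar>n\<bar> * pi" unfolding n by (simp add: norm_mult)
    also have "\<dots> \<ge> 2 * 1 * 1" using \<open>n \<noteq> 0\<close> pi_gt3 by (intro mult_mono) auto
    finally show ?thesis by simp
  qed
  then show "\<exists>e>0. \<forall>y. y \<in> S \<and> D y \<noteq> D x \<longrightarrow> e \<le> norm (D y - D x)" by (intro exI[of _ 1]) auto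
qed

lemma gds_Ln_one_plus:
  assumes "gds M \<sigma> (1 / 2) \<rho>" "freq_monoid M"
  shows "\<exists>K. gds M \<sigma> K (\<lambda>s. Ln (1 + \<rho> s))"
proof -
  \<comment> \<open>At k = 0 the division by zero returns 0, in agreement with the missing constant
    term of the logarithm series.\<close>
  let ?p = "\<lambda>k. (-1) ^ Suc k / of_nat k :: complex"
  have sm: "summable (\<lambda>k. norm (?p k) * (1 / 2) ^ k)"
  proof (rule summable_comparison_test'[of "\<lambda>k. (1 / 2 :: real) ^ k" 0])
    show "norm (norm (?p k) * (1 / 2) ^ k) \<le> (1 / 2 :: real) ^ k" for k
      by (cases k) (auto simp: norm_divide norm_power divide_simps simp del: of_nat_Suc)
  qed (simp add: summable_geometric)
  have sr: "(\<lambda>k. ?p k * \<rho> s ^ k) sums Ln (1 + \<rho> s)" if "Re s \<ge> \<sigma>" for s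
  proof (rule Ln_series)
    show "norm (\<rho> s) < 1" using gds_norm_le[OF assms(1) _ that] assms(2) by (force simp: freq_monoid_def)
  qed
  show ?thesis by (rule exI, rule gds_power_series[OF assms sm sr])
qed

lemma log_series:
  assumes cont: "continuous_on (half_plane 0) \<Phi>" and "n \<ge> 2"
    and a: "has_dirichlet_series_on b (\<lambda>s. of_nat n powr - \<Phi> s) (half_plane 0)"
  obtains N \<sigma> K \<phi> where "N \<ge> 1" "gds (ratio_freq N) \<sigma> K \<phi>"
    "\<And>s. Re s \<ge> \<sigma> \<Longrightarrow> \<Phi> s = of_real (ln (real N) / ln (real n)) * s + \<phi> s"
proof -
  define F where "F s = of_nat n powr - \<Phi> s" for s
  have F: "F s = exp (- (of_real (ln (real n)) * \<Phi> s))" for s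
    using \<open>n \<ge> 2\<close> by (simp add: F_def powr_def Ln_of_nat mult.commute)
  define a where "a l = b (nat \<lfloor>l\<rfloor>)" for l :: real
  have a: "gds_coeff nat_freq 2 a F"
    using has_dirichlet_series_on_gds_coeff[OF a, of 2] unfolding a_def F_def by simp
  \<comment> \<open>A leading term exists because \<open>F\<close> is an exponential and so cannot
    be the zero series.\<close>
  have "\<exists>l\<in>nat_freq. a l \<noteq> 0"
  proof (rule ccontr)
    assume "\<not> ?thesis"
    then have "((\<lambda>l. a l * of_real l powr - 2) has_sum 0) nat_freq" by (intro has_sum_0) auto
    moreover have "((\<lambda>l. a l * of_real l powr - 2) has_sum F 2) nat_freq" using a by (simp add: gds_coeff_def)
    ultimately have "F 2 = 0" by (metis has_sum_unique)
    then show False by (simp add: F)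
  qed
  then obtain \<mu> where \<mu>: "\<mu> \<in> nat_freq" "a \<mu> \<noteq> 0" "\<And>k. k \<in> nat_freq \<Longrightarrow> k < \<mu> \<Longrightarrow> a k = 0"
    using first_coeff_exists[OF discrete_freq_nat_freq] by metis
  then obtain N where N: "N \<ge> 1" "\<mu> = real N" by (auto simp: nat_freq_iff)
  let ?M = "ratio_freq N"
  obtain \<sigma> where \<sigma>: "\<sigma> \<ge> 2" and \<rho>0: "gds ?M \<sigma> (1 / 2) (\<lambda>s. F s * of_real \<mu> powr s / a \<mu> - 1)"
    using gds_coeff_quotient[OF a nat_freq_ge_1 discrete_freq_nat_freq \<mu> ratio_freq_ge_1, of N "1 / 2"]
      divide_in_ratio_freq N by auto
  define \<rho> where "\<rho> s = F s * of_real \<mu> powr s / a \<mu> - 1" for s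
  have \<rho>: "gds ?M \<sigma> (1 / 2) \<rho>" using \<rho>0 unfolding \<rho>_def .
  obtain K where K: "gds ?M \<sigma> K (\<lambda>s. Ln (1 + \<rho> s))" using gds_Ln_one_plus[OF \<rho> freq_monoid_ratio_freq] by blast
  have \<rho>_le: "norm (\<rho> s) \<le> 1 / 2" if "Re s \<ge> \<sigma>" for s
    using gds_norm_le[OF \<rho> ratio_freq_ge_1 that] .
  have \<rho>_nz: "1 + \<rho> s \<notin> \<real>\<^sub>\<le>\<^sub>0" "1 + \<rho> s \<noteq> 0" if "Re s \<ge> \<sigma>" for s
  proof -
    have "Re (1 + \<rho> s) > 0" using \<rho>_le[OF that] abs_Re_le_cmod[of "\<rho> s"] by simp
    then show "1 + \<rho> s \<notin> \<real>\<^sub>\<le>\<^sub>0" by (simp add: complex_nonpos_Reals_iff)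
    then show "1 + \<rho> s \<noteq> 0" by auto
  qed
  \<comment> \<open>The defect between the known logarithm \<open>- ln n * \<Phi>\<close> of
    \<open>F\<close> and the one assembled from the leading term and
    \<open>Ln (1 + \<rho> s)\<close>. Its exponential is 1, so on the half-plane it is a constant,
    which is then absorbed into \<phi>.\<close>
  define D where "D s = - (of_real (ln (real n)) * \<Phi> s) - Ln (a \<mu>) + of_real (ln (real N)) * s - Ln (1 + \<rho> s)" for s
  have sub: "{s. Re s \<ge> \<sigma>} \<subseteq> half_plane 0" using \<sigma> by (auto simp: half_plane_def)
  note contP = continuous_on_subset[OF cont sub]
  have \<mu>p: "of_real \<mu> powr s = exp (of_real (ln (real N)) * s)" for s :: complex
    using N by (simp add: powr_def Ln_of_nat mult.commute)
  have "continuous_on {s. Re s \<ge> \<sigma>} \<rho>"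
    unfolding \<rho>_def F \<mu>p by (intro continuous_intros contP) (use \<mu> in auto)
  then have "continuous_on {s. Re s \<ge> \<sigma>} D"
    unfolding D_def using \<rho>_nz by (intro continuous_intros contP) auto
  moreover have "exp (D s) = 1" if "s \<in> {s. Re s \<ge> \<sigma>}" for s
  proof -
    have "exp (D s) = F s * of_real \<mu> powr s / a \<mu> / (1 + \<rho> s)"
      using \<mu>(2) \<rho>_nz[of s] that by (simp add: D_def exp_diff exp_add F \<mu>p)
    also have "F s * of_real \<mu> powr s / a \<mu> = 1 + \<rho> s" by (simp add: \<rho>_def)
    finally show ?thesis using \<rho>_nz[of s] that by simp
  qed
  moreover have "connected {s. Re s \<ge> \<sigma>}" by (rule convex_connected) (rule convex_halfspace_Re_ge)
  ultimately obtain d where d: "\<And>s. Re s \<ge> \<sigma> \<Longrightarrow> D s = d"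
    using exp_eq_one_constant_on[of "{s. Re s \<ge> \<sigma>}" D] by (auto simp: constant_on_def)
  define L where "L = complex_of_real (ln (real n))"
  have L: "L \<noteq> 0" using \<open>n \<ge> 2\<close> by (simp add: L_def)
  define \<phi> where "\<phi> s = - (Ln (a \<mu>) + d) / L + (- 1 / L) * Ln (1 + \<rho> s)" for s
  have "gds ?M \<sigma> (norm (- (Ln (a \<mu>) + d) / L) + norm (- 1 / L) * K) \<phi>"
    unfolding \<phi>_def using freq_monoid_ratio_freq[of N]
    by (intro gds_add gds_cmult K gds_const ratio_freq_ge_1) (auto simp: freq_monoid_def)
  moreover have "\<Phi> s = of_real (ln (real N) / ln (real n)) * s + \<phi> s" if "Re s \<ge> \<sigma>" for s
  proof -
    have "L * \<Phi> s = of_real (ln (real N)) * s - (Ln (a \<mu>) + d) - Ln (1 + \<rho> s)"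
      using d[OF that] by (simp add: D_def L_def algebra_simps)
    then have "\<Phi> s = (of_real (ln (real N)) * s - (Ln (a \<mu>) + d) - Ln (1 + \<rho> s)) / L"
      using L by (simp add: field_simps)
    then show ?thesis by (simp add: \<phi>_def diff_divide_distrib L_def add_divide_distrib)
  qed
  ultimately show ?thesis using N that by blast
qed

lemma affine_bounded_diff_unique:
  fixes c c' K :: real
  assumes "\<And>x::real. x \<ge> \<sigma> \<Longrightarrow> norm (of_real c * of_real x - of_real c' * complex_of_real x) \<le> K"
  shows "c = c'"
proof (rule ccontr)
  assume "c \<noteq> c'"
  define x where "x = max \<sigma> ((\<bar>K\<bar> + 1) / \<bar>c - c'\<bar>)"
  have "norm (of_real c * of_real x - of_real c' * complex_of_real x) = \<bar>c - c'\<bar> * \<bar>x\<bar>"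
    by (simp only: left_diff_distrib[symmetric] of_real_diff[symmetric] norm_mult norm_of_real)
  moreover have "\<bar>c - c'\<bar> * \<bar>x\<bar> \<ge> \<bar>c - c'\<bar> * ((\<bar>K\<bar> + 1) / \<bar>c - c'\<bar>)"
    by (intro mult_left_mono) (auto simp: x_def)
  moreover have "\<bar>c - c'\<bar> * ((\<bar>K\<bar> + 1) / \<bar>c - c'\<bar>) = \<bar>K\<bar> + 1" using \<open>c \<noteq> c'\<close> by simp
  moreover have "norm (of_real c * of_real x - of_real c' * complex_of_real x) \<le> K"
    by (rule assms) (simp add: x_def)
  ultimately show False by linarith
qed

lemma G_infinity_of_powers:
  assumes hol: "\<Phi> holomorphic_on half_plane 0" and map: "\<Phi> \<in> half_plane 0 \<rightarrow> half_plane 0"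
    and ser: "\<And>n. n \<ge> 2 \<Longrightarrow> \<exists>b. has_dirichlet_series_on b (\<lambda>s. of_nat n powr - \<Phi> s) (half_plane 0)"
  shows "\<Phi> \<in> G_infinity"
proof -
  have "\<exists>N \<sigma> K \<phi>. N \<ge> 1 \<and> gds (ratio_freq N) \<sigma> K \<phi> \<and>
      (\<forall>s. Re s \<ge> \<sigma> \<longrightarrow> \<Phi> s = of_real (ln (real N) / ln (real n)) * s + \<phi> s)" if n: "n \<ge> 2" for n
  proof -
    obtain b where "has_dirichlet_series_on b (\<lambda>s. of_nat n powr - \<Phi> s) (half_plane 0)" using ser[OF n] by blast
    from log_series[OF holomorphic_on_imp_continuous_on[OF hol] n this] show ?thesis by metis
  qed
  then obtain N \<sigma> K \<phi> where N: "\<And>n. n \<ge> 2 \<Longrightarrow> N n \<ge> 1"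
    and \<phi>: "\<And>n. n \<ge> 2 \<Longrightarrow> gds (ratio_freq (N n)) (\<sigma> n) (K n) (\<phi> n)"
    and \<Phi>: "\<And>n s. n \<ge> 2 \<Longrightarrow> Re s \<ge> \<sigma> n \<Longrightarrow> \<Phi> s = of_real (ln (real (N n)) / ln (real n)) * s + \<phi> n s"
    by metis
  define c where "c = ln (real (N 2)) / ln 2"
  have c: "ln (real (N n)) / ln (real n) = c" if n: "n \<ge> 2" for n
  proof (rule affine_bounded_diff_unique)
    fix x assume x: "x \<ge> max (\<sigma> n) (\<sigma> 2)"
    have "of_real (ln (real (N n)) / ln (real n)) * of_real x - of_real c * complex_of_real x
       = \<phi> 2 (of_real x) - \<phi> n (of_real x)"
      using \<Phi>[OF n, of "of_real x"] \<Phi>[of 2 "of_real x"] x unfolding c_def by (simp add: algebra_simps)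
    also have "norm \<dots> \<le> K 2 + K n"
      using x n by (intro order_trans[OF norm_triangle_ineq4] add_mono gds_norm_le[OF \<phi> ratio_freq_ge_1]) auto
    finally show "norm (of_real (ln (real (N n)) / ln (real n)) * of_real x - of_real c * complex_of_real x) \<le> K 2 + K n" .
  qed
  have pw: "real n powr c = real (N n)" if n: "n \<ge> 2" for n
  proof -
    have "c * ln (real n) = ln (real (N n))" using c[OF n] n by (simp add: divide_eq_eq)
    then show ?thesis using N[OF n] n by (simp add: powr_def)
  qed
  have "c \<in> \<nat>"
  proof (rule Nats_of_powr_Ints)
    show "real n powr c \<in> \<int>" if "n \<ge> 1" for n
      using that pw[of n] by (cases "n = 1") auto
    show "c \<ge> 0" using N[of 2] by (simp add: c_def)
  qed
  then obtain m where m: "c = real m" by (auto elim: Nats_cases)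
  \<comment> \<open>The leading frequency is an exact power of n, so the expansions for n = 2 and n
    = 3 live over the coprime parameters \<open>2 ^ m\<close> and \<open>3 ^ m\<close>.\<close>
  have Nn: "N n = n ^ m" if n: "n \<ge> 2" for n
  proof -
    have "real (N n) = real (n ^ m)" using pw[OF n] n by (simp add: m powr_realpow)
    then show ?thesis by (simp only: of_nat_eq_iff)
  qed
  define \<psi> where "\<psi> s = \<Phi> s - of_nat m * s" for s
  define \<sigma>' where "\<sigma>' = max (\<sigma> 2) (\<sigma> 3)"
  have \<psi>: "gds (ratio_freq (n ^ m)) \<sigma>' (K n) \<psi>" if n: "n \<in> {2, 3}" for n
  proof -
    have "gds (ratio_freq (n ^ m)) \<sigma>' (K n) (\<phi> n)"
      by (rule gds_mono_abscissa[OF _ ratio_freq_ge_1, of _ "\<sigma> n"]) (use \<phi>[of n] Nn[of n] n in \<open>auto simp: \<sigma>'_def\<close>)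
    then show ?thesis
    proof (rule gds_cong)
      fix s assume "Re s \<ge> \<sigma>'"
      then show "\<phi> n s = \<psi> s" using \<Phi>[of n s] c[of n] n by (auto simp: \<psi>_def m \<sigma>'_def)
    qed
  qed
  have "\<exists>K. gds nat_freq \<sigma>' K \<psi>"
  \<comment> \<open>Both expansions represent the same function \<psi>; the set for the parameter
    \<open>2 ^ m * 3 ^ m\<close> contains both frequency sets and is still discrete, so uniqueness
    is available there.\<close>
  proof (rule gds_inter[OF \<psi>[of 2] \<psi>[of 3]])
    show "ratio_freq (2 ^ m) \<subseteq> ratio_freq (2 ^ m * 3 ^ m)" by (rule ratio_freq_mult_mono) auto
    show "ratio_freq (3 ^ m) \<subseteq> ratio_freq (2 ^ m * 3 ^ m)"
      using ratio_freq_mult_mono[of "3 ^ m" "2 ^ m"] by (simp add: mult.commute)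
    show "ratio_freq (2 ^ m) \<inter> ratio_freq (3 ^ m) \<subseteq> nat_freq"
      by (rule ratio_freq_inter_coprime) (auto simp: coprime_commute)
  qed (use ratio_freq_ge_1 in \<open>auto intro: discrete_freq_ratio_freq\<close>)
  then obtain a where "\<And>s. Re s \<ge> \<sigma>' \<Longrightarrow> (\<lambda>n. a (Suc n) * of_nat (Suc n) powr - s) sums \<psi> s"
    using gds_imp_dirichlet by metis
  then have "has_dirichlet_series_on a \<psi> (half_plane \<sigma>')"
    by (auto simp: has_dirichlet_series_on_def half_plane_def)
  moreover have "\<psi> holomorphic_on half_plane 0" unfolding \<psi>_def by (intro holomorphic_intros hol)
  ultimately have "\<psi> \<in> dirichlet_class" by (auto simp: dirichlet_class_def)
  moreover have "\<forall>s\<in>half_plane 0. \<Phi> s = of_nat m * s + \<psi> s" by (simp add: \<psi>_def)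
  ultimately show ?thesis using hol map by (auto simp: G_infinity_def)
qed

text \<open>Closeness of \<open>2 powr - \<Phi>\<close> at two points determines \<Phi> only up to
  multiples of \<open>2 * pi * \<i> / ln 2\<close>. The ambiguity is removed by following \<Phi>
  along the segment between them. The segment may leave the set where \<open>Re \<Phi> < M\<close>,
  but this does no harm: the power is uniformly continuous on the whole half-plane, and its lower
  bound \<open>2 powr - M\<close> is used only at the endpoint s.\<close>

lemma uniformly_continuous_on_of_power:
  assumes cont: "continuous_on (half_plane 0) \<Phi>"
    and uc: "uniformly_continuous_on (half_plane 0) (\<lambda>s. 2 powr - \<Phi> s)"
  shows "uniformly_continuous_on {s \<in> half_plane 0. 0 < Re (\<Phi> s) \<and> Re (\<Phi> s) < M} \<Phi>"
    (is "uniformly_continuous_on ?A _")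
  unfolding uniformly_continuous_on_def
proof (intro allI impI)
  fix e :: real assume e: "e > 0"
  have "isCont Ln 1" by (intro continuous_intros) auto
  then have "\<exists>\<eta>>0. \<forall>u. dist u 1 < \<eta> \<longrightarrow> dist (Ln u) (Ln 1) < ln 2 * e"
    using e unfolding continuous_at_eps_delta by simp
  then obtain \<eta>0 where \<eta>0: "\<eta>0 > 0" "\<And>u. norm (u - 1) < \<eta>0 \<Longrightarrow> norm (Ln u) < ln 2 * e"
    by (auto simp: dist_norm)
  \<comment> \<open>The cap 1 keeps \<open>exp (h z)\<close> in the right half-plane along the
    segment, away from the branch cut of \<open>Ln\<close>; \<open>\<eta>0\<close> then controls the
    size of the logarithm.\<close>
  define \<eta> where "\<eta> = min \<eta>0 1"
  have \<eta>: "\<eta> > 0" using \<eta>0 by (simp add: \<eta>_def)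
  have p2: "(2 :: complex) powr - z = exp (- (of_real (ln 2) * z))" for z
    by (simp add: powr_def mult.commute Ln_of_real[of 2, simplified])
  obtain \<delta> where \<delta>: "\<delta> > 0"
    "\<And>s s'. s \<in> half_plane 0 \<Longrightarrow> s' \<in> half_plane 0 \<Longrightarrow> dist s' s < \<delta> \<Longrightarrow>
      dist (2 powr - \<Phi> s') (2 powr - \<Phi> s :: complex) < \<eta> * 2 powr - M"
    using uc \<eta> unfolding uniformly_continuous_on_def by (metis mult_pos_pos powr_gt_zero zero_neq_numeral)
  show "\<exists>d>0. \<forall>x\<in>?A. \<forall>x'\<in>?A. dist x' x < d \<longrightarrow> dist (\<Phi> x') (\<Phi> x) < e"
  proof (intro exI[of _ \<delta>] conjI \<delta>(1) ballI impI)
    fix s s' assume s: "s \<in> ?A" and s': "s' \<in> ?A" and d: "dist s' s < \<delta>"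
    let ?S = "closed_segment s s'"
    have sub: "?S \<subseteq> half_plane 0"
      using s s' by (intro closed_segment_subset convex_half_plane) auto
    define h where "h z = of_real (ln 2) * (\<Phi> s - \<Phi> z)" for z
    have u: "norm (exp (h z) - 1) < \<eta>" if z: "z \<in> ?S" for z
    proof -
      have "dist z s < \<delta>" using segment_bound1[of z s s'] z d by (simp add: dist_norm norm_minus_commute)
      then have "norm (2 powr - \<Phi> z - 2 powr - \<Phi> s :: complex) < \<eta> * 2 powr - M"
        using \<delta>(2)[of s z] z sub s by (auto simp: dist_norm)
      also have "(2 powr - \<Phi> z - 2 powr - \<Phi> s :: complex) = (exp (h z) - 1) * 2 powr - \<Phi> s"
        by (simp add: p2 h_def left_diff_distrib exp_add[symmetric] algebra_simps)
      also have "norm \<dots> = norm (exp (h z) - 1) * 2 powr - Re (\<Phi> s)"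
        using norm_of_real_powr[of 2 "- \<Phi> s"] by (simp add: norm_mult)
      finally have "norm (exp (h z) - 1) * 2 powr - Re (\<Phi> s) < \<eta> * 2 powr - M" .
      also have "\<dots> \<le> \<eta> * 2 powr - Re (\<Phi> s)" using s \<eta> by (intro mult_left_mono powr_mono) auto
      finally show ?thesis by simp
    qed
    have np: "exp (h z) \<notin> \<real>\<^sub>\<le>\<^sub>0" if "z \<in> ?S" for z
    proof -
      have "Re (exp (h z)) > 0"
      proof -
        have "\<bar>Re (exp (h z) - 1)\<bar> < 1"
          using u[OF that] abs_Re_le_cmod[of "exp (h z) - 1"] unfolding \<eta>_def by linarith
        then show ?thesis by (simp only: minus_complex.sel one_complex.sel)
      qed
      then show ?thesis by (auto simp: complex_nonpos_Reals_iff)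
    qed
    have hc: "continuous_on ?S h" unfolding h_def by (intro continuous_intros continuous_on_subset[OF cont sub])
    have "(\<lambda>z. Ln (exp (h z)) - h z) constant_on ?S"
    proof (rule exp_eq_one_constant_on)
      show "continuous_on ?S (\<lambda>z. Ln (exp (h z)) - h z)" by (intro continuous_intros hc) (use np in auto)
    qed (auto simp: exp_diff)
    \<comment> \<open>At the starting point s both sides vanish, so the constant defect is 0 and
      \<open>h s'\<close> is the principal logarithm, which is small.\<close>
    then have "Ln (exp (h s')) - h s' = Ln (exp (h s)) - h s"
      by (auto simp: constant_on_def)
    also have "h s = 0" by (simp add: h_def)
    finally have "h s' = Ln (exp (h s'))" by simp
    moreover have "norm (Ln (exp (h s'))) < ln 2 * e" using u[of s'] by (intro \<eta>0(2)) (auto simp: \<eta>_def)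
    ultimately have "norm (h s') < ln 2 * e" by simp
    then have "ln 2 * norm (\<Phi> s - \<Phi> s') < ln 2 * e" by (simp add: h_def norm_mult)
    then show "dist (\<Phi> s') (\<Phi> s) < e" by (simp add: dist_norm norm_minus_commute)
  qed
qed

section \<open>Composition with a symbol\<close>

lemma gds_coeff_const: "gds_coeff {1} \<sigma> (\<lambda>_. c) (\<lambda>_. c)"
  by (simp add: gds_coeff_def has_sum_finite_iff)

text \<open>If the constant coefficient lay on the imaginary axis, the next nonzero term, whose argument can be
  prescribed through \<open>Im s\<close>, would push the real part below zero.\<close>

lemma Re_constant_coeff_pos:
  assumes b: "gds_coeff nat_freq \<sigma>0 b \<phi>" and pos: "\<And>s. Re s \<ge> \<sigma>0 \<Longrightarrow> Re (\<phi> s) > 0"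
    and l: "l \<in> nat_freq" "l \<noteq> 1" "b l \<noteq> 0"
  shows "Re (b 1) > 0"
proof -
  define e where "e l = b l - (if l \<in> {1} then b 1 else 0)" for l
  have one: "1 \<in> nat_freq" using freq_monoid_nat_freq by (simp add: freq_monoid_def)
  have e: "gds_coeff nat_freq \<sigma>0 e (\<lambda>s. \<phi> s - b 1)"
    unfolding e_def using one by (intro gds_coeff_diff b gds_coeff_extend gds_coeff_const) auto
  have "e l \<noteq> 0" using l by (simp add: e_def)
  from first_coeff_exists[where a = e, OF discrete_freq_nat_freq l(1) this] obtain \<mu>
    where \<mu>: "\<mu> \<in> nat_freq" "e \<mu> \<noteq> 0" "\<And>k. k \<in> nat_freq \<Longrightarrow> k < \<mu> \<Longrightarrow> e k = 0" by blast
  have "\<mu> \<noteq> 1" using \<mu>(2) by (auto simp: e_def)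
  then have \<mu>1: "\<mu> > 1" using \<mu>(1) nat_freq_ge_1 by force
  obtain \<nu> C where \<nu>: "\<nu> > \<mu>" and le: "\<And>s. Re s \<ge> \<sigma>0 \<Longrightarrow> norm (\<phi> s - b 1 - e \<mu> * of_real \<mu> powr - s) \<le> C * \<nu> powr - Re s"
    using gds_coeff_leading[OF e nat_freq_ge_1 discrete_freq_nat_freq \<mu>(1,3)] by blast
  have "eventually (\<lambda>\<sigma>. C * \<nu> powr - \<sigma> * \<mu> powr \<sigma> < norm (e \<mu>)) at_top"
    using powr_ratio_tendsto_0[of \<mu> \<nu> C] \<nu> \<mu>1 \<mu>(2) by (intro order_tendstoD) auto
  then have "eventually (\<lambda>\<sigma>. \<sigma> \<ge> \<sigma>0 \<and> C * \<nu> powr - \<sigma> * \<mu> powr \<sigma> < norm (e \<mu>)) at_top"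
    using eventually_ge_at_top[of \<sigma>0] by eventually_elim simp
  then obtain \<sigma> where \<sigma>: "\<sigma> \<ge> \<sigma>0" "C * \<nu> powr - \<sigma> * \<mu> powr \<sigma> < norm (e \<mu>)"
    by (auto dest: eventually_happens)
  \<comment> \<open>With \<open>Im s * ln \<mu> = Arg (e \<mu>) + pi\<close> the leading term
    becomes the negative number \<open>- norm (e \<mu>) * \<mu> powr - \<sigma>\<close>, and
    \<sigma> was chosen so that this outweighs the tail.\<close>
  define s where "s = Complex \<sigma> ((Arg (e \<mu>) + pi) / ln \<mu>)"
  let ?\<alpha> = "\<i> * complex_of_real (Arg (e \<mu>))"
  have "of_real \<mu> powr - s = exp (- (of_real (ln \<mu>) * s))"
    using \<mu>1 by (simp add: powr_def Ln_of_real mult.commute)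
  also have "- (of_real (ln \<mu>) * s) = of_real (- \<sigma> * ln \<mu>) - ?\<alpha> - \<i> * of_real pi"
    using \<mu>1 by (simp add: s_def complex_eq_iff)
  finally have pw: "of_real \<mu> powr - s = exp (of_real (- \<sigma> * ln \<mu>) - ?\<alpha> - \<i> * of_real pi)" .
  have "e \<mu> = of_real (norm (e \<mu>)) * exp ?\<alpha>"
    using \<mu>(2) by (simp add: Arg_eq)
  then have "e \<mu> * of_real \<mu> powr - s =
      of_real (norm (e \<mu>)) * (exp ?\<alpha> * exp (of_real (- \<sigma> * ln \<mu>) - ?\<alpha> - \<i> * of_real pi))"
    unfolding pw by (metis mult.assoc)
  also have "exp ?\<alpha> * exp (of_real (- \<sigma> * ln \<mu>) - ?\<alpha> - \<i> * of_real pi) = exp (of_real (- \<sigma> * ln \<mu>)) * exp (- (\<i> * of_real pi))"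
    unfolding exp_add[symmetric] by simp
  also have "exp (- (\<i> * of_real pi)) = -1" by (simp only: exp_minus exp_pi_i') simp
  also have "exp (complex_of_real (- \<sigma> * ln \<mu>)) = of_real (\<mu> powr - \<sigma>)"
    using \<mu>1 by (simp only: exp_of_real powr_def) simp
  finally have "e \<mu> * of_real \<mu> powr - s = - of_real (norm (e \<mu>) * \<mu> powr - \<sigma>)" by simp
  with le[of s] \<sigma>(1) have "norm (\<phi> s - b 1 + of_real (norm (e \<mu>) * \<mu> powr - \<sigma>)) \<le> C * \<nu> powr - \<sigma>"
    by (simp add: s_def)
  then have "Re (\<phi> s - b 1 + of_real (norm (e \<mu>) * \<mu> powr - \<sigma>)) \<le> C * \<nu> powr - \<sigma>"
    using complex_Re_le_cmod order_trans by blast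
  then have "Re (\<phi> s) - Re (b 1) + norm (e \<mu>) * \<mu> powr - \<sigma> \<le> C * \<nu> powr - \<sigma>" by simp
  moreover have "C * \<nu> powr - \<sigma> < norm (e \<mu>) * \<mu> powr - \<sigma>"
  proof -
    have "C * \<nu> powr - \<sigma> * \<mu> powr \<sigma> * \<mu> powr - \<sigma> < norm (e \<mu>) * \<mu> powr - \<sigma>"
      using \<sigma>(2) \<mu>1 by (intro mult_strict_right_mono) auto
    then show ?thesis using \<mu>1 by (simp add: mult.assoc powr_add[symmetric])
  qed
  moreover have "Re (\<phi> s) > 0" using \<sigma>(1) by (intro pos) (simp add: s_def)
  ultimately show ?thesis by linarith
qed

text \<open>The n-th term of \<open>f (c * s + \<phi> s)\<close> is a monomial of frequency
  \<open>n ^ c\<close> times \<open>exp (- ln n * \<phi> s)\<close>. The exponential has coefficient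
  norm at most \<open>n powr K0\<close>, a growth that the monomial compensates at a large abscissa
  because c is at least 1.\<close>

lemma gds_compose_linear:
  assumes a: "has_dirichlet_series_on a f (half_plane 0)" and \<phi>: "gds nat_freq \<sigma>0 K0 \<phi>" and c: "c \<ge> (1::nat)"
    and map: "\<And>s. Re s \<ge> \<sigma>0 \<Longrightarrow> Re (of_nat c * s + \<phi> s) > 0"
  shows "\<exists>\<sigma> K. gds nat_freq \<sigma> K (\<lambda>s. f (of_nat c * s + \<phi> s))"
proof -
  \<comment> \<open>\<open>K0 + 2\<close> leaves a factor \<open>n powr - 2\<close>, against which
    the coefficients of f are absolutely summable; nonnegativity gives
    \<open>\<sigma> \<le> c * \<sigma>\<close>.\<close>
  define \<sigma> where "\<sigma> = max \<sigma>0 (max 0 (K0 + 2))"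
  have \<phi>': "gds nat_freq \<sigma> K0 \<phi>" by (rule gds_mono_abscissa[OF \<phi> nat_freq_ge_1]) (simp add: \<sigma>_def)
  have "summable (\<lambda>n. a (Suc n) * of_nat (Suc n) powr - (1 / 2))"
    using a by (auto simp: has_dirichlet_series_on_def half_plane_def sums_iff)
  then have sm: "summable (\<lambda>n. norm (a (Suc n)) * real (Suc n) powr - 2)"
    by (rule dirichlet_abs_summable) simp
  define L where "L n = ln (real (Suc n))" for n
  define g where "g n s = (a (Suc n) * of_real (real (Suc n) ^ c) powr - s) * exp (- of_real (L n) * \<phi> s)" for n s
  have gg: "gds nat_freq \<sigma> (norm (a (Suc n)) * real (Suc n) powr - 2) (g n)" for n
  proof -
    have "real (Suc n) ^ c \<in> nat_freq" unfolding nat_freq_iff by (intro exI[of _ "Suc n ^ c"]) auto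
    then have "gds nat_freq \<sigma> ((norm (a (Suc n)) * (real (Suc n) ^ c) powr - \<sigma>) * exp (norm (- complex_of_real (L n)) * K0)) (g n)"
      unfolding g_def
      by (intro gds_times gds_monomial gds_exp gds_cmult \<phi>' freq_monoid_nat_freq nat_freq_ge_1)
    moreover have "(norm (a (Suc n)) * (real (Suc n) ^ c) powr - \<sigma>) * exp (norm (- complex_of_real (L n)) * K0)
        \<le> norm (a (Suc n)) * real (Suc n) powr - 2"
    proof -
      have L: "L n \<ge> 0" by (simp add: L_def)
      have "(real (Suc n) ^ c) powr - \<sigma> * exp (norm (- complex_of_real (L n)) * K0) = exp (- (real c * \<sigma>) * L n + K0 * L n)"
      proof -
        have 1: "(real (Suc n) ^ c) powr - \<sigma> = exp (- (real c * \<sigma>) * L n)"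
          by (simp add: powr_def ln_realpow L_def mult_ac del: of_nat_Suc)
        have 2: "norm (- complex_of_real (L n)) * K0 = K0 * L n" using L by simp
        show ?thesis unfolding 1 2 exp_add[symmetric] by (rule refl)
      qed
      also have "\<dots> \<le> exp (- 2 * L n)"
      proof -
        have "\<sigma> \<le> real c * \<sigma>" using c by (intro mult_right_mono[of 1 "real c" \<sigma>, simplified]) (auto simp: \<sigma>_def)
        then have "K0 + 2 \<le> real c * \<sigma>" by (simp add: \<sigma>_def)
        from mult_right_mono[OF this L] show ?thesis by (simp add: algebra_simps)
      qed
      also have "\<dots> = real (Suc n) powr - 2" by (simp add: powr_def L_def)
      finally show ?thesis by (simp only: mult.assoc) (intro mult_left_mono, auto)
    qed
    ultimately show ?thesis by (rule gds_mono)
  qed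
  have gs: "(\<lambda>n. g n s) sums f (of_nat c * s + \<phi> s)" if s: "Re s \<ge> \<sigma>" for s
  proof -
    have "of_nat c * s + \<phi> s \<in> half_plane 0" using map[of s] s by (simp add: half_plane_def \<sigma>_def)
    then have "(\<lambda>n. a (Suc n) * of_nat (Suc n) powr - (of_nat c * s + \<phi> s)) sums f (of_nat c * s + \<phi> s)"
      using a unfolding has_dirichlet_series_on_def by blast
    moreover have "a (Suc n) * of_nat (Suc n) powr - (of_nat c * s + \<phi> s) = g n s" for n
    proof -
      have 1: "of_nat (Suc n) powr z = exp (z * of_real (L n))" for z :: complex
        by (simp add: powr_def L_def Ln_of_nat del: of_nat_Suc)
      have 2: "of_real (real (Suc n) ^ c) powr z = exp (z * of_real (real c * L n))" for z :: complex
      proof -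
        have "Ln (of_real (real (Suc n) ^ c)) = of_real (real c * L n)"
          by (subst Ln_of_real) (simp_all add: L_def ln_realpow del: of_nat_Suc)
        then show ?thesis by (simp add: powr_def del: of_nat_Suc of_real_power)
      qed
      show ?thesis unfolding g_def 1 2 by (simp add: exp_add[symmetric] algebra_simps mult.assoc)
    qed
    ultimately show ?thesis by simp
  qed
  from gds_sum[OF gg sm nat_freq_ge_1 gs] show ?thesis by blast
qed

text \<open>Without a linear part nothing offsets the growth \<open>n powr K0\<close> of the
  exponentials, so the Taylor series of f at \<open>b 1\<close> replaces its Dirichlet series. The
  disc of radius \<open>Re (b 1)\<close> lies in the half-plane, and far to the right
  \<open>\<phi> - b 1\<close> has coefficient norm at most half that radius. A constant \<phi> is
  treated separately.\<close>

lemma gds_compose_holomorphic: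
  assumes f: "f holomorphic_on half_plane 0" and b: "gds_coeff nat_freq \<sigma>0 b \<phi>"
    and map: "\<And>s. Re s \<ge> \<sigma>0 \<Longrightarrow> Re (\<phi> s) > 0"
  shows "\<exists>\<sigma>\<ge>\<sigma>0. \<exists>K. gds nat_freq \<sigma> K (\<lambda>s. f (\<phi> s))"
proof (cases "\<exists>l\<in>nat_freq. l \<noteq> 1 \<and> b l \<noteq> 0")
  case False
  have one: "1 \<in> nat_freq" using freq_monoid_nat_freq by (simp add: freq_monoid_def)
  have "\<phi> s = b 1" if "Re s \<ge> \<sigma>0" for s
  proof -
    have "((\<lambda>l. b l * of_real l powr - s) has_sum \<phi> s) nat_freq" using b that by (simp add: gds_coeff_def)
    moreover have "((\<lambda>l. b l * of_real l powr - s) has_sum b 1) nat_freq"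
      using False one by (intro has_sum_finite_neutralI[of "{1}"]) auto
    ultimately show ?thesis by (rule has_sum_unique)
  qed
  then have "gds nat_freq \<sigma>0 (norm (f (b 1))) (\<lambda>s. f (\<phi> s))"
    by (intro gds_cong[OF gds_const[OF nat_freq_ge_1 one]]) simp
  then show ?thesis by blast
next
  case True
  then have r: "Re (b 1) > 0" using Re_constant_coeff_pos[OF b map] by blast
  define r where "r = Re (b 1)"
  have one: "1 \<in> nat_freq" using freq_monoid_nat_freq by (simp add: freq_monoid_def)
  obtain \<sigma> where \<sigma>: "\<sigma> \<ge> \<sigma>0" and \<psi>: "gds nat_freq \<sigma> (r / 2) (\<lambda>s. \<phi> s - b 1)"
    using gds_coeff_minus_const[OF b nat_freq_ge_1 discrete_freq_nat_freq one, of "r / 2"] r by (auto simp: r_def)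
  have "ball (b 1) r \<subseteq> half_plane 0"
  proof
    fix z assume "z \<in> ball (b 1) r"
    then show "z \<in> half_plane 0"
      using abs_Re_le_cmod[of "b 1 - z"] by (simp add: half_plane_def dist_norm r_def)
  qed
  then have fb: "f holomorphic_on ball (b 1) r" using f holomorphic_on_subset by blast
  define p where "p k = (deriv ^^ k) f (b 1) / fact k" for k
  have p: "(\<lambda>k. p k * (w - b 1) ^ k) sums f w" if "w \<in> ball (b 1) r" for w
    using holomorphic_power_series[OF fb that] by (simp add: p_def)
  \<comment> \<open>Convergence at the larger radius \<open>3 * r / 4\<close> yields absolute
    convergence at \<open>r / 2\<close>.\<close>
  have "summable (\<lambda>k. p k * (of_real (3 * r / 4)) ^ k)"
    using p[of "b 1 + of_real (3 * r / 4)"] r by (simp add: dist_norm r_def sums_iff)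
  then have "summable (\<lambda>k. norm (p k * of_real (r / 2) ^ k))"
    by (rule powser_insidea) (use r in \<open>simp add: r_def\<close>)
  then have "summable (\<lambda>k. norm (p k) * (r / 2) ^ k)"
    using r by (simp add: norm_mult norm_power r_def)
  moreover have "(\<lambda>k. p k * (\<phi> s - b 1) ^ k) sums f (\<phi> s)" if "Re s \<ge> \<sigma>" for s
  proof (rule p)
    show "\<phi> s \<in> ball (b 1) r"
      using gds_norm_le[OF \<psi> nat_freq_ge_1 that] r by (simp add: dist_norm norm_minus_commute r_def)
  qed
  ultimately have "gds nat_freq \<sigma> (\<Sum>k. norm (p k) * (r / 2) ^ k) (\<lambda>s. f (\<phi> s))"
    by (intro gds_power_series[OF \<psi> freq_monoid_nat_freq])
  then show ?thesis using \<sigma> by blast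
qed

lemma gds_compose:
  assumes f: "f \<in> dirichlet_algebra" and \<Phi>: "\<Phi> \<in> G_infinity"
  shows "\<exists>\<sigma> K. gds nat_freq \<sigma> K (f \<circ> \<Phi>)"
proof -
  obtain a where a: "has_dirichlet_series_on a f (half_plane 0)" using f by (auto simp: dirichlet_algebra_def)
  obtain c :: nat and \<phi> where \<phi>: "\<phi> \<in> dirichlet_class" and eq: "\<And>s. s \<in> half_plane 0 \<Longrightarrow> \<Phi> s = of_nat c * s + \<phi> s"
    and map: "\<Phi> \<in> half_plane 0 \<rightarrow> half_plane 0"
    using \<Phi> by (auto simp: G_infinity_def)
  obtain b \<theta> where "has_dirichlet_series_on b \<phi> (half_plane \<theta>)" using \<phi> by (auto simp: dirichlet_class_def)
  then have b: "gds_coeff nat_freq (max \<theta> 0 + 2) (\<lambda>l. b (nat \<lfloor>l\<rfloor>)) \<phi>"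
    by (rule has_dirichlet_series_on_gds_coeff) simp
  then obtain K0 where K0: "gds nat_freq (max \<theta> 0 + 2) K0 \<phi>" unfolding gds_def by blast
  have pos: "Re (of_nat c * s + \<phi> s) > 0" if "Re s \<ge> max \<theta> 0 + 2" for s
  proof -
    have "s \<in> half_plane 0" using that by (simp add: half_plane_def)
    then show ?thesis using map eq[of s] by (force simp: half_plane_def)
  qed
  have "\<exists>\<sigma> K. gds nat_freq \<sigma> K (\<lambda>s. f (of_nat c * s + \<phi> s))"
  proof (cases "c = 0")
    case True
    then show ?thesis
      using gds_compose_holomorphic[OF dirichlet_series_holomorphic[OF a] b] pos by auto
  next
    case False
    then show ?thesis using gds_compose_linear[OF a K0 _ pos] by simp
  qed
  then obtain \<sigma> K where "gds nat_freq \<sigma> K (\<lambda>s. f (of_nat c * s + \<phi> s))" by blast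
  \<comment> \<open>The formula for \<Phi> holds only on \<open>half_plane 0\<close>, so the
    abscissa is first made positive.\<close>
  then have "gds nat_freq (max \<sigma> 1) K (\<lambda>s. f (of_nat c * s + \<phi> s))"
    by (rule gds_mono_abscissa[OF _ nat_freq_ge_1]) simp
  then have "gds nat_freq (max \<sigma> 1) K (f \<circ> \<Phi>)"
    by (rule gds_cong) (simp add: eq half_plane_def)
  then show ?thesis by blast
qed

lemma uniformly_continuous_on_compose_G_algebra:
  assumes f: "f \<in> dirichlet_algebra" and \<Phi>: "\<Phi> \<in> G_algebra"
  shows "uniformly_continuous_on (half_plane 0) (f \<circ> \<Phi>)"
  unfolding uniformly_continuous_on_def
proof (intro allI impI)
  fix e :: real assume e: "e > 0"
  obtain a where a: "has_dirichlet_series_on a f (half_plane 0)" and uf: "uniformly_continuous_on (half_plane 0) f"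
    using f by (auto simp: dirichlet_algebra_def)
  have hol: "\<Phi> holomorphic_on half_plane 0" and map: "\<And>s. s \<in> half_plane 0 \<Longrightarrow> \<Phi> s \<in> half_plane 0"
    using \<Phi> by (auto simp: G_algebra_def G_infinity_def)
  have "e / 3 > 0" using e by simp
  then obtain M where M: "M > 0" "\<And>s. Re s \<ge> M \<Longrightarrow> norm (f s - a 1) \<le> e / 3"
    using dirichlet_uniform_limit_infinity[OF a] by metis
  obtain \<eta> where \<eta>: "\<eta> > 0" "\<And>z z'. z \<in> half_plane 0 \<Longrightarrow> z' \<in> half_plane 0 \<Longrightarrow> dist z' z < \<eta> \<Longrightarrow> dist (f z') (f z) < e"
    using uf e unfolding uniformly_continuous_on_def by metis
  let ?A = "{s \<in> half_plane 0. 0 < Re (\<Phi> s) \<and> Re (\<Phi> s) < M + 1}"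
  have uA: "uniformly_continuous_on ?A \<Phi>" using \<Phi> M by (simp add: G_algebra_def)
  have "min \<eta> (1 / 2) > 0" using \<eta> by simp
  from uA[unfolded uniformly_continuous_on_def, rule_format, OF this]
  obtain \<delta> where \<delta>: "\<delta> > 0"
    "\<And>s s'. s \<in> ?A \<Longrightarrow> s' \<in> ?A \<Longrightarrow> dist s' s < \<delta> \<Longrightarrow> dist (\<Phi> s') (\<Phi> s) < min \<eta> (1 / 2)"
    by blast
  \<comment> \<open>The mixed case, one point below level M and its neighbour far above, is not
    covered by continuity of \<Phi> on \<open>?A\<close> directly. If it occurred, some z on the
    segment would have \<open>Re (\<Phi> z) = M + 1 / 2\<close>; then z lies in \<open>?A\<close>
    within \<delta> of s, while \<Phi> changes by more than \<open>1 / 2\<close>. The buffer from M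
    to M + 1 exists for this argument.\<close>
  have near: "Re (\<Phi> s') < M + 1" if s: "s \<in> half_plane 0" "s' \<in> half_plane 0" "dist s' s < \<delta>" "Re (\<Phi> s) < M" for s s'
  proof (rule ccontr)
    assume *: "\<not> Re (\<Phi> s') < M + 1"
    let ?S = "closed_segment s s'"
    have sub: "?S \<subseteq> half_plane 0" using s by (intro closed_segment_subset convex_half_plane) auto
    have "continuous_on (linepath s s' ` {0..1}) \<Phi>"
      unfolding linepath_image_01 by (rule continuous_on_subset[OF holomorphic_on_imp_continuous_on[OF hol] sub])
    from continuous_on_Re[OF continuous_on_compose[OF continuous_on_linepath this]]
    have "continuous_on {0..1} (\<lambda>t. Re (\<Phi> (linepath s s' t)))" by (simp add: o_def)
    moreover have "Re (\<Phi> (linepath s s' 0)) \<le> M + 1 / 2" "M + 1 / 2 \<le> Re (\<Phi> (linepath s s' 1))"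
      using s(4) * by (simp_all add: linepath_0' linepath_1')
    ultimately obtain t where t: "0 \<le> t" "t \<le> 1" "Re (\<Phi> (linepath s s' t)) = M + 1 / 2"
      using IVT'[of "\<lambda>t. Re (\<Phi> (linepath s s' t))" 0 "M + 1 / 2" 1] by auto
    define z where "z = linepath s s' t"
    have z: "z \<in> ?S" unfolding z_def linepath_image_01[symmetric] using t by auto
    have zh: "z \<in> half_plane 0" using z sub by auto
    have "dist z s < \<delta>" using segment_bound1[OF z] s by (simp add: dist_norm norm_minus_commute)
    moreover have "z \<in> ?A" using zh map[OF zh] t M by (simp add: z_def half_plane_def)
    moreover have "s \<in> ?A" using s map[OF s(1)] by (simp add: half_plane_def)
    ultimately have "dist (\<Phi> z) (\<Phi> s) < 1 / 2" using \<delta>(2)[of s z] by simp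
    then show False
      using abs_Re_le_cmod[of "\<Phi> z - \<Phi> s"] t s by (simp add: dist_norm z_def)
  qed
  show "\<exists>d>0. \<forall>s\<in>half_plane 0. \<forall>s'\<in>half_plane 0. dist s' s < d \<longrightarrow> dist ((f \<circ> \<Phi>) s') ((f \<circ> \<Phi>) s) < e"
  proof (intro exI[of _ \<delta>] conjI \<delta>(1) ballI impI)
    fix s s' assume s: "s \<in> half_plane 0" "s' \<in> half_plane 0" "dist s' s < \<delta>"
    show "dist ((f \<circ> \<Phi>) s') ((f \<circ> \<Phi>) s) < e"
    proof (cases "Re (\<Phi> s) \<ge> M \<and> Re (\<Phi> s') \<ge> M")
      case True
      then have "norm (f (\<Phi> s) - a 1) \<le> e / 3" "norm (f (\<Phi> s') - a 1) \<le> e / 3" using M by auto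
      then have "dist (f (\<Phi> s')) (f (\<Phi> s)) \<le> e / 3 + e / 3"
        using dist_triangle2[of "f (\<Phi> s')" "f (\<Phi> s)" "a 1"] by (simp add: dist_norm)
      then show ?thesis using e by simp
    next
      case False
      then have "Re (\<Phi> s) < M + 1 \<and> Re (\<Phi> s') < M + 1"
        using near[OF s] near[OF s(2,1)] s(3) by (auto simp: dist_commute not_le)
      then have "s \<in> ?A" "s' \<in> ?A" using s map[of s] map[of s'] by (auto simp: half_plane_def)
      then have "dist (\<Phi> s') (\<Phi> s) < \<eta>" using \<delta>(2)[of s s'] s by simp
      then show ?thesis using \<eta>(2) map s by simp
    qed
  qed
qed

lemma compose_G_algebra:
  assumes f: "f \<in> dirichlet_algebra" and \<Phi>: "\<Phi> \<in> G_algebra"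
  shows "f \<circ> \<Phi> \<in> dirichlet_algebra"
proof -
  have G: "\<Phi> \<in> G_infinity" using \<Phi> by (simp add: G_algebra_def)
  then have hol: "\<Phi> holomorphic_on half_plane 0" and map: "\<Phi> \<in> half_plane 0 \<rightarrow> half_plane 0"
    by (auto simp: G_infinity_def)
  obtain a where "has_dirichlet_series_on a f (half_plane 0)" using f by (auto simp: dirichlet_algebra_def)
  then have fh: "f holomorphic_on half_plane 0" by (rule dirichlet_series_holomorphic)
  obtain B where B: "\<And>s. s \<in> half_plane 0 \<Longrightarrow> norm (f s) \<le> B" using dirichlet_algebra_bounded[OF f] by blast
  obtain \<sigma> K where "gds nat_freq \<sigma> K (f \<circ> \<Phi>)" using gds_compose[OF f G] by blast
  then obtain b where b: "summable (\<lambda>n. norm (b (Suc n)) * real (Suc n) powr - \<sigma>)"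
    "\<And>s. Re s \<ge> \<sigma> \<Longrightarrow> (\<lambda>n. b (Suc n) * of_nat (Suc n) powr - s) sums (f \<circ> \<Phi>) s"
    using gds_imp_dirichlet by blast
  have "has_dirichlet_series_on b (f \<circ> \<Phi>) (half_plane 0)"
  proof (rule bohr_convergence[OF _ _ b])
    show "f \<circ> \<Phi> holomorphic_on half_plane 0"
      using hol fh map by (intro holomorphic_on_compose_gen) auto
    show "norm ((f \<circ> \<Phi>) s) \<le> B" if "s \<in> half_plane 0" for s using B map that by auto
  qed
  then show ?thesis
    using uniformly_continuous_on_compose_G_algebra[OF f \<Phi>] by (auto simp: dirichlet_algebra_def)
qed

theorem theorem1p3:
  fixes \<Phi> :: "complex \<Rightarrow> complex"
  assumes "\<Phi> holomorphic_on half_plane 0"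
    and "\<Phi> \<in> half_plane 0 \<rightarrow> half_plane 0"
  shows "bounded_operator_on_algebra (composition_operator \<Phi>) \<longleftrightarrow> \<Phi> \<in> G_algebra"
proof
  assume bdd: "bounded_operator_on_algebra (composition_operator \<Phi>)"
  have pw: "(\<lambda>s. of_nat n powr - \<Phi> s) \<in> dirichlet_algebra" if "n \<ge> 1" for n
    using bdd power_in_dirichlet_algebra[OF that]
    unfolding bounded_operator_on_algebra_def composition_operator_def by (auto simp: o_def)
  have "\<Phi> \<in> G_infinity"
    using pw by (intro G_infinity_of_powers assms) (auto simp: dirichlet_algebra_def)
  moreover have "uniformly_continuous_on (half_plane 0) (\<lambda>s. 2 powr - \<Phi> s)"
    using pw[of 2] by (simp add: dirichlet_algebra_def)
  ultimately show "\<Phi> \<in> G_algebra"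
    using uniformly_continuous_on_of_power[OF holomorphic_on_imp_continuous_on[OF assms(1)]]
    by (auto simp: G_algebra_def)
next
  assume \<Phi>: "\<Phi> \<in> G_algebra"
  \<comment> \<open>The operator is a contraction because \<Phi> maps the half-plane into itself;
    boundedness of f makes the real supremum an actual upper bound.\<close>
  have "sup_norm (f \<circ> \<Phi>) \<le> 1 * sup_norm f" if f: "f \<in> dirichlet_algebra" for f
  proof -
    obtain B where B: "\<And>s. s \<in> half_plane 0 \<Longrightarrow> norm (f s) \<le> B" using dirichlet_algebra_bounded[OF f] by blast
    have "1 \<in> half_plane 0" by (simp add: half_plane_def)
    moreover have "norm ((f \<circ> \<Phi>) s) \<le> sup_norm f" if "s \<in> half_plane 0" for s
      unfolding sup_norm_def o_def using assms(2) that B by (intro cSUP_upper bdd_aboveI2[of _ _ B]) auto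
    ultimately show ?thesis unfolding sup_norm_def[of "f \<circ> \<Phi>"] by (auto intro!: cSUP_least)
  qed
  then show "bounded_operator_on_algebra (composition_operator \<Phi>)"
    using compose_G_algebra[OF _ \<Phi>]
    unfolding bounded_operator_on_algebra_def composition_operator_def by (auto intro!: exI[of _ 1])
qed

end
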